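(* Let $\mathbb{Z}[1/3]\subset\mathbb{Q}$ be the subring generated by $1/3$. The cohomology of the discrete group $SL_2(\mathbb{Z}[1/3])$ with trivial integer coefficients satisfies $$H^i(SL_2(\mathbb{Z}[1/3]), \mathbb{Z}) \cong \begin{cases} 0 & \text{if } i \text{ is odd}; \\ \mathbb{Z} \oplus \mathbb{Z}/4 & \text{if } i = 2; \\ \mathbb{Z}/12 \oplus \mathbb{Z}/4 & \text{if } i = 2j \text{ with } j > 1 \text{ an integer}. \end{cases}$$
   Context: $H^*(G,\mathbb{Z})$ denotes group cohomology of the discrete group $G$ with coefficients in the trivial $G$-module $\mathbb{Z}$. All isomorphisms are isomorphisms of abelian groups. *)

theory Defs
  imports
    "HOL-Analysis.Determinants"
    "HOL-Algebra.Elementary_Groups"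
    "HOL-Algebra.Generated_Rings"
    "HOL-Algebra.Algebraic_Closure_Type"
begin

section \<open>Group cohomology with trivial integer coefficients\<close>

text \<open>
  We use the cochain complex of \<open>G\<close>-equivariant homomorphisms from the standard
  (homogeneous bar) resolution of \<open>\<int>\<close> over \<open>\<int>[G]\<close> into the trivial module \<open>\<int>\<close>.
  The degree \<open>n\<close> term of the resolution is free abelian on \<open>(n+1)\<close>-tuples of elements of \<open>G\<close>,
  with \<open>G\<close> acting diagonally by left multiplication, so an \<open>n\<close>-cochain is an integer-valued
  function on these tuples that is invariant under this action. To make cochains uniquely
  determined by their values on the tuples, they are required to vanish on all other lists.
\<close>

definition tuples :: "('a, 'b) monoid_scheme \<Rightarrow> nat \<Rightarrow> 'a list set" where
  "tuples G n = {xs. length xs = Suc n \<and> set xs \<subseteq> carrier G}"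

definition cochain_group :: "('a, 'b) monoid_scheme \<Rightarrow> nat \<Rightarrow> ('a list \<Rightarrow> int) monoid" where
  "cochain_group G n =
     \<lparr>carrier = {f. (\<forall>xs. xs \<notin> tuples G n \<longrightarrow> f xs = 0) \<and>
                    (\<forall>g\<in>carrier G. \<forall>xs\<in>tuples G n. f (map (\<lambda>x. g \<otimes>\<^bsub>G\<^esub> x) xs) = f xs)},
      monoid.mult = (\<lambda>f f' xs. f xs + f' xs),
      one = (\<lambda>_. 0)\<rparr>"

definition omit_nth :: "nat \<Rightarrow> 'a list \<Rightarrow> 'a list" where
  "omit_nth i xs = take i xs @ drop (Suc i) xs"

definition coboundary ::
  "('a, 'b) monoid_scheme \<Rightarrow> nat \<Rightarrow> ('a list \<Rightarrow> int) \<Rightarrow> 'a list \<Rightarrow> int" where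
  "coboundary G n f xs =
     (if xs \<in> tuples G (Suc n) then \<Sum>i\<le>Suc n. (-1) ^ i * f (omit_nth i xs) else 0)"

definition cocycle_set :: "('a, 'b) monoid_scheme \<Rightarrow> nat \<Rightarrow> ('a list \<Rightarrow> int) set" where
  "cocycle_set G n =
     kernel (cochain_group G n) (cochain_group G (Suc n)) (coboundary G n)"

definition coboundary_set :: "('a, 'b) monoid_scheme \<Rightarrow> nat \<Rightarrow> ('a list \<Rightarrow> int) set" where
  "coboundary_set G n =
     (case n of 0 \<Rightarrow> {\<one>\<^bsub>cochain_group G 0\<^esub>}
      | Suc m \<Rightarrow> coboundary G m ` carrier (cochain_group G m))"

definition group_cohomology ::
  "('a, 'b) monoid_scheme \<Rightarrow> nat \<Rightarrow> ('a list \<Rightarrow> int) set monoid" where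
  "group_cohomology G n =
     (cochain_group G n)\<lparr>carrier := cocycle_set G n\<rparr> Mod coboundary_set G n"

lemma comm_group_cochain_group: "comm_group (cochain_group G n)"
proof (rule comm_groupI)
  fix f assume f: "f \<in> carrier (cochain_group G n)"
  show "\<exists>f'\<in>carrier (cochain_group G n).
          f' \<otimes>\<^bsub>cochain_group G n\<^esub> f = \<one>\<^bsub>cochain_group G n\<^esub>"
    by (rule bexI[of _ "\<lambda>xs. - f xs"]) (use f in \<open>auto simp: cochain_group_def\<close>)
qed (auto simp: cochain_group_def fun_eq_iff)

lemma omit_nth_map: "omit_nth i (map h xs) = map h (omit_nth i xs)"
  by (simp add: omit_nth_def take_map drop_map)

lemma omit_nth_tuples: "xs \<in> tuples G (Suc n) \<Longrightarrow> i \<le> Suc n \<Longrightarrow> omit_nth i xs \<in> tuples G n"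
  by (auto simp: tuples_def omit_nth_def dest!: in_set_takeD in_set_dropD)

lemma omit_nth_omit_nth:
  assumes "j \<le> i" "i < length xs"
  shows "omit_nth i (omit_nth j xs) = omit_nth j (omit_nth (Suc i) xs)"
  using assms by (simp add: omit_nth_def min_def Suc_diff_le drop_take)

lemma coboundary_hom:
  assumes "group G"
  shows "coboundary G n \<in> hom (cochain_group G n) (cochain_group G (Suc n))"
proof (rule homI)
  interpret group G by fact
  fix f assume f: "f \<in> carrier (cochain_group G n)"
  have "coboundary G n f (map (\<lambda>x. g \<otimes>\<^bsub>G\<^esub> x) xs) = coboundary G n f xs"
    if g: "g \<in> carrier G" and xs: "xs \<in> tuples G (Suc n)" for g xs
  proof -
    have "map (\<lambda>x. g \<otimes>\<^bsub>G\<^esub> x) xs \<in> tuples G (Suc n)"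
      using g xs by (auto simp: tuples_def)
    moreover have "f (map (\<lambda>x. g \<otimes>\<^bsub>G\<^esub> x) (omit_nth i xs)) = f (omit_nth i xs)"
      if "i \<le> Suc n" for i
      using f g omit_nth_tuples[OF xs that] by (auto simp: cochain_group_def)
    ultimately show ?thesis
      using xs by (auto simp: coboundary_def omit_nth_map intro!: sum.cong)
  qed
  then show "coboundary G n f \<in> carrier (cochain_group G (Suc n))"
    by (auto simp: cochain_group_def coboundary_def)
qed (auto simp: cochain_group_def coboundary_def fun_eq_iff sum.distrib algebra_simps)

lemma coboundary_coboundary: "coboundary G (Suc n) (coboundary G n f) = (\<lambda>_. 0)"
proof
  fix xs
  show "coboundary G (Suc n) (coboundary G n f) xs = 0"
  proof (cases "xs \<in> tuples G (Suc (Suc n))")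
    case xs: True
    define N where "N = Suc n"
    define t where "t = (\<lambda>(j, i). (-1) ^ (j + i) * f (omit_nth i (omit_nth j xs)))"
    define A where "A = {(j, i). j \<le> Suc N \<and> i \<le> N \<and> j \<le> i}"
    define B where "B = {(j, i). j \<le> Suc N \<and> i \<le> N \<and> i < j}"
    have fin: "finite A" "finite B"
      by (rule finite_subset[of _ "{..Suc N} \<times> {..N}"]; force simp: A_def B_def)+
    have "coboundary G (Suc n) (coboundary G n f) xs
            = (\<Sum>j\<le>Suc N. \<Sum>i\<le>N. t (j, i))"
      using xs omit_nth_tuples[OF xs]
      by (simp add: coboundary_def N_def t_def sum_distrib_left power_add mult.assoc
               del: sum.atMost_Suc)
    also have "\<dots> = sum t ({..Suc N} \<times> {..N})"
      by (simp add: sum.cartesian_product del: sum.atMost_Suc)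
    also have "{..Suc N} \<times> {..N} = A \<union> B"
      by (auto simp: A_def B_def)
    also have "sum t (A \<union> B) = sum t A + sum t B"
      by (rule sum.union_disjoint) (use fin in \<open>auto simp: A_def B_def\<close>)
    also have "sum t A = (\<Sum>p\<in>B. - t p)"
    proof (rule sum.reindex_bij_witness[where j = "\<lambda>(j, i). (Suc i, j)"
                                         and i = "\<lambda>(j, i). (i, j - 1)"])
      fix p assume p: "p \<in> A"
      obtain j i where ji: "p = (j, i)" by (cases p)
      have "j \<le> i" "i < length xs"
        using p xs by (auto simp: A_def ji tuples_def N_def)
      then show "- t (case p of (j, i) \<Rightarrow> (Suc i, j)) = t p"
        by (simp add: t_def ji omit_nth_omit_nth add.commute)
    qed (auto simp: A_def B_def)
    finally show ?thesis by (simp add: sum_negf)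
  qed (simp add: coboundary_def)
qed

lemma comm_group_group_cohomology:
  assumes "group G"
  shows "comm_group (group_cohomology G n)"
proof -
  interpret C: comm_group "cochain_group G n" by (rule comm_group_cochain_group)
  have hom: "group_hom (cochain_group G m) (cochain_group G (Suc m)) (coboundary G m)" for m
    using coboundary_hom[OF assms] comm_group.axioms(2)[OF comm_group_cochain_group]
    by (auto simp: group_hom_def group_hom_axioms_def)
  have Z: "subgroup (cocycle_set G n) (cochain_group G n)"
    unfolding cocycle_set_def by (rule group_hom.subgroup_kernel[OF hom])
  have B: "subgroup (coboundary_set G n) (cochain_group G n)"
    by (cases n) (use group_hom.img_is_subgroup[OF hom] C.triv_subgroup in
      \<open>auto simp: coboundary_set_def\<close>)
  have "coboundary_set G n \<subseteq> cocycle_set G n"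
  proof (cases n)
    case 0
    then show ?thesis
      using subgroup.one_closed[OF Z] by (simp add: coboundary_set_def)
  next
    case (Suc m)
    then show ?thesis
      using hom_carrier[OF coboundary_hom[OF assms, of m]] coboundary_coboundary[of G m]
      by (auto simp: coboundary_set_def cocycle_set_def kernel_def cochain_group_def)
  qed
  then have "subgroup (coboundary_set G n) ((cochain_group G n)\<lparr>carrier := cocycle_set G n\<rparr>)"
    by (rule C.subgroup_incl[OF B Z])
  moreover have "comm_group ((cochain_group G n)\<lparr>carrier := cocycle_set G n\<rparr>)"
    by (rule group.group_comm_groupI[OF C.subgroup_imp_group[OF Z]])
      (simp add: cochain_group_def add.commute)
  ultimately show ?thesis
    unfolding group_cohomology_def by (rule comm_group.abelian_FactGroup[rotated])
qed


section \<open>Special linear groups\<close>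

text \<open>\<open>R\<close> is meant to be (the underlying set of) a subring of the ambient ring.\<close>

definition special_linear_group :: "'a::comm_ring_1 set \<Rightarrow> ('a ^ 'n ^ 'n) monoid" where
  "special_linear_group R =
     \<lparr>carrier = {A. (\<forall>i j. A $ i $ j \<in> R) \<and> det A = 1},
      monoid.mult = (**),
      one = mat 1\<rparr>"

definition Z_third :: "rat set" where
  "Z_third = generate_ring ring_of_type_algebra {1/3}"

definition SL2_Z_third :: "(rat ^ 2 ^ 2) monoid" where
  "SL2_Z_third = special_linear_group Z_third"

lemma Z_third_closed:
  shows "0 \<in> Z_third" and "1 \<in> Z_third" and "1/3 \<in> Z_third"
    and "x \<in> Z_third \<Longrightarrow> - x \<in> Z_third"
    and "x \<in> Z_third \<Longrightarrow> y \<in> Z_third \<Longrightarrow> x + y \<in> Z_third"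
    and "x \<in> Z_third \<Longrightarrow> y \<in> Z_third \<Longrightarrow> x * y \<in> Z_third"
proof -
  let ?Q = "ring_of_type_algebra :: rat ring"
  interpret Q: ring ?Q by (rule ring_from_type_algebra)
  have ops: "\<one>\<^bsub>?Q\<^esub> = 1" "\<zero>\<^bsub>?Q\<^esub> = 0" "x \<oplus>\<^bsub>?Q\<^esub> y = x + y" "x \<otimes>\<^bsub>?Q\<^esub> y = x * y"
    and carr: "z \<in> carrier ?Q" for x y z
    by (simp_all add: ring_of_type_algebra_def)
  have minus: "\<ominus>\<^bsub>?Q\<^esub> x = - x" for x
    using Q.r_neg[OF carr, of x] by (simp add: ops eq_neg_iff_add_eq_0 add.commute)
  show one: "1 \<in> Z_third"
    using generate_ring.one[of ?Q] by (simp add: Z_third_def ops)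
  show "1/3 \<in> Z_third"
    by (simp add: Z_third_def generate_ring.incl)
  show m: "- x \<in> Z_third" if "x \<in> Z_third" for x
    using generate_ring.a_inv[of x ?Q] that by (simp add: Z_third_def minus)
  show p: "x + y \<in> Z_third" if "x \<in> Z_third" "y \<in> Z_third" for x y
    using generate_ring.eng_add[of x ?Q _ y] that by (simp add: Z_third_def ops)
  show "x * y \<in> Z_third" if "x \<in> Z_third" "y \<in> Z_third"
    using generate_ring.eng_mult[of x ?Q _ y] that by (simp add: Z_third_def ops)
  show "0 \<in> Z_third"
    using p[OF one m[OF one]] by simp
qed

lemma group_SL2_Z_third: "group SL2_Z_third"
proof (rule groupI)
  fix A assume "A \<in> carrier SL2_Z_third"
  then have R: "A $ i $ j \<in> Z_third" and d: "det A = 1" for i j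
    by (auto simp: SL2_Z_third_def special_linear_group_def)
  define B :: "rat ^ 2 ^ 2" where
    "B = vector [vector [A $ 2 $ 2, - A $ 1 $ 2], vector [- A $ 2 $ 1, A $ 1 $ 1]]"
  have "det B = 1"
    using d by (simp add: B_def det_2 mult.commute)
  moreover have "B $ i $ j \<in> Z_third" for i j
    using exhaust_2[of i] exhaust_2[of j] by (auto simp: B_def R Z_third_closed(4))
  moreover have "B ** A = mat 1"
    using d by (auto simp: B_def det_2 matrix_matrix_mult_def mat_def vec_eq_iff forall_2 sum_2
                  algebra_simps)
  ultimately show "\<exists>B\<in>carrier SL2_Z_third. B \<otimes>\<^bsub>SL2_Z_third\<^esub> A = \<one>\<^bsub>SL2_Z_third\<^esub>"
    by (auto simp: SL2_Z_third_def special_linear_group_def)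
next
  fix A B assume "A \<in> carrier SL2_Z_third" "B \<in> carrier SL2_Z_third"
  then have R: "A $ i $ j \<in> Z_third" "B $ i $ j \<in> Z_third" and d: "det (A ** B) = 1" for i j
    by (auto simp: SL2_Z_third_def special_linear_group_def det_mul)
  have "(A ** B) $ i $ j \<in> Z_third" for i j
    by (simp add: matrix_matrix_mult_def sum_2 R Z_third_closed(5,6))
  with d show "A \<otimes>\<^bsub>SL2_Z_third\<^esub> B \<in> carrier SL2_Z_third"
    by (simp add: SL2_Z_third_def special_linear_group_def)
next
  have "(mat 1 :: rat ^ 2 ^ 2) $ i $ j \<in> Z_third" for i j
    by (simp add: mat_def Z_third_closed(1,2))
  then show "\<one>\<^bsub>SL2_Z_third\<^esub> \<in> carrier SL2_Z_third"
    by (simp add: SL2_Z_third_def special_linear_group_def)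
qed (simp_all add: SL2_Z_third_def special_linear_group_def matrix_mul_assoc)

end

(*
  Write Gamma = SL_2(Z[1/3]). It is the amalgam of A = SL_2(Z) and of its conjugate B by diag(3, 1) along
  C = Gamma_0(3); moreover A = Z/4 *_{Z/2} Z/6 (likewise B) and C = Z/6 *_{Z/2} (Z x Z/2). For a subgroup K,
  the cohomology of K is computed by the K-invariant functions on the tuples of Gamma, so that restriction
  maps are inclusions, and an amalgam K *_M L corresponds to the statements "K-invariant and L-invariant
  together means K *_M L-invariant" and "every M-invariant function is the sum of a K-invariant and an
  L-invariant one"; together they give the Mayer-Vietoris sequence. The second statement says that the
  Bass-Serre graph is a forest, and it is proved by exhibiting a height function for which every vertex has
  a unique lower neighbour.

  Cup product with the Euler class c of the action of Gamma on the circle of rays in R^2 is defined for all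
  these complexes at once, and it is the periodicity map of every finite cyclic group involved. Climbing the
  Mayer-Vietoris sequences shows that odd cohomology vanishes and that H^{2j}(Gamma) is generated by c^j and
  l c^{j-1}, where l in H^2 restricts to 0 on A and to 6c on B. The boundary t of the generator of H^1(C) = Z
  satisfies 12 c = 2 t and 2 l = t in H^2(Gamma), so that the only relation in degree 2 is 12 c = 4 l, while
  2 t c^{j-1} = 0 gives the relations 12 c^j = 0 and 4 l c^{j-1} = 0 for j > 1.
*)
theory Submission
  imports Defs "HOL-Library.Function_Algebras"
begin

section \<open>Cochains invariant under a set of group elements\<close>

text \<open>The exact sequences alone leave an extension problem open: how multiples of c meet the
  image of the connecting map. It is settled on cochains. Without an invariance condition the
  complex is acyclic, so c is the coboundary of a 1-cochain w that is not invariant, and k c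
  vanishes on a subgroup exactly if adding the coboundary of some 0-cochain \<alpha>, a function of
  Rademacher type, makes k w invariant. Under an element of order m dividing k that acts as a
  rotation, \<alpha> changes by the constant k/m up to a multiple of an explicit cochain counting
  crossings of a fixed ray. As U = S T in SL_2(Z), the shear T changes \<alpha> by 12/6 - 12/4 = -1
  on A. In B the matrix T is the cube of the corresponding shear, so there the change is -3. The
  difference 2 of these numbers is the factor 2 in 12 c = 2 t. The numbers 12 = lcm(4, 6) and 6 =
  lcm(6, 2) are orders of c on the vertex and edge groups, both glued along the group of order 2
  generated by -1. The generator t needs a 0-cochain that is invariant under V and -1 and grows by
  one under T; it is assembled from the same functions.\<close>

lemma of_int_fun_apply [simp]: "(of_int k :: 'a \<Rightarrow> int) x = k"
  by (cases k) simp_all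

text \<open>The set \<open>K\<close> is arbitrary. Since \<open>G\<close> is a free set under the subgroup generated by \<open>K\<close>, these
  complexes compute the cohomology of that subgroup.\<close>

definition cochains :: "('a, 'b) monoid_scheme \<Rightarrow> 'a set \<Rightarrow> nat \<Rightarrow> ('a list \<Rightarrow> int) set" where
  "cochains G K n =
     {f. (\<forall>xs. xs \<notin> tuples G n \<longrightarrow> f xs = 0) \<and>
         (\<forall>z\<in>K. \<forall>xs\<in>tuples G n. f (map (\<lambda>x. z \<otimes>\<^bsub>G\<^esub> x) xs) = f xs)}"

definition cocycles :: "('a, 'b) monoid_scheme \<Rightarrow> 'a set \<Rightarrow> nat \<Rightarrow> ('a list \<Rightarrow> int) set" where
  "cocycles G K n = {f \<in> cochains G K n. coboundary G n f = 0}"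

definition coboundaries :: "('a, 'b) monoid_scheme \<Rightarrow> 'a set \<Rightarrow> nat \<Rightarrow> ('a list \<Rightarrow> int) set" where
  "coboundaries G K n =
     (case n of 0 \<Rightarrow> {0} | Suc m \<Rightarrow> coboundary G m ` cochains G K m)"

text \<open>Precomposition with a left translation, hence a right action, see
  \<open>act_mult\<close>. The guard tests the entries but not the length, so that one operator
  serves all degrees.\<close>

definition act :: "('a, 'b) monoid_scheme \<Rightarrow> 'a \<Rightarrow> ('a list \<Rightarrow> int) \<Rightarrow> 'a list \<Rightarrow> int" where
  "act G z f xs = (if set xs \<subseteq> carrier G then f (map (\<lambda>x. z \<otimes>\<^bsub>G\<^esub> x) xs) else 0)"

definition unit_cochain :: "('a, 'b) monoid_scheme \<Rightarrow> 'a list \<Rightarrow> int" where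
  "unit_cochain G xs = (if xs \<in> tuples G 0 then 1 else 0)"

text \<open>The Alexander-Whitney product: the front face of degree \<open>n\<close> and the back
  face of degree \<open>m\<close> share the entry at position \<open>n\<close>.\<close>

definition cup ::
  "('a, 'b) monoid_scheme \<Rightarrow> nat \<Rightarrow> nat \<Rightarrow> ('a list \<Rightarrow> int) \<Rightarrow> ('a list \<Rightarrow> int) \<Rightarrow> 'a list \<Rightarrow> int" where
  "cup G n m f g xs =
     (if xs \<in> tuples G (n + m) then f (take (Suc n) xs) * g (drop n xs) else 0)"

lemma coboundary_add: "coboundary G n (f + g) = coboundary G n f + coboundary G n g"
  by (rule ext) (simp add: coboundary_def sum.distrib algebra_simps del: sum.atMost_Suc)

lemma coboundary_diff: "coboundary G n (f - g) = coboundary G n f - coboundary G n g"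
  by (rule ext) (simp add: coboundary_def sum_subtractf algebra_simps del: sum.atMost_Suc)

text \<open>Integers act through constant functions in the pointwise ring of integer-valued
  functions, so that linear combinations of cochains are normalised by ring arithmetic.\<close>

lemma coboundary_of_int_mult: "coboundary G n (of_int k * f) = of_int k * coboundary G n f"
  by (rule ext) (simp add: coboundary_def sum_distrib_left algebra_simps del: sum.atMost_Suc)

lemma coboundary_zero [simp]: "coboundary G n 0 = 0"
  by (rule ext) (simp add: coboundary_def)

lemma coboundary_twice [simp]: "coboundary G (Suc n) (coboundary G n f) = 0"
  by (simp add: coboundary_coboundary zero_fun_def)

lemmas coboundary_linear = coboundary_add coboundary_diff coboundary_of_int_mult

lemma cochains_zero: "0 \<in> cochains G K n"
  by (simp add: cochains_def)

lemma cochains_add: "f \<in> cochains G K n \<Longrightarrow> g \<in> cochains G K n \<Longrightarrow> f + g \<in> cochains G K n"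
  by (simp add: cochains_def)

lemma cochains_diff: "f \<in> cochains G K n \<Longrightarrow> g \<in> cochains G K n \<Longrightarrow> f - g \<in> cochains G K n"
  by (simp add: cochains_def)

lemma cochains_of_int_mult: "f \<in> cochains G K n \<Longrightarrow> of_int k * f \<in> cochains G K n"
  by (simp add: cochains_def)

lemmas cochains_linear = cochains_zero cochains_add cochains_diff cochains_of_int_mult

lemma cochains_mono: "K \<subseteq> L \<Longrightarrow> f \<in> cochains G L n \<Longrightarrow> f \<in> cochains G K n"
  by (auto simp: cochains_def)

lemma cochains_Un: "cochains G (K \<union> L) n = cochains G K n \<inter> cochains G L n"
  by (auto simp: cochains_def)

lemma cocyclesI: "f \<in> cochains G K n \<Longrightarrow> coboundary G n f = 0 \<Longrightarrow> f \<in> cocycles G K n"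
  by (simp add: cocycles_def)

lemma cocyclesD: "f \<in> cocycles G K n \<Longrightarrow> f \<in> cochains G K n"
  "f \<in> cocycles G K n \<Longrightarrow> coboundary G n f = 0"
  by (simp_all add: cocycles_def)

lemma cocycles_linear:
  "0 \<in> cocycles G K n"
  "f \<in> cocycles G K n \<Longrightarrow> g \<in> cocycles G K n \<Longrightarrow> f + g \<in> cocycles G K n"
  "f \<in> cocycles G K n \<Longrightarrow> g \<in> cocycles G K n \<Longrightarrow> f - g \<in> cocycles G K n"
  "f \<in> cocycles G K n \<Longrightarrow> of_int k * f \<in> cocycles G K n"
  by (simp_all add: cocycles_def cochains_linear coboundary_linear)

lemma cocycles_mono: "K \<subseteq> L \<Longrightarrow> f \<in> cocycles G L n \<Longrightarrow> f \<in> cocycles G K n"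
  by (auto simp: cocycles_def intro: cochains_mono)

lemma coboundaries_Suc: "coboundaries G K (Suc n) = coboundary G n ` cochains G K n"
  by (simp add: coboundaries_def)

lemma coboundaries_0 [simp]: "coboundaries G K 0 = {0}"
  by (simp add: coboundaries_def)

lemma coboundaries_linear:
  "0 \<in> coboundaries G K n"
  "f \<in> coboundaries G K n \<Longrightarrow> g \<in> coboundaries G K n \<Longrightarrow> f + g \<in> coboundaries G K n"
  "f \<in> coboundaries G K n \<Longrightarrow> g \<in> coboundaries G K n \<Longrightarrow> f - g \<in> coboundaries G K n"
  "f \<in> coboundaries G K n \<Longrightarrow> of_int k * f \<in> coboundaries G K n"
proof -
  show "0 \<in> coboundaries G K n"
    by (cases n) (auto simp: coboundaries_Suc image_iff intro!: bexI[of _ 0] cochains_zero)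
  show "f + g \<in> coboundaries G K n" if "f \<in> coboundaries G K n" "g \<in> coboundaries G K n"
    using that by (cases n)
      (auto simp: coboundaries_Suc coboundary_add[symmetric] intro!: imageI cochains_linear)
  show "f - g \<in> coboundaries G K n" if "f \<in> coboundaries G K n" "g \<in> coboundaries G K n"
    using that by (cases n)
      (auto simp: coboundaries_Suc coboundary_diff[symmetric] intro!: imageI cochains_linear)
  show "of_int k * f \<in> coboundaries G K n" if "f \<in> coboundaries G K n"
    using that by (cases n)
      (auto simp: coboundaries_Suc coboundary_of_int_mult[symmetric] intro!: imageI cochains_linear)
qed

lemma coboundaries_mono: "K \<subseteq> L \<Longrightarrow> f \<in> coboundaries G L n \<Longrightarrow> f \<in> coboundaries G K n"
  by (cases n) (auto simp: coboundaries_Suc intro: cochains_mono)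

lemma coboundariesI: "f \<in> cochains G K n \<Longrightarrow> coboundary G n f \<in> coboundaries G K (Suc n)"
  by (simp add: coboundaries_Suc)

lemma coboundariesE:
  assumes "f \<in> coboundaries G K (Suc n)"
  obtains g where "g \<in> cochains G K n" "f = coboundary G n g"
  using assms by (auto simp: coboundaries_Suc)

section \<open>Faces of tuples and the Leibniz rule\<close>

lemma omit_nth_Cons_0 [simp]: "omit_nth 0 (x # xs) = xs"
  by (simp add: omit_nth_def)

lemma omit_nth_Cons_Suc [simp]: "omit_nth (Suc i) (x # xs) = x # omit_nth i xs"
  by (simp add: omit_nth_def)

lemma take_omit_nth:
  "i \<le> n \<Longrightarrow> take (Suc n) (omit_nth i xs) = omit_nth i (take (Suc (Suc n)) xs)"
proof (induction xs arbitrary: n i)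
  case (Cons x xs)
  then show ?case by (cases i; cases n) auto
qed (simp add: omit_nth_def)

lemma drop_omit_nth: "i \<le> n \<Longrightarrow> drop n (omit_nth i xs) = drop (Suc n) xs"
proof (induction xs arbitrary: n i)
  case (Cons x xs)
  then show ?case by (cases i; cases n) auto
qed (simp add: omit_nth_def)

lemma take_omit_nth_ge: "n \<le> i \<Longrightarrow> take n (omit_nth i xs) = take n xs"
proof (induction xs arbitrary: n i)
  case (Cons x xs)
  then show ?case by (cases i; cases n) auto
qed (simp add: omit_nth_def)

lemma drop_omit_nth_ge: "drop n (omit_nth (n + i) xs) = omit_nth i (drop n xs)"
proof (induction xs arbitrary: n)
  case (Cons x xs)
  then show ?case by (cases n) auto
qed (simp add: omit_nth_def)

lemma tuples_take: "xs \<in> tuples G (n + m) \<Longrightarrow> take (Suc n) xs \<in> tuples G n"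
  by (auto simp: tuples_def dest: in_set_takeD)

lemma tuples_drop: "xs \<in> tuples G (n + m) \<Longrightarrow> drop n xs \<in> tuples G m"
  by (auto simp: tuples_def dest: in_set_dropD)

text \<open>Omitting an entry up to position \<open>n\<close> affects the front factor, omitting a
  later one the back factor. The right-hand side has two further terms, the last face of the front
  and the first face of the back; both equal the product \<open>f0 * g0\<close> up to sign and
  cancel.\<close>

lemma coboundary_cup:
  "coboundary G (n + m) (cup G n m f g) =
     cup G (Suc n) m (coboundary G n f) g + (-1) ^ n * cup G n (Suc m) f (coboundary G m g)"
proof
  fix xs
  show "coboundary G (n + m) (cup G n m f g) xs =
     (cup G (Suc n) m (coboundary G n f) g + (-1) ^ n * cup G n (Suc m) f (coboundary G m g)) xs"
  proof (cases "xs \<in> tuples G (Suc (n + m))")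
    case xs: True
    have xs1: "xs \<in> tuples G (Suc n + m)" and xs2: "xs \<in> tuples G (n + Suc m)"
      using xs by simp_all
    have omit: "omit_nth i xs \<in> tuples G (n + m)" if "i \<le> Suc (n + m)" for i
      using omit_nth_tuples[OF xs that] .
    define F where "F i = f (omit_nth i (take (Suc (Suc n)) xs))" for i
    define H where "H i = g (omit_nth i (drop n xs))" for i
    define f0 where "f0 = f (take (Suc n) xs)"
    define g0 where "g0 = g (drop (Suc n) xs)"
    have FSuc: "F (Suc n) = f0"
      using take_omit_nth_ge[of "Suc n" "Suc n" "take (Suc (Suc n)) xs"] xs
      by (simp add: F_def f0_def min_def omit_nth_def tuples_def)
    have H0: "H 0 = g0"
      by (simp add: H_def g0_def omit_nth_def)
    have "coboundary G (n + m) (cup G n m f g) xs =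
       (\<Sum>i\<le>Suc (n + m). (-1) ^ i * (f (take (Suc n) (omit_nth i xs)) * g (drop n (omit_nth i xs))))"
      using xs omit by (simp add: coboundary_def cup_def del: sum.atMost_Suc)
    also have "\<dots> = (\<Sum>i\<le>n. (-1) ^ i * (f (take (Suc n) (omit_nth i xs)) * g (drop n (omit_nth i xs))))
       + (\<Sum>i=Suc n..n + Suc m. (-1) ^ i * (f (take (Suc n) (omit_nth i xs)) * g (drop n (omit_nth i xs))))"
      using sum.ub_add_nat[of 0 n "\<lambda>i. (-1) ^ i * (f (take (Suc n) (omit_nth i xs)) * g (drop n (omit_nth i xs)))" "Suc m"]
      by (simp add: atMost_atLeast0 del: sum.atMost_Suc sum.cl_ivl_Suc)
    also have "(\<Sum>i\<le>n. (-1) ^ i * (f (take (Suc n) (omit_nth i xs)) * g (drop n (omit_nth i xs))))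
        = (\<Sum>i\<le>n. (-1) ^ i * F i) * g0"
      by (simp add: take_omit_nth drop_omit_nth F_def g0_def sum_distrib_right mult.assoc)
    also have "(\<Sum>i=Suc n..n + Suc m. (-1) ^ i * (f (take (Suc n) (omit_nth i xs)) * g (drop n (omit_nth i xs))))
        = (\<Sum>i=Suc 0..Suc m. (-1) ^ (n + i) * (f (take (Suc n) (omit_nth (n + i) xs)) * g (drop n (omit_nth (n + i) xs))))"
      using sum.shift_bounds_cl_nat_ivl[of "\<lambda>i. (-1) ^ i * (f (take (Suc n) (omit_nth i xs)) * g (drop n (omit_nth i xs)))" "Suc 0" n "Suc m"]
      by (simp add: add.commute del: sum.cl_ivl_Suc)
    also have "\<dots> = (\<Sum>i=Suc 0..Suc m. (-1) ^ (n + i) * (f0 * H i))"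
      by (rule sum.cong) (auto simp: take_omit_nth_ge drop_omit_nth_ge f0_def H_def)
    also have "\<dots> = (-1) ^ n * f0 * (\<Sum>i=Suc 0..Suc m. (-1) ^ i * H i)"
      unfolding sum_distrib_left by (rule sum.cong) (simp_all add: power_add)
    also have "(\<Sum>i=Suc 0..Suc m. (-1) ^ i * H i) = (\<Sum>i\<le>Suc m. (-1) ^ i * H i) - g0"
      by (simp add: atMost_atLeast0 sum.atLeast_Suc_atMost[of 0] H0 del: sum.cl_ivl_Suc)
    finally have L: "coboundary G (n + m) (cup G n m f g) xs =
       (\<Sum>i\<le>n. (-1) ^ i * F i) * g0 + (-1) ^ n * f0 * ((\<Sum>i\<le>Suc m. (-1) ^ i * H i) - g0)" .
    have C1: "cup G (Suc n) m (coboundary G n f) g xs = (\<Sum>i\<le>Suc n. (-1) ^ i * F i) * g0"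
      using xs tuples_take[OF xs1] by (simp add: cup_def coboundary_def F_def g0_def)
    have C2: "cup G n (Suc m) f (coboundary G m g) xs = f0 * (\<Sum>i\<le>Suc m. (-1) ^ i * H i)"
      using xs tuples_drop[OF xs2]
      by (simp add: cup_def coboundary_def f0_def H_def del: sum.atMost_Suc)
    have C3: "((-1) ^ n :: 'a list \<Rightarrow> int) xs = (-1) ^ n"
      by (induction n) (simp_all)
    show ?thesis
      unfolding L plus_fun_apply times_fun_apply C1 C2 C3 by (simp add: FSuc algebra_simps)
  qed (simp add: coboundary_def cup_def)
qed

lemma cup_linear:
  "cup G n m (f + f') g = cup G n m f g + cup G n m f' g"
  "cup G n m (f - f') g = cup G n m f g - cup G n m f' g"
  "cup G n m (of_int k * f) g = of_int k * cup G n m f g"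
  "cup G n m f (g + g') = cup G n m f g + cup G n m f g'"
  "cup G n m f (g - g') = cup G n m f g - cup G n m f g'"
  "cup G n m 0 g = 0" "cup G n m f 0 = 0"
  by (auto simp: fun_eq_iff cup_def algebra_simps)

lemma cup_unit: "f \<in> cochains G K n \<Longrightarrow> cup G 0 n (unit_cochain G) f = f"
  by (auto simp: fun_eq_iff cup_def unit_cochain_def tuples_def cochains_def dest: in_set_takeD)

lemma map_tuples_iff:
  "group G \<Longrightarrow> z \<in> carrier G \<Longrightarrow> set xs \<subseteq> carrier G \<Longrightarrow>
     map (\<lambda>x. z \<otimes>\<^bsub>G\<^esub> x) xs \<in> tuples G n \<longleftrightarrow> xs \<in> tuples G n"
  by (auto simp: tuples_def intro: group.subgroup_self subgroup.m_closed)

lemma map_tuples: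
  "group G \<Longrightarrow> z \<in> carrier G \<Longrightarrow> xs \<in> tuples G n \<Longrightarrow> map (\<lambda>x. z \<otimes>\<^bsub>G\<^esub> x) xs \<in> tuples G n"
  using map_tuples_iff[of G z xs n] by (auto simp: tuples_def[of G n])

lemma tuples_0: "xs \<in> tuples G 0 \<longleftrightarrow> (\<exists>x\<in>carrier G. xs = [x])"
  by (auto simp: tuples_def length_Suc_conv)

section \<open>Invariance, contractibility and degree zero\<close>

context group
begin

lemma coboundary_cochains:
  assumes "f \<in> cochains G K n" "K \<subseteq> carrier G"
  shows "coboundary G n f \<in> cochains G K (Suc n)"
  using assms
  by (auto simp: cochains_def coboundary_def map_tuples omit_nth_map omit_nth_tuples
      is_group subset_iff intro!: sum.cong)

lemma coboundaries_subset_cocycles: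
  "K \<subseteq> carrier G \<Longrightarrow> f \<in> coboundaries G K n \<Longrightarrow> f \<in> cocycles G K n"
  by (cases n) (auto simp: coboundaries_Suc cocycles_def coboundary_cochains cochains_zero)

text \<open>The translations that fix \<open>f\<close> form a subgroup, so invariance has to be
  imposed on generators only.\<close>

lemma cochains_generate:
  assumes "K \<subseteq> carrier G" "f \<in> cochains G K n"
  shows "f \<in> cochains G (generate G K) n"
proof -
  have *: "\<forall>xs\<in>tuples G n. f (map (\<lambda>x. z \<otimes> x) xs) = f xs" if "z \<in> generate G K" for z
    using that
  proof induction
    case one
    have "map (\<lambda>x. \<one> \<otimes> x) xs = xs" if "xs \<in> tuples G n" for xs
      by (rule map_idI) (use that in \<open>auto simp: tuples_def\<close>)
    then show ?case by simp
  next
    case (incl h)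
    then show ?case using assms by (auto simp: cochains_def)
  next
    case (inv h)
    then have h: "h \<in> carrier G" using assms by auto
    show ?case
    proof
      fix xs assume xs: "xs \<in> tuples G n"
      define ys where "ys = map (\<lambda>x. inv h \<otimes> x) xs"
      have "ys \<in> tuples G n" unfolding ys_def by (rule map_tuples) (use h xs is_group in auto)
      moreover have "map (\<lambda>x. h \<otimes> x) ys = xs"
        unfolding ys_def map_map comp_def
        by (rule map_idI) (use h xs in \<open>auto simp: tuples_def m_assoc[symmetric]\<close>)
      ultimately show "f (map (\<lambda>x. inv h \<otimes> x) xs) = f xs"
        using assms(2) inv by (auto simp: cochains_def ys_def[symmetric])
    qed
  next
    case (eng h1 h2)
    then have h: "h1 \<in> carrier G" "h2 \<in> carrier G"
      using generate_in_carrier[OF assms(1)] by auto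
    show ?case
    proof
      fix xs assume xs: "xs \<in> tuples G n"
      define ys where "ys = map (\<lambda>x. h2 \<otimes> x) xs"
      have 1: "map (\<lambda>x. (h1 \<otimes> h2) \<otimes> x) xs = map (\<lambda>x. h1 \<otimes> x) ys"
        using h xs by (auto simp: ys_def tuples_def m_assoc)
      have 2: "ys \<in> tuples G n"
        unfolding ys_def by (rule map_tuples) (use h xs is_group in auto)
      have 3: "f ys = f xs"
        using eng.IH(2) xs by (simp add: ys_def)
      show "f (map (\<lambda>x. (h1 \<otimes> h2) \<otimes> x) xs) = f xs"
        unfolding 1 using eng.IH(1) 2 3 by simp
    qed
  qed
  show ?thesis using assms(2) * by (auto simp: cochains_def)
qed

lemma act_cochains:
  assumes "f \<in> cochains G {} n" "z \<in> carrier G"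
  shows "act G z f \<in> cochains G {} n"
  using assms by (auto simp: cochains_def act_def map_tuples_iff is_group)

lemma cochains_act_eq:
  assumes "f \<in> cochains G K n" "z \<in> K"
  shows "act G z f = f"
proof
  fix xs
  show "act G z f xs = f xs"
    using assms by (cases "length xs = Suc n") (auto simp: act_def cochains_def tuples_def)
qed

lemma cochainsI_act:
  assumes "f \<in> cochains G {} n" "\<And>z. z \<in> K \<Longrightarrow> act G z f = f"
  shows "f \<in> cochains G K n"
proof -
  have "f (map (\<lambda>x. z \<otimes> x) xs) = f xs" if "z \<in> K" "xs \<in> tuples G n" for z xs
    using fun_cong[OF assms(2)[OF that(1)], of xs] that(2) by (simp add: act_def tuples_def)
  then show ?thesis using assms(1) by (simp add: cochains_def)
qed

lemma act_add: "act G z (f + g) = act G z f + act G z g"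
  by (auto simp: fun_eq_iff act_def)

lemma act_diff: "act G z (f - g) = act G z f - act G z g"
  by (auto simp: fun_eq_iff act_def)

lemma act_of_int_mult: "act G z (of_int k * f) = of_int k * act G z f"
  by (auto simp: fun_eq_iff act_def)

lemma act_zero [simp]: "act G z 0 = 0"
  by (auto simp: fun_eq_iff act_def)

lemmas act_linear = act_add act_diff act_of_int_mult act_zero

lemma act_mult:
  assumes "z \<in> carrier G" "z' \<in> carrier G"
  shows "act G z (act G z' f) = act G (z' \<otimes> z) f"
proof
  fix xs
  show "act G z (act G z' f) xs = act G (z' \<otimes> z) f xs"
  proof (cases "set xs \<subseteq> carrier G")
    case True
    then have eq: "map (\<lambda>x. z' \<otimes> z \<otimes> x) xs = map (\<lambda>x. z' \<otimes> x) (map (\<lambda>x. z \<otimes> x) xs)"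
      using assms by (auto simp: m_assoc)
    have "set (map (\<lambda>x. z \<otimes> x) xs) \<subseteq> carrier G"
      using True assms by auto
    then have "act G z (act G z' f) xs = f (map (\<lambda>x. z' \<otimes> x) (map (\<lambda>x. z \<otimes> x) xs))"
      using True by (simp add: act_def)
    also have "\<dots> = act G (z' \<otimes> z) f xs"
      using True by (simp only: eq act_def if_True)
    finally show ?thesis .
  qed (simp add: act_def)
qed

lemma act_coboundary:
  assumes "z \<in> carrier G"
  shows "act G z (coboundary G n f) = coboundary G n (act G z f)"
proof
  fix xs
  show "act G z (coboundary G n f) xs = coboundary G n (act G z f) xs"
  proof (cases "xs \<in> tuples G (Suc n)")
    case True
    then have "set (omit_nth i xs) \<subseteq> carrier G" if "i \<le> Suc n" for i
      using omit_nth_tuples[OF True that] by (auto simp: tuples_def)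
    then show ?thesis
      using True map_tuples[OF is_group assms True]
      by (auto simp: act_def coboundary_def omit_nth_map tuples_def intro!: sum.cong simp del: sum.atMost_Suc)
  qed (auto simp: act_def coboundary_def map_tuples_iff is_group assms)
qed

lemma act_cup:
  assumes "z \<in> carrier G"
  shows "act G z (cup G n m f g) = cup G n m (act G z f) (act G z g)"
proof
  fix xs
  show "act G z (cup G n m f g) xs = cup G n m (act G z f) (act G z g) xs"
  proof (cases "xs \<in> tuples G (n + m)")
    case True
    then show ?thesis
      using map_tuples[OF is_group assms True] tuples_take[OF True] tuples_drop[OF True]
      by (simp add: act_def cup_def take_map drop_map tuples_def)
  qed (auto simp: act_def cup_def map_tuples_iff is_group assms)
qed

lemma act_unit: "z \<in> carrier G \<Longrightarrow> act G z (unit_cochain G) = unit_cochain G"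
  by (auto simp: fun_eq_iff act_def unit_cochain_def map_tuples_iff is_group tuples_def)

lemma unit_cochain_cochains: "K \<subseteq> carrier G \<Longrightarrow> unit_cochain G \<in> cochains G K 0"
  by (auto simp: cochains_def unit_cochain_def map_tuples is_group)

lemma cup_cochains:
  assumes "f \<in> cochains G K n" "g \<in> cochains G K m" "K \<subseteq> carrier G"
  shows "cup G n m f g \<in> cochains G K (n + m)"
  using assms
  by (auto simp: cochains_def cup_def map_tuples is_group take_map drop_map tuples_take tuples_drop subset_iff)

text \<open>Prepending the neutral element is a contracting homotopy, but it does not respect
  invariance. Group cohomology is therefore read off from the failure of such primitives to be
  invariant.\<close>

lemma cocycles_trivial_acyclic:
  assumes "f \<in> cocycles G {} (Suc n)"
  shows "f \<in> coboundaries G {} (Suc n)"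
proof -
  define g where "g ys = (if ys \<in> tuples G n then f (\<one> # ys) else 0)" for ys
  have "f xs = coboundary G n g xs" for xs
  proof (cases "xs \<in> tuples G (Suc n)")
    case True
    then have 1: "\<one> # xs \<in> tuples G (Suc (Suc n))" by (simp add: tuples_def)
    have "0 = coboundary G (Suc n) f (\<one> # xs)"
      using assms by (simp add: cocycles_def)
    also have "\<dots> = (\<Sum>i\<le>Suc (Suc n). (-1) ^ i * f (omit_nth i (\<one> # xs)))"
      using 1 by (simp add: coboundary_def)
    also have "\<dots> = f xs - (\<Sum>i\<le>Suc n. (-1) ^ i * f (\<one> # omit_nth i xs))"
      by (subst sum.atMost_Suc_shift) (simp add: sum_negf[symmetric] del: sum.atMost_Suc)
    also have "(\<Sum>i\<le>Suc n. (-1) ^ i * f (\<one> # omit_nth i xs)) = coboundary G n g xs"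
      using True omit_nth_tuples[OF True] by (simp add: coboundary_def g_def del: sum.atMost_Suc)
    finally show ?thesis by simp
  next
    case False
    then show ?thesis using assms by (auto simp: cocycles_def cochains_def coboundary_def)
  qed
  then have "f = coboundary G n g" by auto
  moreover have "g \<in> cochains G {} n" by (auto simp: cochains_def g_def)
  ultimately show ?thesis by (auto simp: coboundaries_Suc)
qed

text \<open>The coboundary at \<open>[\<one>, x]\<close> compares the value at \<open>x\<close> with
  the value at the neutral element. This is how cochain identities are turned into integers
  below.\<close>

lemma cocycles_0_constant:
  assumes "f \<in> cocycles G K 0"
  obtains k where "f = of_int k * unit_cochain G"
proof -
  define k where "k = f [\<one>]"
  have k: "f [x] = k" if "x \<in> carrier G" for x
  proof -
    have "coboundary G 0 f [\<one>, x] = 0"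
      using assms by (simp add: cocycles_def)
    then show ?thesis
      using that by (simp add: coboundary_def tuples_def k_def)
  qed
  have "f xs = (of_int k * unit_cochain G) xs" for xs
  proof (cases "xs \<in> tuples G 0")
    case True
    then show ?thesis using k by (auto simp: unit_cochain_def tuples_0)
  next
    case False
    then show ?thesis using assms by (simp add: unit_cochain_def cocycles_def cochains_def)
  qed
  then have "f = of_int k * unit_cochain G" by blast
  then show ?thesis using that by blast
qed

lemma coboundary_unit [simp]: "coboundary G 0 (unit_cochain G) = 0"
proof
  fix xs
  show "coboundary G 0 (unit_cochain G) xs = 0 xs"
    using omit_nth_tuples[of xs G 0]
    by (auto simp: coboundary_def unit_cochain_def)
qed

lemma unit_cochain_cocycles: "K \<subseteq> carrier G \<Longrightarrow> unit_cochain G \<in> cocycles G K 0"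
  by (simp add: cocycles_def unit_cochain_cochains)

lemma of_int_mult_unit_eq_0: "of_int k * unit_cochain G = 0 \<longleftrightarrow> k = 0"
proof
  assume "of_int k * unit_cochain G = 0"
  then have "(of_int k * unit_cochain G) [\<one>] = 0" by simp
  then show "k = 0" by (simp add: unit_cochain_def tuples_def)
qed simp

end

section \<open>Mayer--Vietoris sequences and powers of a class of degree two\<close>

text \<open>The Chinese remainder theorem for moduli that need not be coprime; it aligns the
  coefficients of a class on the two factors of an amalgam.\<close>

lemma simultaneous_congruence:
  fixes k l m1 m2 :: int
  assumes "gcd m1 m2 dvd k - l"
  obtains s where "m1 dvd k - s" "m2 dvd l - s"
proof -
  obtain t where t: "k - l = gcd m1 m2 * t" using assms by blast
  obtain u v where uv: "u * m1 + v * m2 = gcd m1 m2" using bezout_int by blast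
  have "l - (k - u * m1 * t) = u * m1 * t - gcd m1 m2 * t"
    using t by simp
  also have "\<dots> = m2 * (- (v * t))" by (simp add: uv[symmetric] algebra_simps)
  finally have "m2 dvd l - (k - u * m1 * t)" by simp
  moreover have "m1 dvd k - (k - u * m1 * t)" by simp
  ultimately show ?thesis using that by blast
qed

lemma sum_fun_apply: "(sum f A) x = (\<Sum>i\<in>A. f i x)"
  by (induction A rule: infinite_finite_induct) simp_all

text \<open>Surjectivity of the difference map onto the cochains of \<open>M\<close>. As an equation
  of sets it also contains that restriction from \<open>K\<close> and from \<open>L\<close> to
  \<open>M\<close> is defined.\<close>

definition glued :: "('a, 'b) monoid_scheme \<Rightarrow> 'a set \<Rightarrow> 'a set \<Rightarrow> 'a set \<Rightarrow> bool" where
  "glued G K L M \<longleftrightarrow>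
     K \<subseteq> carrier G \<and> L \<subseteq> carrier G \<and> M \<subseteq> carrier G \<and>
     (\<forall>n. cochains G M n = {p + q | p q. p \<in> cochains G K n \<and> q \<in> cochains G L n})"

text \<open>The degree \<open>n\<close> of \<open>f\<close> is carried along because
  \<open>cup\<close> cuts tuples by position.\<close>

primrec cup_pow ::
  "('a, 'b) monoid_scheme \<Rightarrow> ('a list \<Rightarrow> int) \<Rightarrow> nat \<Rightarrow> nat \<Rightarrow> ('a list \<Rightarrow> int) \<Rightarrow> 'a list \<Rightarrow> int" where
  "cup_pow G c n 0 f = f"
| "cup_pow G c n (Suc j) f = cup G (n + 2 * j) 2 (cup_pow G c n j f) c"

lemma cup_pow_linear:
  "cup_pow G c n j (f + g) = cup_pow G c n j f + cup_pow G c n j g"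
  "cup_pow G c n j (f - g) = cup_pow G c n j f - cup_pow G c n j g"
  "cup_pow G c n j (of_int k * f) = of_int k * cup_pow G c n j f"
  "cup_pow G c n j 0 = 0"
  by (induction j) (simp_all add: cup_linear)

context group
begin

lemma glued_cochains:
  assumes "glued G K L M"
  shows "f \<in> cochains G K n \<Longrightarrow> f \<in> cochains G M n" "f \<in> cochains G L n \<Longrightarrow> f \<in> cochains G M n"
proof -
  have M: "cochains G M n = {p + q | p q. p \<in> cochains G K n \<and> q \<in> cochains G L n}"
    using assms by (simp add: glued_def)
  show "f \<in> cochains G K n \<Longrightarrow> f \<in> cochains G M n"
    unfolding M by (force intro: cochains_zero exI[of _ f] exI[of _ 0])
  show "f \<in> cochains G L n \<Longrightarrow> f \<in> cochains G M n"
    unfolding M by (force intro: cochains_zero exI[of _ f] exI[of _ 0])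
qed

lemma glued_split:
  assumes "glued G K L M" "f \<in> cochains G M n"
  obtains p q where "p \<in> cochains G K n" "q \<in> cochains G L n" "f = p + q"
  using assms unfolding glued_def by blast

lemma glued_coboundaries:
  assumes "glued G K L M"
  shows "f \<in> coboundaries G K n \<Longrightarrow> f \<in> coboundaries G M n"
    "f \<in> coboundaries G L n \<Longrightarrow> f \<in> coboundaries G M n"
  by (cases n; force simp: coboundaries_Suc dest: glued_cochains[OF assms])+

lemma glued_subset:
  assumes "glued G K L M"
  shows "K \<subseteq> carrier G" "L \<subseteq> carrier G" "M \<subseteq> carrier G"
  using assms by (auto simp: glued_def)

text \<open>Exactness of the Mayer--Vietoris sequence at the cohomology of \<open>K \<union> L\<close>.\<close>

lemma glued_exact:
  assumes gl: "glued G K L M"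
    and \<alpha>: "\<alpha> \<in> cochains G K n" and \<beta>: "\<beta> \<in> cochains G L n"
    and x: "x = coboundary G n \<alpha>" "x = coboundary G n \<beta>"
    and \<kappa>: "\<kappa> \<in> cocycles G (K \<union> L) n"
    and diff: "\<alpha> - \<beta> - \<kappa> \<in> coboundaries G M n"
  shows "x \<in> coboundaries G (K \<union> L) (Suc n)"
proof -
  \<comment> \<open>A coboundary on \<open>M\<close> is the coboundary of a sum and therefore
    splits. In degree 0 the difference is 0 and both parts are taken to be 0.\<close>
  obtain p q where pq: "p \<in> cocycles G K n" "q \<in> cocycles G L n" "\<alpha> - \<beta> - \<kappa> = p + q"
  proof (cases n)
    case 0
    then show ?thesis using that[of 0 0] diff cocycles_linear(1) by auto
  next
    case (Suc m)
    then obtain \<gamma> where \<gamma>: "\<gamma> \<in> cochains G M m" "\<alpha> - \<beta> - \<kappa> = coboundary G m \<gamma>"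
      using diff by (auto elim: coboundariesE)
    obtain p q where "p \<in> cochains G K m" "q \<in> cochains G L m" "\<gamma> = p + q"
      using glued_split[OF gl \<gamma>(1)] .
    then show ?thesis
      using that[of "coboundary G m p" "coboundary G m q"] \<gamma> Suc glued_subset[OF gl]
      by (simp add: coboundary_add cocyclesI coboundary_cochains)
  qed
  \<comment> \<open>Correcting \<open>\<alpha>\<close> by \<open>p\<close> and
    \<open>\<kappa>\<close> makes it equal to \<open>\<beta> + q\<close>, hence invariant under
    \<open>K\<close> and \<open>L\<close> at once.\<close>
  define \<alpha>' where "\<alpha>' = \<alpha> - p - \<kappa>"
  have \<kappa>': "\<kappa> \<in> cochains G K n" "\<kappa> \<in> cochains G L n"
    using cocyclesD(1)[OF \<kappa>] by (auto simp: cochains_Un)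
  have "\<alpha>' = \<beta> + q" using pq(3) by (simp add: \<alpha>'_def algebra_simps)
  then have "\<alpha>' \<in> cochains G L n" using \<beta> cocyclesD(1)[OF pq(2)] by (simp add: cochains_linear)
  moreover have "\<alpha>' \<in> cochains G K n"
    using \<alpha> cocyclesD(1)[OF pq(1)] \<kappa>' by (simp add: \<alpha>'_def cochains_linear)
  ultimately have "\<alpha>' \<in> cochains G (K \<union> L) n" by (simp add: cochains_Un)
  moreover have "coboundary G n \<alpha>' = x"
    using x cocyclesD(2)[OF pq(1)] cocyclesD(2)[OF \<kappa>] by (simp add: \<alpha>'_def coboundary_linear)
  ultimately show ?thesis by (auto simp: coboundaries_Suc)
qed

text \<open>The sign of the Leibniz rule is hidden in \<open>s\<close> with
  \<open>s * s = 1\<close>, so that the periodicity arguments need no distinction by parity.\<close>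

lemma coboundary_cup_cocycle:
  assumes "f \<in> cocycles G K n"
  obtains s :: int where "s * s = 1"
    "\<And>m g. coboundary G (n + m) (cup G n m f g) = of_int s * cup G n (Suc m) f (coboundary G m g)"
proof
  show "((-1) ^ n :: int) * (-1) ^ n = 1" by (simp add: power_mult_distrib[symmetric])
  show "coboundary G (n + m) (cup G n m f g) =
      of_int ((-1) ^ n) * cup G n (Suc m) f (coboundary G m g)" for m g
    using assms by (simp add: coboundary_cup cocycles_def cup_linear)
qed

lemma cup_unit_right:
  assumes "f \<in> cochains G K n"
  shows "cup G n 0 f (unit_cochain G) = f"
proof
  fix xs
  show "cup G n 0 f (unit_cochain G) xs = f xs"
  proof (cases "xs \<in> tuples G n")
    case True
    then have "drop n xs \<in> tuples G 0" using tuples_drop[of xs G n 0] by simp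
    then show ?thesis using True by (simp add: cup_def unit_cochain_def) (simp add: tuples_def)
  qed (use assms in \<open>simp add: cup_def cochains_def\<close>)
qed

lemma act_one: "f \<in> cochains G {} n \<Longrightarrow> act G \<one> f = f"
proof -
  assume f: "f \<in> cochains G {} n"
  have "map (\<lambda>x. \<one> \<otimes> x) xs = xs" if "set xs \<subseteq> carrier G" for xs
    by (rule map_idI) (use that in auto)
  then show ?thesis
    using f by (auto simp: fun_eq_iff act_def cochains_def tuples_def)
qed

lemma act_sum:
  fixes f :: "'c \<Rightarrow> 'a list \<Rightarrow> int"
  shows "act G z (\<Sum>i\<in>A. f i) = (\<Sum>i\<in>A. act G z (f i))"
  by (rule ext) (simp add: act_def sum_fun_apply)

text \<open>If \<open>z\<close> has order \<open>m\<close>, this is the norm operator of the cyclic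
  group generated by \<open>z\<close>.\<close>

definition orbit_sum :: "'a \<Rightarrow> nat \<Rightarrow> ('a list \<Rightarrow> int) \<Rightarrow> 'a list \<Rightarrow> int" where
  "orbit_sum z m f = (\<Sum>i<m. act G (z [^] i) f)"

end

lemma cochains_sum:
  fixes f :: "'c \<Rightarrow> 'a list \<Rightarrow> int"
  shows "(\<And>i. i \<in> A \<Longrightarrow> f i \<in> cochains G K n) \<Longrightarrow> sum f A \<in> cochains G K n"
  by (simp add: cochains_def sum_fun_apply)

lemma coboundary_sum:
  fixes f :: "'c \<Rightarrow> 'a list \<Rightarrow> int"
  shows "coboundary G n (\<Sum>i\<in>A. f i) = (\<Sum>i\<in>A. coboundary G n (f i))"
  by (rule ext) (simp add: coboundary_def sum_fun_apply sum_distrib_left sum.swap[of _ A] del: sum.atMost_Suc)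

lemma cup_sum_left:
  fixes f :: "'c \<Rightarrow> 'a list \<Rightarrow> int"
  shows "cup G n m (\<Sum>i\<in>A. f i) g = (\<Sum>i\<in>A. cup G n m (f i) g)"
  by (rule ext) (simp add: cup_def sum_fun_apply sum_distrib_left sum_distrib_right)

lemma cup_sum_right:
  fixes g :: "'c \<Rightarrow> 'a list \<Rightarrow> int"
  shows "cup G n m f (\<Sum>i\<in>A. g i) = (\<Sum>i\<in>A. cup G n m f (g i))"
  by (rule ext) (simp add: cup_def sum_fun_apply sum_distrib_left sum_distrib_right)

text \<open>By acyclicity every class of degree two has a primitive without invariance. The
  primitive \<open>w\<close> is made part of the data because the periodicity argument works with
  \<open>w\<close> and its translates.\<close>

locale group_with_class = group G for G (structure) +
  fixes w :: "'a list \<Rightarrow> int"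
  assumes w_cochain: "w \<in> cochains G {} 1"
    and class_invariant: "coboundary G 1 w \<in> cochains G (carrier G) 2"
begin

definition c :: "'a list \<Rightarrow> int" where "c = coboundary G 1 w"

abbreviation cp :: "nat \<Rightarrow> 'a list \<Rightarrow> int" where
  "cp j \<equiv> cup_pow G c 0 j (unit_cochain G)"

lemma c_cocycle: "K \<subseteq> carrier G \<Longrightarrow> c \<in> cocycles G K 2"
proof -
  assume "K \<subseteq> carrier G"
  then have "c \<in> cochains G K 2"
    using class_invariant cochains_mono[of K "carrier G"] by (simp add: c_def)
  moreover have "coboundary G 2 c = 0"
    using coboundary_twice[of G 1 w] by (simp add: c_def numeral_2_eq_2)
  ultimately show ?thesis by (simp add: cocycles_def)
qed

lemma act_c: "z \<in> carrier G \<Longrightarrow> act G z c = c"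
  using cochains_act_eq[OF cocyclesD(1)[OF c_cocycle[of "carrier G"]]] by simp

lemma cup_pow_cochains:
  assumes "f \<in> cochains G K n" "K \<subseteq> carrier G"
  shows "cup_pow G c n j f \<in> cochains G K (n + 2 * j)"
proof (induction j)
  case (Suc j)
  then show ?case
    using cup_cochains[OF Suc cocyclesD(1)[OF c_cocycle[OF assms(2)]] assms(2)] by (simp add: algebra_simps)
qed (use assms in simp)

lemma coboundary_cup_c:
  "coboundary G (n + 2) (cup G n 2 f c) = cup G (Suc n) 2 (coboundary G n f) c"
  using coboundary_cup[of G n 2 f c] cocyclesD(2)[OF c_cocycle[of "{}"]] by (simp add: cup_linear)

lemma coboundary_cup_pow:
  "coboundary G (n + 2 * j) (cup_pow G c n j f) = cup_pow G c (Suc n) j (coboundary G n f)"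
proof (induction j)
  case (Suc j)
  then show ?case using coboundary_cup_c[of "n + 2 * j"] by (simp add: algebra_simps)
qed simp

lemma act_cup_pow: "z \<in> carrier G \<Longrightarrow> act G z (cup_pow G c n j f) = cup_pow G c n j (act G z f)"
  by (induction j) (simp_all add: act_cup act_c)

lemma cup_pow_cocycles:
  assumes "f \<in> cocycles G K n" "K \<subseteq> carrier G"
  shows "cup_pow G c n j f \<in> cocycles G K (n + 2 * j)"
  using assms cup_pow_cochains[of f K n j]
  by (simp add: cocycles_def coboundary_cup_pow cup_pow_linear)

lemma cup_pow_coboundaries:
  assumes "f \<in> coboundaries G K n" "K \<subseteq> carrier G"
  shows "cup_pow G c n j f \<in> coboundaries G K (n + 2 * j)"
proof (cases n)
  case 0
  then show ?thesis using assms by (simp add: cup_pow_linear coboundaries_linear)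
next
  case (Suc m)
  then obtain g where g: "g \<in> cochains G K m" "f = coboundary G m g"
    using assms by (auto elim: coboundariesE)
  have "coboundary G (m + 2 * j) (cup_pow G c m j g) = cup_pow G c n j f"
    by (simp add: coboundary_cup_pow g Suc)
  moreover have "cup_pow G c m j g \<in> cochains G K (m + 2 * j)"
    using g assms by (simp add: cup_pow_cochains)
  ultimately show ?thesis by (force simp: Suc coboundaries_Suc)
qed

lemma cp_cocycle: "K \<subseteq> carrier G \<Longrightarrow> cp j \<in> cocycles G K (2 * j)"
  using cup_pow_cocycles[OF unit_cochain_cocycles, of K j] by simp

lemma cp_Suc: "cp (Suc j) = cup_pow G c 2 j c"
proof (induction j)
  case 0
  show ?case using cup_unit[OF cocyclesD(1)[OF c_cocycle[of "{}"]]] by simp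
next
  case (Suc j)
  have "cp (Suc (Suc j)) = cup G (2 + 2 * j) 2 (cp (Suc j)) c" by simp
  also have "\<dots> = cup_pow G c 2 (Suc j) c" unfolding Suc by simp
  finally show ?case .
qed

text \<open>In even degrees the cohomology ring is that of a cyclic group: the polynomial ring in c
  modulo m c. The second clause starts at \<open>Suc j\<close> because degree 0 is infinite
  cyclic.\<close>

definition even_coh :: "'a set \<Rightarrow> int \<Rightarrow> bool" where
  "even_coh K m \<longleftrightarrow>
     (\<forall>j. \<forall>f\<in>cocycles G K (2 * j). \<exists>k. f - of_int k * cp j \<in> coboundaries G K (2 * j)) \<and>
     (\<forall>j k. of_int k * cp (Suc j) \<in> coboundaries G K (2 * Suc j) \<longleftrightarrow> m dvd k)"

definition odd_coh :: "'a set \<Rightarrow> bool" where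
  "odd_coh K \<longleftrightarrow> (\<forall>j. cocycles G K (Suc (2 * j)) \<subseteq> coboundaries G K (Suc (2 * j)))"

section \<open>Mayer-Vietoris when powers of the class generate\<close>

lemma even_cohE:
  assumes "even_coh K m" "f \<in> cocycles G K (2 * j)"
  obtains k where "f - of_int k * cp j \<in> coboundaries G K (2 * j)"
  using assms unfolding even_coh_def by blast

lemma even_coh_iff:
  "even_coh K m \<Longrightarrow> of_int k * cp (Suc j) \<in> coboundaries G K (2 * Suc j) \<longleftrightarrow> m dvd k"
  unfolding even_coh_def by blast

lemma odd_cohD: "odd_coh K \<Longrightarrow> f \<in> cocycles G K (Suc (2 * j)) \<Longrightarrow> f \<in> coboundaries G K (Suc (2 * j))"
  unfolding odd_coh_def by blast

text \<open>The even cohomology of \<open>M\<close> consists of multiples of \<open>cp j\<close>,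
  and these are defined on all of \<open>K \<union> L\<close>. So the connecting map out of even
  degrees is zero.\<close>

lemma glued_odd_coh:
  assumes gl: "glued G K L M" and "odd_coh K" "odd_coh L" "even_coh M m"
  shows "odd_coh (K \<union> L)"
  unfolding odd_coh_def
proof (intro allI subsetI)
  note sub = glued_subset[OF gl]
  fix j x assume x: "x \<in> cocycles G (K \<union> L) (Suc (2 * j))"
  then have "x \<in> cocycles G K (Suc (2 * j))" "x \<in> cocycles G L (Suc (2 * j))"
    using cocycles_mono[of K "K \<union> L"] cocycles_mono[of L "K \<union> L"] by auto
  then obtain \<alpha> \<beta> where \<alpha>: "\<alpha> \<in> cochains G K (2 * j)" "x = coboundary G (2 * j) \<alpha>"
    and \<beta>: "\<beta> \<in> cochains G L (2 * j)" "x = coboundary G (2 * j) \<beta>"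
    using assms(2,3) by (meson odd_cohD coboundariesE)
  have "\<alpha> - \<beta> \<in> cocycles G M (2 * j)"
    using \<alpha> \<beta> glued_cochains[OF gl] by (auto simp: cocycles_def coboundary_linear intro: cochains_linear)
  then obtain k where "\<alpha> - \<beta> - of_int k * cp j \<in> coboundaries G M (2 * j)"
    using even_cohE[OF assms(4)] by blast
  then show "x \<in> coboundaries G (K \<union> L) (Suc (2 * j))"
    using glued_exact[OF gl \<alpha>(1) \<beta>(1) \<alpha>(2) \<beta>(2), of "of_int k * cp j"] sub
    by (auto intro: cocycles_linear cp_cocycle)
qed

text \<open>As the odd cohomology of \<open>M\<close> vanishes, the connecting map into even degrees
  is zero and restriction to \<open>K\<close> and \<open>L\<close> is injective there.\<close>

lemma glued_even_coboundary:
  assumes gl: "glued G K L M" and "odd_coh M"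
    and "x \<in> coboundaries G K (2 * Suc j)" "x \<in> coboundaries G L (2 * Suc j)"
  shows "x \<in> coboundaries G (K \<union> L) (2 * Suc j)"
proof -
  obtain \<alpha> \<beta> where \<alpha>: "\<alpha> \<in> cochains G K (Suc (2 * j))" "x = coboundary G (Suc (2 * j)) \<alpha>"
    and \<beta>: "\<beta> \<in> cochains G L (Suc (2 * j))" "x = coboundary G (Suc (2 * j)) \<beta>"
    using assms(3,4) by (metis coboundariesE mult_Suc_right add_2_eq_Suc)
  have "\<alpha> - \<beta> \<in> cocycles G M (Suc (2 * j))"
    using \<alpha> \<beta> glued_cochains[OF gl] by (auto simp: cocycles_def coboundary_linear intro: cochains_linear)
  then have "\<alpha> - \<beta> - 0 \<in> coboundaries G M (Suc (2 * j))"
    using odd_cohD[OF assms(2)] by simp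
  then show ?thesis
    using glued_exact[OF gl \<alpha>(1) \<beta>(1) \<alpha>(2) \<beta>(2) cocycles_linear(1)] by simp
qed

lemma even_coh_0:
  assumes "f \<in> cocycles G K 0"
  shows "\<exists>k. f - of_int k * cp 0 \<in> coboundaries G K 0"
  using cocycles_0_constant[OF assms] by (metis cup_pow.simps(1) coboundaries_linear(1) diff_self)

text \<open>In positive even degrees the cohomology is the fibre product of cyclic groups of orders
  \<open>m1\<close> and \<open>m2\<close> over one of order \<open>gcd m1 m2\<close>, with
  compatible generators. Such a fibre product is cyclic of order \<open>lcm m1 m2\<close>.\<close>

lemma glued_even_coh:
  assumes gl: "glued G K L M" and K: "even_coh K m1" and L: "even_coh L m2"
    and M: "odd_coh M" "even_coh M (gcd m1 m2)"
  shows "even_coh (K \<union> L) (lcm m1 m2)"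
  unfolding even_coh_def
proof (intro conjI allI ballI)
  note sub = glued_subset[OF gl]
  have iff: "of_int k * cp (Suc j) \<in> coboundaries G (K \<union> L) (2 * Suc j) \<longleftrightarrow> lcm m1 m2 dvd k" for j k
  proof -
    have "of_int k * cp (Suc j) \<in> coboundaries G (K \<union> L) (2 * Suc j) \<longleftrightarrow>
      of_int k * cp (Suc j) \<in> coboundaries G K (2 * Suc j) \<and>
      of_int k * cp (Suc j) \<in> coboundaries G L (2 * Suc j)"
      using glued_even_coboundary[OF gl M(1)] coboundaries_mono[of K "K \<union> L"]
        coboundaries_mono[of L "K \<union> L"] by blast
    then show ?thesis
      using even_coh_iff[OF K] even_coh_iff[OF L] by (simp add: lcm_least_iff del: cup_pow.simps)
  qed
  then show "of_int k * cp (Suc j) \<in> coboundaries G (K \<union> L) (2 * Suc j) \<longleftrightarrow> lcm m1 m2 dvd k" for j k .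
  fix j f assume f: "f \<in> cocycles G (K \<union> L) (2 * j)"
  show "\<exists>k. f - of_int k * cp j \<in> coboundaries G (K \<union> L) (2 * j)"
  proof (cases j)
    case 0
    then show ?thesis using even_coh_0 f by simp
  next
    case (Suc i)
    have "f \<in> cocycles G K (2 * j)" "f \<in> cocycles G L (2 * j)"
      using f cocycles_mono[of K "K \<union> L"] cocycles_mono[of L "K \<union> L"] by auto
    then obtain k l where k: "f - of_int k * cp j \<in> coboundaries G K (2 * j)"
      and l: "f - of_int l * cp j \<in> coboundaries G L (2 * j)"
      using even_cohE[OF K] even_cohE[OF L] by metis
    have "(f - of_int l * cp j) - (f - of_int k * cp j) \<in> coboundaries G M (2 * j)"
      using k l glued_coboundaries[OF gl] by (blast intro: coboundaries_linear)
    moreover have "(f - of_int l * cp j) - (f - of_int k * cp j) = of_int (k - l) * cp j"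
      by (simp add: algebra_simps)
    \<comment> \<open>Restricted to \<open>M\<close>, both \<open>k\<close> and \<open>l\<close>
      describe the class of \<open>f\<close>, so they agree modulo the order of the class
      there.\<close>
    ultimately have "gcd m1 m2 dvd k - l"
      using even_coh_iff[OF M(2)] by (simp only: Suc)
    then obtain s where s: "m1 dvd k - s" "m2 dvd l - s" by (rule simultaneous_congruence)
    have "(f - of_int k * cp j) + of_int (k - s) * cp j \<in> coboundaries G K (2 * j)"
      using k s(1) even_coh_iff[OF K] by (simp only: Suc coboundaries_linear(2))
    moreover have "(f - of_int l * cp j) + of_int (l - s) * cp j \<in> coboundaries G L (2 * j)"
      using l s(2) even_coh_iff[OF L] by (simp only: Suc coboundaries_linear(2))
    moreover have "(f - of_int u * cp j) + of_int (u - s) * cp j = f - of_int s * cp j" for u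
      by (simp add: algebra_simps)
    ultimately show ?thesis
      using glued_even_coboundary[OF gl M(1)] unfolding Suc by metis
  qed
qed

end

section \<open>Periodicity for finite cyclic groups, and translations\<close>

text \<open>The discrete integral from 0 to \<open>k\<close>; for each \<open>k\<close> one of the
  two sums is empty.\<close>

definition antidifference :: "(int \<Rightarrow> int) \<Rightarrow> int \<Rightarrow> int" where
  "antidifference \<phi> k = (\<Sum>i\<in>{0..<k}. \<phi> i) - (\<Sum>i\<in>{k..<0}. \<phi> i)"

lemma antidifference_step: "antidifference \<phi> (k + 1) - antidifference \<phi> k = \<phi> k"
proof (cases "k \<ge> 0")
  case True
  then have "{0..<k + 1} = insert k {0..<k}" by auto
  then show ?thesis using True by (simp add: antidifference_def)
next
  case False
  then have "{k..<0} = insert k {k + 1..<0}" by auto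
  then show ?thesis using False by (simp add: antidifference_def)
qed

section \<open>Norms over a finite cyclic group\<close>

context group
begin

lemma cochains_singletonI:
  "f \<in> cochains G {} n \<Longrightarrow> act G z f = f \<Longrightarrow> f \<in> cochains G {z} n"
  by (rule cochainsI_act) auto

lemma orbit_sum_linear:
  "orbit_sum z m (f + g) = orbit_sum z m f + orbit_sum z m g"
  "orbit_sum z m (f - g) = orbit_sum z m f - orbit_sum z m g"
  "orbit_sum z m (of_int k * f) = of_int k * orbit_sum z m f"
  by (simp_all add: orbit_sum_def act_linear sum.distrib sum_subtractf sum_distrib_left)

lemma orbit_sum_cochains:
  "z \<in> carrier G \<Longrightarrow> f \<in> cochains G {} n \<Longrightarrow> orbit_sum z m f \<in> cochains G {} n"
  unfolding orbit_sum_def by (intro cochains_sum act_cochains) auto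

lemma act_orbit_sum:
  assumes "z \<in> carrier G" "z [^] m = \<one>" "f \<in> cochains G {} n"
  shows "act G z (orbit_sum z m f) = orbit_sum z m f"
    "orbit_sum z m (act G z f) = orbit_sum z m f"
proof -
  have "(\<Sum>i<m. act G (z [^] Suc i) f) + act G (z [^] (0::nat)) f = (\<Sum>i<Suc m. act G (z [^] i) f)"
    by (subst sum.lessThan_Suc_shift) simp
  also have "\<dots> = (\<Sum>i<m. act G (z [^] i) f) + act G (z [^] (0::nat)) f"
    using assms(2) by simp
  finally have *: "(\<Sum>i<m. act G (z [^] Suc i) f) = orbit_sum z m f"
    by (simp add: orbit_sum_def)
  have "act G z (orbit_sum z m f) = (\<Sum>i<m. act G (z [^] Suc i) f)"
    unfolding orbit_sum_def act_sum by (rule sum.cong) (simp_all add: act_mult assms)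
  then show "act G z (orbit_sum z m f) = orbit_sum z m f" using * by simp
  have "orbit_sum z m (act G z f) = (\<Sum>i<m. act G (z [^] Suc i) f)"
    unfolding orbit_sum_def
    by (rule sum.cong) (simp_all only: act_mult nat_pow_Suc2 nat_pow_closed assms)
  then show "orbit_sum z m (act G z f) = orbit_sum z m f" using * by simp
qed

lemma orbit_sum_invariant:
  assumes "z \<in> carrier G" "z [^] m = \<one>" "f \<in> cochains G {} n"
  shows "orbit_sum z m f \<in> cochains G {z} n"
  using orbit_sum_cochains[OF assms(1,3)] act_orbit_sum(1)[OF assms] by (intro cochains_singletonI) auto

lemma orbit_sum_coboundary:
  "z \<in> carrier G \<Longrightarrow> orbit_sum z m (coboundary G n f) = coboundary G n (orbit_sum z m f)"
  unfolding orbit_sum_def coboundary_sum by (rule sum.cong) (simp_all add: act_coboundary)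

lemma act_pow_invariant:
  assumes "z \<in> carrier G" "f \<in> cochains G {z} n"
  shows "act G (z [^] (i::nat)) f = f"
proof (induction i)
  case 0
  then show ?case using act_one[OF cochains_mono[OF empty_subsetI assms(2)]] by simp
next
  case (Suc i)
  have "act G (z [^] Suc i) f = act G z (act G (z [^] i) f)"
    using assms by (simp add: act_mult)
  then show ?case using Suc cochains_act_eq[OF assms(2)] by simp
qed

text \<open>The projection formula: an invariant factor can be pulled out of a norm.\<close>

lemma orbit_sum_cup:
  assumes "z \<in> carrier G" "f \<in> cochains G {z} n"
  shows "orbit_sum z m (cup G n k f g) = cup G n k f (orbit_sum z m g)"
  unfolding orbit_sum_def cup_sum_right
  by (rule sum.cong) (simp_all add: act_cup act_pow_invariant[OF assms] assms(1))

lemma orbit_sum_const: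
  assumes "z \<in> carrier G" "f \<in> cochains G {z} n"
  shows "orbit_sum z m f = of_int (int m) * f"
  unfolding orbit_sum_def by (simp add: act_pow_invariant[OF assms])

text \<open>The contracting homotopy of the norm--difference sequence, written with a function \<open>a\<close> of
  norm one.\<close>

lemma orbit_sum_eq_0:
  assumes z: "z \<in> carrier G" "z [^] m = \<one>" and a: "a \<in> cochains G {} 0" "orbit_sum z m a = unit_cochain G"
    and f: "f \<in> cochains G {} n" "orbit_sum z m f = 0"
  obtains e where "e \<in> cochains G {} n" "act G z e - e = f"
proof -
  \<comment> \<open>The partial norms \<open>F i\<close> are weighted by the translates of
    \<open>a\<close>. Applying \<open>z\<close> turns \<open>h i\<close> into
    \<open>h (Suc i)\<close> up to a term in \<open>f\<close>. The sum telescopes cyclically because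
    \<open>h 0\<close> and \<open>h m\<close> vanish, and the terms in \<open>f\<close> add up to
    \<open>f\<close> since \<open>a\<close> has norm one.\<close>
  define F where "F i = (\<Sum>k<i. act G (z [^] k) f)" for i :: nat
  define h where "h i = cup G 0 n (act G (z [^] i) a) (F i)" for i :: nat
  define e where "e = (\<Sum>i<m. h i)"
  have F: "F i \<in> cochains G {} n" for i
    unfolding F_def using z f by (intro cochains_sum act_cochains) auto
  have hc: "h i \<in> cochains G {} n" for i
    unfolding h_def using cup_cochains[OF act_cochains[OF a(1), of "z [^] i"] F[of i]] z by simp
  have e: "e \<in> cochains G {} n"
    unfolding e_def by (intro cochains_sum hc)
  have actF: "act G z (F i) = F (Suc i) - f" for i
  proof -
    have "act G z (F i) = (\<Sum>k<i. act G (z [^] Suc k) f)"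
      unfolding F_def act_sum by (rule sum.cong) (simp_all add: act_mult z)
    moreover have "F (Suc i) = act G (z [^] (0::nat)) f + (\<Sum>k<i. act G (z [^] Suc k) f)"
      unfolding F_def by (rule sum.lessThan_Suc_shift)
    ultimately show ?thesis using act_one[OF f(1)] by simp
  qed
  have "act G z (h i) = h (Suc i) - cup G 0 n (act G (z [^] Suc i) a) f" for i
    by (simp add: h_def act_cup z act_mult actF cup_linear)
  then have "act G z e = (\<Sum>i<m. h (Suc i)) - (\<Sum>i<m. cup G 0 n (act G (z [^] Suc i) a) f)"
    unfolding e_def act_sum by (simp add: sum_subtractf)
  also have "(\<Sum>i<m. cup G 0 n (act G (z [^] Suc i) a) f) = cup G 0 n (act G z (orbit_sum z m a)) f"
    unfolding orbit_sum_def act_sum cup_sum_left by (rule sum.cong) (simp_all add: act_mult z)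
  also have "\<dots> = f" using a(2) cup_unit[OF f(1)] by (simp add: act_unit z)
  also have "(\<Sum>i<m. h (Suc i)) = e"
  proof -
    have "F m = 0" using f(2) by (simp add: F_def orbit_sum_def)
    then have hm: "h m = 0" by (simp add: h_def cup_linear)
    have h0: "h 0 = 0" by (simp add: h_def F_def cup_linear)
    have "h 0 + (\<Sum>i<m. h (Suc i)) = (\<Sum>i<Suc m. h i)"
      by (rule sum.lessThan_Suc_shift[symmetric])
    then show ?thesis using hm h0 by (simp add: e_def)
  qed
  finally have "act G z e = e - f" .
  then have "act G z (0 - e) - (0 - e) = f" by (simp only: act_linear) simp
  then show ?thesis using that[of "0 - e"] e by (blast intro: cochains_linear)
qed

lemma cochains_insert:
  assumes "z \<in> carrier G" "f \<in> cochains G K n" "act G z f = f"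
  shows "f \<in> cochains G (insert z K) n"
proof -
  have "f \<in> cochains G {} n" using assms(2) cochains_mono[of "{}" K] by auto
  then show ?thesis by (rule cochainsI_act) (use assms cochains_act_eq in auto)
qed

section \<open>Translations with an integer-valued height\<close>

lemma act_commuting_cochains:
  assumes T: "T \<in> carrier G" and K: "K \<subseteq> carrier G" "\<And>z. z \<in> K \<Longrightarrow> T \<otimes> z = z \<otimes> T"
    and g: "g \<in> cochains G K n"
  shows "act G T g \<in> cochains G K n"
proof (rule cochainsI_act)
  show "act G T g \<in> cochains G {} n"
    using g T by (intro act_cochains) (auto intro: cochains_mono[OF empty_subsetI])
  show "act G z (act G T g) = act G T g" if "z \<in> K" for z
  proof -
    have "act G z (act G T g) = act G T (act G z g)"
      using that T K by (simp add: act_mult subset_iff)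
    then show ?thesis using cochains_act_eq[OF g that] by simp
  qed
qed

lemma commutes_int_pow:
  assumes "T \<in> carrier G" "z \<in> carrier G" "T \<otimes> z = z \<otimes> T"
  shows "T [^] (k::int) \<otimes> z = z \<otimes> T [^] k"
proof (cases k rule: int_cases)
  case (nonneg n)
  then show ?thesis using group_commutes_pow[OF assms(3,1,2)] by (simp add: int_pow_int)
next
  case (neg n)
  have "inv T \<otimes> z = inv T \<otimes> (z \<otimes> T) \<otimes> inv T" using assms(1,2) by (simp add: m_assoc)
  also have "\<dots> = inv T \<otimes> (T \<otimes> z) \<otimes> inv T" using assms(3) by simp
  also have "\<dots> = z \<otimes> inv T" using assms(1,2) by (simp add: m_assoc[symmetric])
  finally have "inv T \<otimes> z = z \<otimes> inv T" .
  then have "inv T [^] Suc n \<otimes> z = z \<otimes> inv T [^] Suc n"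
    using group_commutes_pow assms by (metis inv_closed)
  moreover have "T [^] k = inv T [^] Suc n"
    using assms(1) by (simp only: neg int_pow_neg_int nat_pow_inv)
  ultimately show ?thesis by (simp only:)
qed

text \<open>The height \<open>\<tau>\<close> is a coordinate on the orbits of \<open>T\<close>, so
  that \<open>f\<close> can be integrated along them, starting at height 0. Invariance under
  \<open>K\<close> survives because \<open>\<tau>\<close> is invariant and \<open>T\<close> commutes
  with \<open>K\<close>.\<close>

lemma translation_surj:
  assumes T: "T \<in> carrier G" and K: "K \<subseteq> carrier G" "\<And>z. z \<in> K \<Longrightarrow> T \<otimes> z = z \<otimes> T"
    and \<tau>: "\<tau> \<in> cochains G K 0" "act G T \<tau> = \<tau> + unit_cochain G"
    and f: "f \<in> cochains G K n"
  obtains e where "e \<in> cochains G K n" "act G T e - e = f"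
proof -
  \<comment> \<open>The power of \<open>T\<close> moves the first entry to height \<open>k\<close>,
    so \<open>\<phi>\<close> depends only on the orbit of the tuple under \<open>T\<close>, while
    \<open>e\<close> depends on its height as well.\<close>
  define \<phi> where "\<phi> xs k = f (map (\<lambda>x. T [^] (k - \<tau> [hd xs]) \<otimes> x) xs)" for xs k
  define e where "e xs = (if xs \<in> tuples G n then antidifference (\<phi> xs) (\<tau> [hd xs]) else 0)" for xs
  have hd: "hd xs \<in> carrier G" "hd (map (\<lambda>x. z \<otimes> x) xs) = z \<otimes> hd xs" if "xs \<in> tuples G n" for xs z
    using that by (cases xs; auto simp: tuples_def)+
  have \<tau>T: "\<tau> [T \<otimes> x] = \<tau> [x] + 1" if "x \<in> carrier G" for x
    using fun_cong[OF \<tau>(2), of "[x]"] that by (simp add: act_def unit_cochain_def tuples_def)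
  have \<tau>z: "\<tau> [z \<otimes> x] = \<tau> [x]" if "x \<in> carrier G" "z \<in> K" for x z
  proof -
    have "[x] \<in> tuples G 0" using that by (simp add: tuples_def)
    then show ?thesis using \<tau>(1) that by (force simp: cochains_def)
  qed
  have "e (map (\<lambda>x. T \<otimes> x) xs) - e xs = f xs" if xs: "xs \<in> tuples G n" for xs
  proof -
    have "map (\<lambda>x. T [^] (k - \<tau> [hd (map (\<lambda>x. T \<otimes> x) xs)]) \<otimes> x) (map (\<lambda>x. T \<otimes> x) xs) =
      map (\<lambda>x. T [^] (k - \<tau> [hd xs]) \<otimes> x) xs" for k
    proof -
      have "T [^] (k - (\<tau> [hd xs] + 1)) \<otimes> (T \<otimes> x) = T [^] (k - \<tau> [hd xs]) \<otimes> x" if "x \<in> set xs" for x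
      proof -
        have x: "x \<in> carrier G" using that xs by (auto simp: tuples_def)
        have "T [^] (k - (\<tau> [hd xs] + 1)) \<otimes> T = T [^] (k - (\<tau> [hd xs] + 1) + 1)"
          using int_pow_mult[OF T, of "k - (\<tau> [hd xs] + 1)" 1] T by simp
        then show ?thesis using T x by (simp add: m_assoc[symmetric])
      qed
      then show ?thesis by (simp add: hd[OF xs] \<tau>T)
    qed
    then have "\<phi> (map (\<lambda>x. T \<otimes> x) xs) = \<phi> xs" unfolding \<phi>_def by (simp only:)
    then have "e (map (\<lambda>x. T \<otimes> x) xs) = antidifference (\<phi> xs) (\<tau> [hd xs] + 1)"
      using map_tuples[OF is_group T xs] by (simp add: e_def hd[OF xs] \<tau>T)
    then have "e (map (\<lambda>x. T \<otimes> x) xs) - e xs = \<phi> xs (\<tau> [hd xs])"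
      using xs antidifference_step[of "\<phi> xs"] by (simp add: e_def)
    moreover have "map (\<lambda>x. \<one> \<otimes> x) xs = xs"
      by (rule map_idI) (use xs in \<open>auto simp: tuples_def\<close>)
    ultimately show ?thesis by (simp add: \<phi>_def)
  qed
  moreover have ec: "e \<in> cochains G K n"
  proof -
    have "e (map (\<lambda>x. z \<otimes> x) xs) = e xs" if xs: "xs \<in> tuples G n" and z: "z \<in> K" for xs z
    proof -
      have zc: "z \<in> carrier G" using z K by auto
      have "f (map (\<lambda>x. T [^] k \<otimes> x) (map (\<lambda>x. z \<otimes> x) xs)) = f (map (\<lambda>x. T [^] k \<otimes> x) xs)" for k :: int
      proof -
        have "map (\<lambda>x. T [^] k \<otimes> x) (map (\<lambda>x. z \<otimes> x) xs) = map (\<lambda>x. z \<otimes> x) (map (\<lambda>x. T [^] k \<otimes> x) xs)"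
          using xs T zc commutes_int_pow[OF T zc K(2)[OF z]]
          by (auto simp: tuples_def m_assoc[symmetric])
        moreover have "map (\<lambda>x. T [^] k \<otimes> x) xs \<in> tuples G n"
          by (rule map_tuples) (use T xs is_group in auto)
        ultimately show ?thesis using f z by (auto simp: cochains_def simp del: map_map)
      qed
      then have "\<phi> (map (\<lambda>x. z \<otimes> x) xs) = \<phi> xs"
        unfolding \<phi>_def by (simp add: hd[OF xs] \<tau>z[OF hd(1)[OF xs] z] del: map_map)
      then show ?thesis
        using map_tuples[OF is_group zc xs] xs by (simp add: e_def hd[OF xs] \<tau>z[OF hd(1)[OF xs] z])
    qed
    then show ?thesis by (auto simp: cochains_def e_def)
  qed
  moreover have "(act G T e - e) xs = f xs" if "xs \<notin> tuples G n" for xs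
    using that f by (auto simp: act_def e_def cochains_def map_tuples_iff is_group T)
  ultimately have "(act G T e - e) xs = f xs" for xs
    by (cases "xs \<in> tuples G n") (simp_all add: act_def tuples_def)
  then have "act G T e - e = f" by (rule ext)
  then show ?thesis using that ec by blast
qed

end

section \<open>Periodicity for rotations and the effect of a translation\<close>

context group_with_class
begin

text \<open>Passing from c to the norm of \<open>a\<close> is the double dimension shift from degree
  two to degree zero. Norm one thus says that c restricts to the standard generator of the second
  cohomology of the cyclic group.\<close>

definition rotation :: "'a \<Rightarrow> nat \<Rightarrow> ('a list \<Rightarrow> int) \<Rightarrow> bool" where
  "rotation z m a \<longleftrightarrow> z \<in> carrier G \<and> 0 < m \<and> z [^] m = \<one> \<and> a \<in> cochains G {} 0 \<and>
     act G z w - w = coboundary G 0 a \<and> orbit_sum z m a = unit_cochain G"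

text \<open>The double dimension shift applied to \<open>f\<close> yields an invariant cocycle
  \<open>f'\<close> two degrees lower. For \<open>f' c\<close> the same shift gives
  \<open>f' a\<close>, whose norm is again \<open>f'\<close>, so the two classes agree.\<close>

lemma rotation_periodicity_surj:
  assumes r: "rotation z m a" and f: "f \<in> cocycles G {z} (Suc (Suc n))"
  obtains f' where "f' \<in> cocycles G {z} n" "f - cup G n 2 f' c \<in> coboundaries G {z} (Suc (Suc n))"
proof -
  have z: "z \<in> carrier G" "z [^] m = \<one>" and a: "a \<in> cochains G {} 0" "orbit_sum z m a = unit_cochain G"
    and aw: "coboundary G 0 a = act G z w - w"
    using r by (auto simp: rotation_def)
  have "f \<in> cocycles G {} (Suc (Suc n))" using f cocycles_mono[of "{}" "{z}"] by auto
  then obtain b where b: "b \<in> cochains G {} (Suc n)" "f = coboundary G (Suc n) b"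
    using cocycles_trivial_acyclic coboundariesE by metis
  have fz: "act G z f = f" using cochains_act_eq[OF cocyclesD(1)[OF f]] by simp
  have "act G z b - b \<in> cocycles G {} (Suc n)"
    using b fz z by (auto intro!: cocyclesI cochains_linear act_cochains
        simp: coboundary_linear act_coboundary[symmetric])
  then obtain a' where a': "a' \<in> cochains G {} n" "act G z b - b = coboundary G n a'"
    using cocycles_trivial_acyclic coboundariesE by metis
  \<comment> \<open>The change of the primitive \<open>b\<close> under \<open>z\<close> has the
    primitive \<open>a'\<close>; its norm is closed because the norm of \<open>act G z b - b\<close>
    is 0.\<close>
  define f' where "f' = orbit_sum z m a'"
  have f'c: "f' \<in> cochains G {z} n" unfolding f'_def by (rule orbit_sum_invariant[OF z a'(1)])
  have "coboundary G n f' = orbit_sum z m (act G z b) - orbit_sum z m b"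
    by (simp add: f'_def orbit_sum_coboundary[symmetric] z a'(2)[symmetric] orbit_sum_linear)
  then have f': "f' \<in> cocycles G {z} n" using f'c act_orbit_sum(2)[OF z b(1)] by (simp add: cocycles_def)
  have f'e: "f' \<in> cochains G {} n" using f'c cochains_mono[of "{}" "{z}"] by auto
  have cc: "cup G n 0 f' a - a' \<in> cochains G {} n"
    using cup_cochains[OF f'e a(1)] a' by (auto intro: cochains_linear)
  have "orbit_sum z m (cup G n 0 f' a - a') = 0"
    by (simp only: orbit_sum_linear orbit_sum_cup[OF z(1) f'c] a(2) cup_unit_right[OF f'e])
      (simp add: f'_def)
  then obtain e where e: "e \<in> cochains G {} n" "act G z e - e = cup G n 0 f' a - a'"
    using orbit_sum_eq_0[OF z a cc] by blast
  obtain s :: int where s: "s * s = 1" and leib: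
    "\<And>m g. coboundary G (n + m) (cup G n m f' g) = of_int s * cup G n (Suc m) f' (coboundary G m g)"
    using coboundary_cup_cocycle[OF f'] by blast
  \<comment> \<open>The difference of primitives of \<open>f' c\<close> and of \<open>f\<close>. Its
    change under \<open>z\<close> is the coboundary of \<open>f' a - a'\<close>, which equals that
    of \<open>act G z e - e\<close>, so subtracting the coboundary of \<open>e\<close> makes it
    invariant.\<close>
  define g where "g = of_int s * cup G n 1 f' w - b - coboundary G n e"
  have gc: "g \<in> cochains G {} (Suc n)"
    unfolding g_def using cup_cochains[OF f'e w_cochain] b e
    by (auto intro!: cochains_linear coboundary_cochains)
  have f'z: "act G z f' = f'" using cochains_act_eq[OF f'c] by simp
  have "coboundary G n (act G z e - e) = of_int s * cup G n 1 f' (act G z w - w) - (act G z b - b)"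
    unfolding e(2) coboundary_diff a'(2) using leib[of 0 a] by (simp add: aw)
  then have "act G z g = g"
    unfolding g_def
    by (simp add: act_linear act_cup z f'z act_coboundary coboundary_linear cup_linear algebra_simps)
  then have "g \<in> cochains G {z} (Suc n)" using gc by (intro cochains_singletonI) auto
  moreover have "coboundary G (Suc n) g = cup G n 2 f' c - f"
  proof -
    have "coboundary G (Suc n) (cup G n 1 f' w) = of_int s * cup G n 2 f' c"
      using leib[of 1 w] by (simp add: c_def numeral_2_eq_2)
    then have "coboundary G (Suc n) g = of_int (s * s) * cup G n 2 f' c - f"
      by (simp add: g_def coboundary_linear b(2)[symmetric] mult.assoc)
    then show ?thesis by (simp add: s)
  qed
  ultimately have "cup G n 2 f' c - f \<in> coboundaries G {z} (Suc (Suc n))"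
    by (metis coboundariesI)
  then have "0 - (cup G n 2 f' c - f) \<in> coboundaries G {z} (Suc (Suc n))"
    by (rule coboundaries_linear(3)[OF coboundaries_linear(1)])
  then show ?thesis using that[OF f'] by simp
qed

text \<open>The invariant primitive \<open>g\<close> is compared with \<open>f w\<close>. The
  conclusion in terms of norms covers two situations at once: in positive degree such a norm is a
  coboundary, in degree 0 it is a multiple of \<open>m\<close>.\<close>

lemma rotation_periodicity_inj:
  assumes r: "rotation z m a" and f: "f \<in> cocycles G {z} n"
    and ex: "cup G n 2 f c \<in> coboundaries G {z} (Suc (Suc n))"
  obtains k where "k \<in> cocycles G {} n" "f = orbit_sum z m k"
proof -
  have z: "z \<in> carrier G" "z [^] m = \<one>" and a: "a \<in> cochains G {} 0" "orbit_sum z m a = unit_cochain G"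
    and aw: "coboundary G 0 a = act G z w - w"
    using r by (auto simp: rotation_def)
  obtain s :: int where s: "s * s = 1" and leib:
    "\<And>m g. coboundary G (n + m) (cup G n m f g) = of_int s * cup G n (Suc m) f (coboundary G m g)"
    using coboundary_cup_cocycle[OF f] by blast
  obtain g where g: "g \<in> cochains G {z} (Suc n)" "cup G n 2 f c = coboundary G (Suc n) g"
    using ex by (rule coboundariesE)
  have fz: "act G z f = f" "act G z g = g"
    using cochains_act_eq[OF cocyclesD(1)[OF f]] cochains_act_eq[OF g(1)] by auto
  have fe: "f \<in> cochains G {} n" "g \<in> cochains G {} (Suc n)"
    using cocyclesD(1)[OF f] g cochains_mono[of "{}" "{z}"] by auto
  define u where "u = of_int s * cup G n 1 f w - g"
  have "coboundary G (Suc n) (cup G n 1 f w) = of_int s * cup G n 2 f c"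
    using leib[of 1 w] by (simp add: c_def numeral_2_eq_2)
  then have "coboundary G (Suc n) u = of_int (s * s) * cup G n 2 f c - cup G n 2 f c"
    by (simp add: u_def coboundary_linear g(2)[symmetric] mult.assoc)
  then have "u \<in> cocycles G {} (Suc n)"
    using cup_cochains[OF fe(1) w_cochain] fe s by (auto simp: cocycles_def u_def intro!: cochains_linear)
  then obtain h where h: "h \<in> cochains G {} n" "u = coboundary G n h"
    using cocycles_trivial_acyclic coboundariesE by metis
  define k where "k = cup G n 0 f a - (act G z h - h)"
  have kc: "k \<in> cochains G {} n"
    using cup_cochains[OF fe(1) a(1)] h z by (auto simp: k_def intro!: cochains_linear act_cochains)
  have "coboundary G n (act G z h - h) = act G z u - u"
    by (simp add: coboundary_linear act_coboundary[symmetric] z h(2))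
  also have "\<dots> = of_int s * cup G n 1 f (act G z w - w)"
    by (simp add: u_def act_linear fz act_cup z cup_linear algebra_simps)
  also have "\<dots> = coboundary G n (cup G n 0 f a)"
    using leib[of 0 a] by (simp add: aw)
  finally have "k \<in> cocycles G {} n" using kc by (simp add: cocycles_def k_def coboundary_linear)
  moreover have "f = orbit_sum z m k"
    using act_orbit_sum(2)[OF z h(1)] cup_unit_right[OF fe(1)]
    by (simp add: k_def orbit_sum_linear orbit_sum_cup[OF z(1) cocyclesD(1)[OF f]] a(2))
  ultimately show ?thesis using that by blast
qed

lemma rotation_periodicity_coboundary:
  assumes r: "rotation z m a" and f: "f \<in> cocycles G {z} (Suc n)"
    and ex: "cup G (Suc n) 2 f c \<in> coboundaries G {z} (Suc n + 2)"
  shows "f \<in> coboundaries G {z} (Suc n)"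
proof -
  have z: "z \<in> carrier G" "z [^] m = \<one>" using r by (auto simp: rotation_def)
  obtain k where "k \<in> cocycles G {} (Suc n)" "f = orbit_sum z m k"
    using rotation_periodicity_inj[OF r f] ex by auto
  then obtain l where "l \<in> cochains G {} n" "f = orbit_sum z m (coboundary G n l)"
    using cocycles_trivial_acyclic coboundariesE by metis
  then show ?thesis
    using orbit_sum_invariant[OF z, of l n] by (auto simp: orbit_sum_coboundary z intro: coboundariesI)
qed

text \<open>Degree one is the vanishing of homomorphisms from a finite group to the integers: the
  constant change of a primitive has norm 0 and is therefore 0. Periodicity lifts this to all odd
  degrees.\<close>

lemma rotation_odd_coh:
  assumes r: "rotation z m a"
  shows "odd_coh {z}"
  unfolding odd_coh_def
proof
  have z: "z \<in> carrier G" "z [^] m = \<one>" "0 < m" using r by (auto simp: rotation_def)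
  fix j show "cocycles G {z} (Suc (2 * j)) \<subseteq> coboundaries G {z} (Suc (2 * j))"
  proof (induction j)
    case 0
    show ?case
    proof
      fix f assume f: "f \<in> cocycles G {z} (Suc (2 * 0))"
      then have "f \<in> cocycles G {} (Suc 0)" using cocycles_mono[of "{}" "{z}"] by auto
      then obtain b where b: "b \<in> cochains G {} 0" "f = coboundary G 0 b"
        using cocycles_trivial_acyclic coboundariesE by metis
      have "act G z f = f" using cochains_act_eq[OF cocyclesD(1)[OF f]] by simp
      then have "act G z b - b \<in> cocycles G {} 0"
        using b z by (auto intro!: cocyclesI cochains_linear act_cochains
            simp: coboundary_linear act_coboundary[symmetric])
      then obtain k where k: "act G z b - b = of_int k * unit_cochain G"
        by (rule cocycles_0_constant)
      have "of_int (int m * k) * unit_cochain G = orbit_sum z m (act G z b - b)"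
        using orbit_sum_const[OF z(1) unit_cochain_cochains, of m] z(1)
        by (simp add: k orbit_sum_linear algebra_simps)
      also have "\<dots> = 0" using act_orbit_sum(2)[OF z(1,2) b(1)] by (simp add: orbit_sum_linear)
      finally have "k = 0" using of_int_mult_unit_eq_0 z(3) by (metis mult_eq_0_iff of_nat_0_less_iff less_irrefl)
      then have "b \<in> cochains G {z} 0" using k b by (intro cochains_singletonI) auto
      then show "f \<in> coboundaries G {z} (Suc (2 * 0))" using b coboundariesI by force
    qed
  next
    case (Suc j)
    show ?case
    proof
      fix f assume "f \<in> cocycles G {z} (Suc (2 * Suc j))"
      then have "f \<in> cocycles G {z} (Suc (Suc (Suc (2 * j))))" by simp
      then obtain f' where f': "f' \<in> cocycles G {z} (Suc (2 * j))"
        "f - cup G (Suc (2 * j)) 2 f' c \<in> coboundaries G {z} (Suc (Suc (Suc (2 * j))))"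
        by (rule rotation_periodicity_surj[OF r])
      then have "f' \<in> coboundaries G {z} (Suc (2 * j))" using Suc by blast
      then have "cup_pow G c (Suc (2 * j)) 1 f' \<in> coboundaries G {z} (Suc (2 * j) + 2 * 1)"
        by (rule cup_pow_coboundaries) (use z in auto)
      then have "cup G (Suc (2 * j)) 2 f' c \<in> coboundaries G {z} (Suc (Suc (Suc (2 * j))))"
        by simp
      from coboundaries_linear(2)[OF f'(2) this]
      show "f \<in> coboundaries G {z} (Suc (2 * Suc j))" by simp
    qed
  qed
qed

lemma rotation_even_coh:
  assumes r: "rotation z m a"
  shows "even_coh {z} (int m)"
  unfolding even_coh_def
proof (intro conjI allI ballI)
  have z: "z \<in> carrier G" "z [^] m = \<one>" "0 < m" "{z} \<subseteq> carrier G" using r by (auto simp: rotation_def)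
  fix j f assume "f \<in> cocycles G {z} (2 * j)"
  then show "\<exists>k. f - of_int k * cp j \<in> coboundaries G {z} (2 * j)"
  proof (induction j arbitrary: f)
    case 0
    then show ?case using even_coh_0[of f "{z}"] by (simp only: mult_0_right)
  next
    case (Suc j)
    then have "f \<in> cocycles G {z} (Suc (Suc (2 * j)))" by simp
    then obtain f' where f': "f' \<in> cocycles G {z} (2 * j)"
      "f - cup G (2 * j) 2 f' c \<in> coboundaries G {z} (Suc (Suc (2 * j)))"
      by (rule rotation_periodicity_surj[OF r])
    then obtain k where "f' - of_int k * cp j \<in> coboundaries G {z} (2 * j)" using Suc.IH by blast
    then have "cup_pow G c (2 * j) 1 (f' - of_int k * cp j) \<in> coboundaries G {z} (2 * j + 2 * 1)"
      by (rule cup_pow_coboundaries) (use z in auto)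
    then have "cup_pow G c (2 * j) 1 (f' - of_int k * cp j) \<in> coboundaries G {z} (Suc (Suc (2 * j)))"
      by simp
    from coboundaries_linear(2)[OF f'(2) this] have "f - of_int k * cp (Suc j) \<in> coboundaries G {z} (2 * Suc j)"
      by (simp add: cup_linear)
    then show ?case by blast
  qed
next
  have z: "z \<in> carrier G" "z [^] m = \<one>" "0 < m" "{z} \<subseteq> carrier G" using r by (auto simp: rotation_def)
  fix j k show "of_int k * cp (Suc j) \<in> coboundaries G {z} (2 * Suc j) \<longleftrightarrow> int m dvd k"
  proof
    assume "int m dvd k"
    then obtain l where l: "k = int m * l" by blast
    \<comment> \<open>The norm of \<open>w\<close> is an invariant primitive of \<open>m\<close>
      times c.\<close>
    have "orbit_sum z m w \<in> cochains G {z} 1" by (rule orbit_sum_invariant[OF z(1,2) w_cochain])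
    then have "of_int l * orbit_sum z m w \<in> cochains G {z} (Suc 0)" by (simp add: cochains_linear)
    then have "coboundary G (Suc 0) (of_int l * orbit_sum z m w) \<in> coboundaries G {z} 2"
      by (metis coboundariesI numeral_2_eq_2)
    moreover have "coboundary G (Suc 0) (of_int l * orbit_sum z m w) = of_int k * c"
      using orbit_sum_const[OF z(1) cocyclesD(1)[OF c_cocycle[OF z(4)]], of m]
      by (simp add: l coboundary_linear orbit_sum_coboundary[symmetric] z(1) c_def algebra_simps)
    ultimately have "of_int k * c \<in> coboundaries G {z} 2" by simp
    then have "cup_pow G c 2 j (of_int k * c) \<in> coboundaries G {z} (2 + 2 * j)"
      by (rule cup_pow_coboundaries) (use z in auto)
    then show "of_int k * cp (Suc j) \<in> coboundaries G {z} (2 * Suc j)"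
      unfolding cp_Suc cup_pow_linear by simp
  next
    show "int m dvd k" if "of_int k * cp (Suc j) \<in> coboundaries G {z} (2 * Suc j)"
      using that
    proof (induction j)
      case 0
      have "of_int k * unit_cochain G \<in> cocycles G {z} 0"
        using unit_cochain_cocycles[OF z(4)] by (simp add: cocycles_linear)
      moreover have "cup G 0 2 (of_int k * unit_cochain G) c \<in> coboundaries G {z} (Suc (Suc 0))"
      proof -
        have "of_int k * cp (Suc 0) \<in> coboundaries G {z} (2 * Suc 0)" by (rule 0)
        then show ?thesis by (simp add: cup_linear numeral_2_eq_2)
      qed
      ultimately obtain h where h: "h \<in> cocycles G {} 0" "of_int k * unit_cochain G = orbit_sum z m h"
        by (rule rotation_periodicity_inj[OF r])
      \<comment> \<open>The norm of a constant is its multiple by \<open>m\<close>; this is where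
        the order of c is bounded from below.\<close>
      obtain e where "h = of_int e * unit_cochain G" using cocycles_0_constant[OF h(1)] .
      then have "of_int (k - int m * e) * unit_cochain G = 0"
        using h(2) orbit_sum_const[OF z(1) unit_cochain_cochains, of m] z(4)
        by (simp add: orbit_sum_linear algebra_simps)
      then have "k = int m * e" using of_int_mult_unit_eq_0[of "k - int m * e"] by simp
      then show ?case by simp
    next
      case (Suc j)
      have "of_int k * cp (Suc j) \<in> cocycles G {z} (Suc (Suc (2 * j)))"
        using cp_cocycle[OF z(4), of "Suc j"] by (simp add: cocycles_linear del: cup_pow.simps)
      moreover have "cup G (Suc (Suc (2 * j))) 2 (of_int k * cp (Suc j)) c
          \<in> coboundaries G {z} (Suc (Suc (2 * j)) + 2)"
      proof -
        have "of_int k * cp (Suc (Suc j)) \<in> coboundaries G {z} (2 * Suc (Suc j))" by (rule Suc.prems)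
        then show ?thesis by (simp add: cup_linear)
      qed
      ultimately have "of_int k * cp (Suc j) \<in> coboundaries G {z} (Suc (Suc (2 * j)))"
        by (rule rotation_periodicity_coboundary[OF r])
      then have "of_int k * cp (Suc j) \<in> coboundaries G {z} (2 * Suc j)" by simp
      then show ?case by (rule Suc.IH)
    qed
  qed
qed


text \<open>The Wang sequence for a translation commuting with \<open>K\<close>. The odd cohomology
  of \<open>K\<close> would contribute to even degrees, but it vanishes, so restriction to
  \<open>K\<close> is injective on positive even degrees; powers of c make it surjective.\<close>

lemma translation_even_coh:
  assumes T: "T \<in> carrier G" and K: "K \<subseteq> carrier G" "\<And>z. z \<in> K \<Longrightarrow> T \<otimes> z = z \<otimes> T"
    and \<tau>: "\<tau> \<in> cochains G K 0" "act G T \<tau> = \<tau> + unit_cochain G"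
    and ev: "even_coh K m" and od: "odd_coh K"
  shows "even_coh (insert T K) m"
proof -
  have sub: "insert T K \<subseteq> carrier G" using T K by auto
  \<comment> \<open>The change of a primitive under \<open>T\<close> is closed of odd degree, hence
    some coboundary of \<open>\<beta>\<close>. Writing \<open>\<beta>\<close> as the change of
    \<open>\<gamma>\<close> permits a correction of the primitive that is fixed by
    \<open>T\<close>.\<close>
  have cob: "f \<in> coboundaries G (insert T K) (2 * Suc j)"
    if f: "f \<in> cocycles G (insert T K) (2 * Suc j)" "f \<in> coboundaries G K (2 * Suc j)" for f j
  proof -
    obtain \<alpha> where \<alpha>: "\<alpha> \<in> cochains G K (Suc (2 * j))" "f = coboundary G (Suc (2 * j)) \<alpha>"
      using f(2) by (metis coboundariesE mult_Suc_right add_2_eq_Suc)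
    have fT: "act G T f = f" using cochains_act_eq[OF cocyclesD(1)[OF f(1)]] by simp
    have "act G T \<alpha> - \<alpha> \<in> cocycles G K (Suc (2 * j))"
      using \<alpha> act_commuting_cochains[OF T K] fT T by (intro cocyclesI cochains_linear)
        (auto simp: coboundary_linear act_coboundary[symmetric])
    then obtain \<beta> where \<beta>: "\<beta> \<in> cochains G K (2 * j)" "act G T \<alpha> - \<alpha> = coboundary G (2 * j) \<beta>"
      using odd_cohD[OF od] coboundariesE by metis
    obtain \<gamma> where \<gamma>: "\<gamma> \<in> cochains G K (2 * j)" "act G T \<gamma> - \<gamma> = \<beta>"
      using translation_surj[OF T K \<tau> \<beta>(1)] .
    define \<alpha>' where "\<alpha>' = \<alpha> - coboundary G (2 * j) \<gamma>"
    have "act G T \<alpha>' - \<alpha>' = (act G T \<alpha> - \<alpha>) - coboundary G (2 * j) (act G T \<gamma> - \<gamma>)"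
      using T by (simp add: \<alpha>'_def act_linear act_coboundary coboundary_linear)
    then have "act G T \<alpha>' = \<alpha>'" by (simp add: \<beta>(2) \<gamma>(2))
    then have "\<alpha>' \<in> cochains G (insert T K) (Suc (2 * j))"
      using \<alpha> \<gamma> T K by (intro cochains_insert) (auto simp: \<alpha>'_def intro!: cochains_linear coboundary_cochains)
    moreover have "coboundary G (Suc (2 * j)) \<alpha>' = f"
      by (simp add: \<alpha>'_def coboundary_linear \<alpha>(2))
    ultimately show ?thesis using coboundariesI by force
  qed
  show ?thesis
    unfolding even_coh_def
  proof (intro conjI allI ballI)
    fix j k show "of_int k * cp (Suc j) \<in> coboundaries G (insert T K) (2 * Suc j) \<longleftrightarrow> m dvd k"
      using cob[OF cocycles_linear(4)[OF cp_cocycle[OF sub]]] even_coh_iff[OF ev]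
        coboundaries_mono[of K "insert T K"] by blast
  next
    fix j f assume f: "f \<in> cocycles G (insert T K) (2 * j)"
    show "\<exists>k. f - of_int k * cp j \<in> coboundaries G (insert T K) (2 * j)"
    proof (cases j)
      case 0
      then show ?thesis using even_coh_0 f by simp
    next
      case (Suc i)
      have "f \<in> cocycles G K (2 * j)" using f cocycles_mono[of K "insert T K"] by auto
      then obtain k where k: "f - of_int k * cp j \<in> coboundaries G K (2 * j)"
        using even_cohE[OF ev] by blast
      have "f - of_int k * cp j \<in> cocycles G (insert T K) (2 * j)"
        using cocycles_linear(3)[OF f cocycles_linear(4)[OF cp_cocycle[OF sub]]] .
      then show ?thesis using cob k unfolding Suc by blast
    qed
  qed
qed

text \<open>The coboundary of \<open>\<tau>\<close> represents the homomorphism that sends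
  \<open>T\<close> to 1 and kills \<open>K\<close>. By the Wang sequence its products with powers of
  c generate odd degrees, with the order of \<open>cp j\<close> on \<open>K\<close>: infinite for
  \<open>j = 0\<close> and \<open>m\<close> afterwards.\<close>

lemma translation_odd_coh:
  assumes T: "T \<in> carrier G" and K: "K \<subseteq> carrier G" "\<And>z. z \<in> K \<Longrightarrow> T \<otimes> z = z \<otimes> T"
    and \<tau>: "\<tau> \<in> cochains G K 0" "act G T \<tau> = \<tau> + unit_cochain G"
    and ev: "even_coh K m" and od: "odd_coh K"
  shows "f \<in> cocycles G (insert T K) (Suc (2 * j)) \<Longrightarrow>
      \<exists>k. f - of_int k * cup_pow G c (Suc 0) j (coboundary G 0 \<tau>)
        \<in> coboundaries G (insert T K) (Suc (2 * j))"
    and "of_int k * cup_pow G c (Suc 0) j (coboundary G 0 \<tau>) \<in> coboundaries G (insert T K) (Suc (2 * j))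
      \<longleftrightarrow> (if j = 0 then k = 0 else m dvd k)"
proof -
  have sub: "insert T K \<subseteq> carrier G" using T K by auto
  define \<theta> where "\<theta> = cup_pow G c 0 j \<tau>"
  have \<theta>: "\<theta> \<in> cochains G K (2 * j)" using cup_pow_cochains[OF \<tau>(1) K(1), of j] by (simp add: \<theta>_def)
  have \<theta>T: "act G T \<theta> = \<theta> + cp j" by (simp add: \<theta>_def act_cup_pow T \<tau>(2) cup_pow_linear)
  have d\<theta>: "cup_pow G c (Suc 0) j (coboundary G 0 \<tau>) = coboundary G (2 * j) \<theta>"
    using coboundary_cup_pow[of 0 j \<tau>] by (simp add: \<theta>_def)
  \<comment> \<open>Under \<open>T\<close> the cochain \<open>\<theta>\<close> changes by exactly
    \<open>cp j\<close>. So subtracting \<open>k\<close> times \<open>\<theta>\<close> leaves a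
    change that is a coboundary on \<open>K\<close>, and \<open>translation_surj\<close> removes
    it.\<close>
  have adjust: "\<exists>\<alpha>'\<in>cochains G (insert T K) (2 * j).
      coboundary G (2 * j) \<alpha>' = coboundary G (2 * j) \<alpha> - of_int k * coboundary G (2 * j) \<theta>"
    if \<alpha>: "\<alpha> \<in> cochains G K (2 * j)" and
      k: "act G T \<alpha> - \<alpha> - of_int k * cp j \<in> coboundaries G K (2 * j)" for \<alpha> k
  proof (cases j)
    case 0
    then have "act G T \<alpha> - \<alpha> = of_int k * cp j" using k by simp
    then have "act G T (\<alpha> - of_int k * \<theta>) = \<alpha> - of_int k * \<theta>"
      by (simp only: act_linear \<theta>T) (simp add: algebra_simps)
    then have "\<alpha> - of_int k * \<theta> \<in> cochains G (insert T K) (2 * j)"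
      using \<alpha> \<theta> T by (intro cochains_insert cochains_linear)
    then show ?thesis by (force simp: coboundary_linear)
  next
    case (Suc i)
    then obtain \<beta> where \<beta>: "\<beta> \<in> cochains G K (2 * j - 1)"
      "act G T \<alpha> - \<alpha> - of_int k * cp j = coboundary G (2 * j - 1) \<beta>"
      using k by (auto elim: coboundariesE)
    obtain \<gamma> where \<gamma>: "\<gamma> \<in> cochains G K (2 * j - 1)" "act G T \<gamma> - \<gamma> = \<beta>"
      using translation_surj[OF T K \<tau> \<beta>(1)] .
    define \<alpha>' where "\<alpha>' = \<alpha> - of_int k * \<theta> - coboundary G (2 * j - 1) \<gamma>"
    have j: "Suc (2 * j - 1) = 2 * j" using Suc by simp
    have "act G T \<alpha>' - \<alpha>' = (act G T \<alpha> - \<alpha> - of_int k * cp j) - coboundary G (2 * j - 1) (act G T \<gamma> - \<gamma>)"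
      using T by (simp only: \<alpha>'_def act_linear act_coboundary coboundary_linear \<theta>T) (simp add: algebra_simps)
    then have "act G T \<alpha>' = \<alpha>'" by (simp add: \<beta>(2) \<gamma>(2))
    moreover have "\<alpha>' \<in> cochains G K (2 * j)"
      using \<alpha> \<theta> coboundary_cochains[OF \<gamma>(1) K(1)] unfolding \<alpha>'_def j by (intro cochains_linear)
    ultimately have "\<alpha>' \<in> cochains G (insert T K) (2 * j)"
      using T by (intro cochains_insert)
    moreover have "coboundary G (2 * j) \<alpha>' = coboundary G (2 * j) \<alpha> - of_int k * coboundary G (2 * j) \<theta>"
      using coboundary_twice[of G "2 * j - 1" \<gamma>] unfolding j by (simp add: \<alpha>'_def coboundary_linear)
    ultimately show ?thesis by blast
  qed
  show "\<exists>k. f - of_int k * cup_pow G c (Suc 0) j (coboundary G 0 \<tau>)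
        \<in> coboundaries G (insert T K) (Suc (2 * j))"
    if f: "f \<in> cocycles G (insert T K) (Suc (2 * j))"
  proof -
    have "f \<in> cocycles G K (Suc (2 * j))" using f cocycles_mono[of K "insert T K"] by auto
    then obtain \<alpha> where \<alpha>: "\<alpha> \<in> cochains G K (2 * j)" "f = coboundary G (2 * j) \<alpha>"
      using odd_cohD[OF od] coboundariesE by metis
    have fT: "act G T f = f" using cochains_act_eq[OF cocyclesD(1)[OF f]] by simp
    have "act G T \<alpha> - \<alpha> \<in> cocycles G K (2 * j)"
      using \<alpha> act_commuting_cochains[OF T K] fT T by (intro cocyclesI cochains_linear)
        (auto simp: coboundary_linear act_coboundary[symmetric])
    then obtain k where "act G T \<alpha> - \<alpha> - of_int k * cp j \<in> coboundaries G K (2 * j)"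
      using even_cohE[OF ev] by blast
    then show ?thesis unfolding d\<theta> using adjust[OF \<alpha>(1)] \<alpha>(2) coboundariesI by metis
  qed
  show "of_int k * cup_pow G c (Suc 0) j (coboundary G 0 \<tau>) \<in> coboundaries G (insert T K) (Suc (2 * j))
      \<longleftrightarrow> (if j = 0 then k = 0 else m dvd k)"
    unfolding d\<theta>
  proof
    assume "of_int k * coboundary G (2 * j) \<theta> \<in> coboundaries G (insert T K) (Suc (2 * j))"
    then obtain u where u: "u \<in> cochains G (insert T K) (2 * j)"
      "of_int k * coboundary G (2 * j) \<theta> = coboundary G (2 * j) u" by (rule coboundariesE)
    have uK: "u \<in> cochains G K (2 * j)" using u(1) cochains_mono[of K "insert T K"] by auto
    have uT: "act G T u = u" using cochains_act_eq[OF u(1)] by simp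
    have "of_int k * \<theta> - u \<in> cocycles G K (2 * j)"
      using \<theta> uK u(2) by (intro cocyclesI cochains_linear) (simp_all add: coboundary_linear)
    then obtain l where l: "of_int k * \<theta> - u - of_int l * cp j \<in> coboundaries G K (2 * j)"
      using even_cohE[OF ev] by blast
    \<comment> \<open>\<open>v\<close> is a coboundary on \<open>K\<close>, and so is its translate;
      but the change of \<open>v\<close> under \<open>T\<close> is \<open>k\<close> times
      \<open>cp j\<close>.\<close>
    define v where "v = of_int k * \<theta> - u - of_int l * cp j"
    have vB: "act G T v \<in> coboundaries G K (2 * j)"
    proof (cases j)
      case 0
      then show ?thesis using l by (simp add: v_def coboundaries_linear)
    next
      case (Suc i)
      then obtain \<beta> where "\<beta> \<in> cochains G K (2 * j - 1)" "v = coboundary G (2 * j - 1) \<beta>"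
        using l by (auto elim: coboundariesE simp: v_def)
      then show ?thesis using act_commuting_cochains[OF T K] coboundariesI[of "act G T \<beta>" G K "2 * j - 1"] T Suc
        by (auto simp: act_coboundary)
    qed
    have cpT: "act G T (cp j) = cp j"
      using cochains_act_eq[OF cocyclesD(1)[OF cp_cocycle[of "carrier G" j]]] T by simp
    have "act G T v - v = of_int k * cp j"
      by (simp only: v_def act_linear \<theta>T uT cpT) (simp add: algebra_simps)
    moreover have "act G T v - v \<in> coboundaries G K (2 * j)"
      using vB l by (intro coboundaries_linear(3)) (simp_all only: v_def)
    ultimately have "of_int k * cp j \<in> coboundaries G K (2 * j)" by simp
    then show "if j = 0 then k = 0 else m dvd k"
      using even_coh_iff[OF ev, of k "j - 1"] of_int_mult_unit_eq_0[of k] by (cases j) auto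
  next
    assume k: "if j = 0 then k = 0 else m dvd k"
    have kc: "of_int k * cp j \<in> coboundaries G K (2 * j)"
      using k even_coh_iff[OF ev, of k "j - 1"] by (cases j) auto
    have "act G T 0 - 0 - of_int (- k) * cp j \<in> coboundaries G K (2 * j)"
      using kc by simp
    then obtain \<alpha>' where "\<alpha>' \<in> cochains G (insert T K) (2 * j)"
      "coboundary G (2 * j) \<alpha>' = coboundary G (2 * j) 0 - of_int (- k) * coboundary G (2 * j) \<theta>"
      using adjust[OF cochains_zero] by blast
    then show "of_int k * coboundary G (2 * j) \<theta> \<in> coboundaries G (insert T K) (Suc (2 * j))"
      using coboundariesI[of \<alpha>' G "insert T K" "2 * j"] by simp
  qed
qed

end

section \<open>The even cohomology of an amalgam\<close>

context group
begin

lemma carrier_cochain_group: "carrier (cochain_group G n) = cochains G (carrier G) n"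
  by (simp add: cochain_group_def cochains_def)

lemma cocycle_set_eq: "cocycle_set G n = cocycles G (carrier G) n"
  unfolding cocycle_set_def kernel_def carrier_cochain_group cocycles_def
  by (simp add: cochain_group_def zero_fun_def)

lemma coboundary_set_eq: "coboundary_set G n = coboundaries G (carrier G) n"
proof (cases n)
  case 0
  then show ?thesis by (simp add: coboundary_set_def cochain_group_def zero_fun_def)
next
  case (Suc m)
  then show ?thesis by (simp add: coboundary_set_def coboundaries_Suc carrier_cochain_group)
qed

lemma group_cohomology_iso:
  assumes H: "group H"
    and hom: "\<And>f. f \<in> cocycles G (carrier G) n \<Longrightarrow> \<phi> f \<in> carrier H"
      "\<And>f g. f \<in> cocycles G (carrier G) n \<Longrightarrow> g \<in> cocycles G (carrier G) n \<Longrightarrow>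
        \<phi> (f + g) = \<phi> f \<otimes>\<^bsub>H\<^esub> \<phi> g"
    and surj: "\<And>x. x \<in> carrier H \<Longrightarrow> \<exists>f\<in>cocycles G (carrier G) n. \<phi> f = x"
    and ker: "\<And>f. f \<in> cocycles G (carrier G) n \<Longrightarrow>
        \<phi> f = \<one>\<^bsub>H\<^esub> \<longleftrightarrow> f \<in> coboundaries G (carrier G) n"
  shows "group_cohomology G n \<cong> H"
proof -
  let ?Z = "(cochain_group G n)\<lparr>carrier := cocycle_set G n\<rparr>"
  interpret C: comm_group "cochain_group G n" by (rule comm_group_cochain_group)
  have chom: "group_hom (cochain_group G n) (cochain_group G (Suc n)) (coboundary G n)"
    using coboundary_hom[OF is_group] comm_group.axioms(2)[OF comm_group_cochain_group]
    by (auto simp: group_hom_def group_hom_axioms_def)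
  have Z: "group ?Z"
    by (rule C.subgroup_imp_group) (unfold cocycle_set_def, rule group_hom.subgroup_kernel[OF chom])
  have mult: "f \<otimes>\<^bsub>cochain_group G n\<^esub> g = f + g" for f g
    by (simp add: cochain_group_def plus_fun_def)
  have "\<phi> \<in> hom ?Z H"
    by (rule homI) (simp_all add: cocycle_set_eq hom mult)
  then have gh: "group_hom ?Z H \<phi>"
    using Z H by (simp add: group_hom_def group_hom_axioms_def)
  have "\<phi> ` carrier ?Z = carrier H"
    using hom(1) surj by (auto simp: cocycle_set_eq image_iff)
  then have "?Z Mod kernel ?Z H \<phi> \<cong> H" by (rule group_hom.FactGroup_iso[OF gh])
  moreover have "kernel ?Z H \<phi> = coboundary_set G n"
    using ker coboundaries_subset_cocycles[OF subset_refl]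
    by (auto simp: kernel_def cocycle_set_eq coboundary_set_eq)
  ultimately show ?thesis by (simp add: group_cohomology_def)
qed

lemma trivial_group_cohomology:
  assumes "cocycles G (carrier G) n \<subseteq> coboundaries G (carrier G) n"
  shows "trivial_group (group_cohomology G n)"
proof -
  have "group_cohomology G n \<cong> singleton_group ()"
  proof (rule group_cohomology_iso[where \<phi> = "\<lambda>_. ()", OF singleton_group])
    show "\<exists>f\<in>cocycles G (carrier G) n. () = x" for x
      using cocycles_linear(1)[of G "carrier G" n] by auto
  qed (use assms in \<open>auto simp: singleton_group_def[of "()"]\<close>)
  moreover have "Group.group (group_cohomology G n)"
    using comm_group.axioms(2)[OF comm_group_group_cohomology[OF is_group]] .
  ultimately show ?thesis
    by (metis isomorphic_group_triviality singleton_group trivial_singleton_group)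
qed

text \<open>A presentation with two generators: \<open>h\<close> is a surjection from pairs of
  integers whose kernel is the group of relations between \<open>c1\<close> and
  \<open>c2\<close>.\<close>

lemma group_cohomology_iso_generators:
  fixes h :: "int \<Rightarrow> int \<Rightarrow> 'h"
  assumes H: "group H"
    and c: "c1 \<in> cocycles G (carrier G) n" "c2 \<in> cocycles G (carrier G) n"
    and gen: "\<And>f. f \<in> cocycles G (carrier G) n \<Longrightarrow>
        \<exists>x y. f - of_int x * c1 - of_int y * c2 \<in> coboundaries G (carrier G) n"
    and rel: "\<And>x y. of_int x * c1 + of_int y * c2 \<in> coboundaries G (carrier G) n \<longleftrightarrow> h x y = \<one>\<^bsub>H\<^esub>"
    and hom: "\<And>x y. h x y \<in> carrier H" "\<And>x y x' y'. h (x + x') (y + y') = h x y \<otimes>\<^bsub>H\<^esub> h x' y'"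
    and surj: "\<And>u. u \<in> carrier H \<Longrightarrow> \<exists>x y. h x y = u"
  shows "group_cohomology G n \<cong> H"
proof -
  interpret H: group H by fact
  let ?B = "coboundaries G (carrier G) n" and ?Z = "cocycles G (carrier G) n"
  define P where "P f p \<longleftrightarrow> f - of_int (fst p) * c1 - of_int (snd p) * c2 \<in> ?B" for f and p :: "int \<times> int"
  \<comment> \<open>The coefficients are an arbitrary choice; two choices differ by a relation, on
    which \<open>h\<close> is trivial.\<close>
  define \<phi> where "\<phi> f = (let p = SOME p. P f p in h (fst p) (snd p))" for f
  have \<phi>: "\<phi> f = h x y" if f: "f \<in> ?Z" and xy: "P f (x, y)" for f x y
  proof -
    obtain x' y' where *: "(SOME p. P f p) = (x', y')" by (cases "SOME p. P f p")
    have "P f (x', y')" unfolding *[symmetric] by (rule someI[of "P f"]) (rule xy)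
    then have "(f - of_int x' * c1 - of_int y' * c2) - (f - of_int x * c1 - of_int y * c2) \<in> ?B"
      using xy unfolding P_def by (metis coboundaries_linear(3) fst_conv snd_conv)
    moreover have "(f - of_int x' * c1 - of_int y' * c2) - (f - of_int x * c1 - of_int y * c2) =
        of_int (x - x') * c1 + of_int (y - y') * c2" by (simp add: algebra_simps)
    ultimately have "h (x - x') (y - y') = \<one>\<^bsub>H\<^esub>" by (simp only: rel)
    then have "h x y = h x' y'" using hom(2)[of "x - x'" x' "y - y'" y'] hom(1) by simp
    then show ?thesis by (simp add: \<phi>_def *)
  qed
  have ex: "\<exists>x y. P f (x, y)" if "f \<in> ?Z" for f using gen[OF that] by (simp add: P_def)
  show ?thesis
  proof (rule group_cohomology_iso[OF H, of n \<phi>])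
    show "\<phi> f \<in> carrier H" for f unfolding \<phi>_def Let_def by (rule hom(1))
    show "\<phi> (f + g) = \<phi> f \<otimes>\<^bsub>H\<^esub> \<phi> g" if f: "f \<in> ?Z" and g: "g \<in> ?Z" for f g
    proof -
      obtain x y x' y' where p: "P f (x, y)" "P g (x', y')" using ex f g by blast
      then have "(f - of_int x * c1 - of_int y * c2) + (g - of_int x' * c1 - of_int y' * c2) \<in> ?B"
        unfolding P_def by (metis coboundaries_linear(2) fst_conv snd_conv)
      moreover have "(f - of_int x * c1 - of_int y * c2) + (g - of_int x' * c1 - of_int y' * c2) =
        f + g - of_int (x + x') * c1 - of_int (y + y') * c2" by (simp add: algebra_simps)
      ultimately have "P (f + g) (x + x', y + y')" by (simp add: P_def)
      then show ?thesis
        by (simp only: \<phi>[OF f p(1)] \<phi>[OF g p(2)] \<phi>[OF cocycles_linear(2)[OF f g]] hom(2))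
    qed
    show "\<phi> f = \<one>\<^bsub>H\<^esub> \<longleftrightarrow> f \<in> ?B" if f: "f \<in> ?Z" for f
    proof -
      obtain x y where p: "P f (x, y)" using ex f by blast
      let ?u = "of_int x * c1 + of_int y * c2"
      have *: "f - ?u \<in> ?B" using p by (simp add: P_def algebra_simps)
      have "f \<in> ?B \<longleftrightarrow> ?u \<in> ?B"
        using coboundaries_linear(2)[OF *, of ?u] coboundaries_linear(3)[OF _ *, of f] by auto
      then show ?thesis using rel \<phi>[OF f p] by simp
    qed
    show "\<exists>f\<in>?Z. \<phi> f = u" if u: "u \<in> carrier H" for u
    proof -
      obtain x y where xy: "h x y = u" using surj[OF u] by (elim exE)
      have Z: "of_int x * c1 + of_int y * c2 \<in> ?Z"
        by (rule cocycles_linear(2)[OF cocycles_linear(4)[OF c(1)] cocycles_linear(4)[OF c(2)]])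
      have "P (of_int x * c1 + of_int y * c2) (x, y)"
        using coboundaries_linear(1) by (simp add: P_def)
      from \<phi>[OF Z this] Z xy show ?thesis by blast
    qed
  qed
qed

end

context group_with_class
begin

text \<open>A class with primitives on \<open>A\<close> and on \<open>B\<close> is the connecting
  image of their difference on \<open>C\<close>. All relations follow by applying this to the given
  primitives of multiples of c and to the parts into which \<open>\<psi>\<close> splits.\<close>

lemma amalgam_even_cohomology:
  assumes gl: "glued G A B C"
    and A: "even_coh A 12" "odd_coh A" and B: "even_coh B 12" "odd_coh B" and C: "even_coh C 6"
    and \<phi>A: "\<phi>A \<in> cochains G A (Suc 0)" "coboundary G (Suc 0) \<phi>A = of_int 12 * c"
    and \<phi>B: "\<phi>B \<in> cochains G B (Suc 0)" "coboundary G (Suc 0) \<phi>B = of_int 12 * c"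
    and \<psi>: "\<psi> \<in> cochains G C (Suc 0)" "coboundary G (Suc 0) \<psi> = of_int 6 * c"
    and t: "t = of_int 2 * \<psi> - \<phi>B"
    and \<phi>t: "\<phi>A - \<phi>B - of_int 2 * t \<in> coboundaries G C (Suc 0)"
    and C1: "\<And>f j. f \<in> cocycles G C (Suc (2 * j)) \<Longrightarrow>
      \<exists>k. f - of_int k * cup_pow G c (Suc 0) j t \<in> coboundaries G C (Suc (2 * j))"
    and C2: "\<And>k j. of_int k * cup_pow G c (Suc 0) j t \<in> coboundaries G C (Suc (2 * j))
      \<longleftrightarrow> (if j = 0 then k = 0 else 2 dvd k)"
  obtains l where "l \<in> cocycles G (A \<union> B) 2"
    "\<And>j f. f \<in> cocycles G (A \<union> B) (2 * Suc j) \<Longrightarrow>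
       \<exists>x y. f - of_int x * cp (Suc j) - of_int y * cup_pow G c 2 j l \<in> coboundaries G (A \<union> B) (2 * Suc j)"
    "\<And>j x y. of_int x * cp (Suc j) + of_int y * cup_pow G c 2 j l \<in> coboundaries G (A \<union> B) (2 * Suc j)
      \<longleftrightarrow> (if j = 0 then \<exists>s. x = 12 * s \<and> y = - 4 * s else 12 dvd x \<and> 4 dvd y)"
proof -
  note sub = glued_subset[OF gl]
  have sub': "A \<union> B \<subseteq> carrier G" using sub by auto
  note lin = cochains_linear and blin = coboundaries_linear
  let ?U = "A \<union> B"
  \<comment> \<open>Splitting the primitive of 6 c on \<open>C\<close> is the origin of
    \<open>l\<close>: the coboundary of the \<open>A\<close>-part is bounded on \<open>A\<close>,
    and it equals 6 c minus the coboundary of the \<open>B\<close>-part.\<close>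
  obtain \<psi>A \<psi>B where \<psi>AB: "\<psi>A \<in> cochains G A (Suc 0)" "\<psi>B \<in> cochains G B (Suc 0)" "\<psi> = \<psi>A + \<psi>B"
    using glued_split[OF gl \<psi>(1)] .
  define l where "l = coboundary G (Suc 0) \<psi>A"
  have l_alt: "l = of_int 6 * c - coboundary G (Suc 0) \<psi>B"
    using \<psi>(2) by (simp add: \<psi>AB(3) l_def coboundary_add algebra_simps)
  have cU: "c \<in> cocycles G K (Suc (Suc 0))" if "K \<subseteq> carrier G" for K
    using c_cocycle[OF that] by (simp add: numeral_2_eq_2)
  have lA: "l \<in> cochains G A (Suc (Suc 0))"
    unfolding l_def using \<psi>AB sub by (intro coboundary_cochains)
  have lB: "l \<in> cochains G B (Suc (Suc 0))"
    unfolding l_alt using \<psi>AB sub cocyclesD(1)[OF cU] by (intro lin coboundary_cochains) auto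
  have lU: "l \<in> cocycles G ?U (Suc (Suc 0))"
    using lA lB by (intro cocyclesI) (simp_all add: cochains_Un l_def)
  define P1 where "P1 j f = cup_pow G c (Suc 0) j f" for j f
  define P2 where "P2 j f = cup_pow G c (Suc (Suc 0)) j f" for j f
  have P1c: "P1 j f \<in> cochains G K (Suc (2 * j))" if "f \<in> cochains G K (Suc 0)" "K \<subseteq> carrier G" for j f K
    using cup_pow_cochains[OF that, of j] by (simp add: P1_def)
  have P2c: "P2 j f \<in> cocycles G K (Suc (Suc (2 * j)))"
    if "f \<in> cocycles G K (Suc (Suc 0))" "K \<subseteq> carrier G" for j f K
    using cup_pow_cocycles[OF that, of j] by (simp add: P2_def)
  have P2b: "P2 j f \<in> coboundaries G K (Suc (Suc (2 * j)))"
    if "f \<in> coboundaries G K (Suc (Suc 0))" "K \<subseteq> carrier G" for j f K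
    using cup_pow_coboundaries[OF that, of j] by (simp add: P2_def)
  have dP1: "coboundary G (Suc (2 * j)) (P1 j f) = P2 j (coboundary G (Suc 0) f)" for j f
    using coboundary_cup_pow[of "Suc 0" j f] by (simp add: P1_def P2_def)
  have cpP: "cp (Suc j) = P2 j c" for j
    unfolding cp_Suc P2_def numeral_2_eq_2 ..
  have P1lin: "P1 j (f + g) = P1 j f + P1 j g" "P1 j (f - g) = P1 j f - P1 j g"
    "P1 j (of_int k * f) = of_int k * P1 j f" for j f g k
    by (simp_all only: P1_def cup_pow_linear)
  have P2lin: "P2 j (f + g) = P2 j f + P2 j g" "P2 j (f - g) = P2 j f - P2 j g"
    "P2 j (of_int k * f) = of_int k * P2 j f" for j f g k
    by (simp_all only: P2_def cup_pow_linear)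
  have ev: "2 * Suc j = Suc (Suc (2 * j))" for j by simp
  have exact: "x \<in> coboundaries G ?U (Suc (Suc (2 * j)))"
    if "\<alpha> \<in> cochains G A (Suc (2 * j))" "\<beta> \<in> cochains G B (Suc (2 * j))"
      "x = coboundary G (Suc (2 * j)) \<alpha>" "x = coboundary G (Suc (2 * j)) \<beta>"
      "\<alpha> - \<beta> \<in> coboundaries G C (Suc (2 * j))" for x \<alpha> \<beta> j
    using glued_exact[OF gl that(1,2,3,4) cocycles_linear(1)] that(5) by simp
  \<comment> \<open>A primitive of 2 l on \<open>B\<close>; on \<open>A\<close> there is twice
    \<open>\<psi>A\<close>. Their difference is \<open>t\<close>, which makes 2 l the connecting
    image of \<open>t\<close>.\<close>
  define \<mu> where "\<mu> = \<phi>B - of_int 2 * \<psi>B"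
  have \<mu>: "\<mu> \<in> cochains G B (Suc 0)" unfolding \<mu>_def using \<phi>B \<psi>AB by (intro lin)
  have d\<mu>: "coboundary G (Suc 0) \<mu> = of_int 2 * l"
  proof -
    have "coboundary G (Suc 0) \<mu> = of_int 12 * c - of_int 2 * coboundary G (Suc 0) \<psi>B"
      by (simp only: \<mu>_def coboundary_linear \<phi>B(2))
    then show ?thesis by (simp add: l_alt algebra_simps)
  qed
  have t\<mu>: "t = of_int 2 * \<psi>A - \<mu>"
    by (simp add: t \<mu>_def \<psi>AB(3) algebra_simps)
  have evA: "of_int k * P2 j c \<in> coboundaries G A (Suc (Suc (2 * j))) \<longleftrightarrow> 12 dvd k" for k j
    using even_coh_iff[OF A(1), of k j] unfolding cpP ev .
  have evB: "of_int k * P2 j c \<in> coboundaries G B (Suc (Suc (2 * j))) \<longleftrightarrow> 12 dvd k" for k j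
    using even_coh_iff[OF B(1), of k j] unfolding cpP ev .
  have evC: "of_int k * P2 j c \<in> coboundaries G C (Suc (Suc (2 * j))) \<longleftrightarrow> 6 dvd k" for k j
    using even_coh_iff[OF C(1), of k j] unfolding cpP ev .
  have P2lA: "P2 j l \<in> coboundaries G A (Suc (Suc (2 * j)))" for j
    by (rule P2b[OF _ sub(1)]) (simp add: l_def coboundariesI \<psi>AB)
  have P2lB: "of_int 6 * P2 j c - P2 j l \<in> coboundaries G B (Suc (Suc (2 * j)))" for j
  proof -
    have "P2 j (of_int 6 * c - l) \<in> coboundaries G B (Suc (Suc (2 * j)))"
      by (rule P2b[OF _ sub(2)]) (simp add: l_alt coboundariesI \<psi>AB)
    then show ?thesis by (simp only: P2lin)
  qed
  have P2U: "P2 j c \<in> cocycles G ?U (Suc (Suc (2 * j)))" "P2 j l \<in> cocycles G ?U (Suc (Suc (2 * j)))" for j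
    using P2c[OF cU[OF sub'] sub'] P2c[OF lU sub'] by auto
  have UA: "f \<in> coboundaries G ?U n \<Longrightarrow> f \<in> coboundaries G A n" for f n
    by (rule coboundaries_mono[of A ?U]) auto
  have UB: "f \<in> coboundaries G ?U n \<Longrightarrow> f \<in> coboundaries G B n" for f n
    by (rule coboundaries_mono[of B ?U]) auto
  note gA = glued_cochains(1)[OF gl] and gB = glued_cochains(2)[OF gl]
  \<comment> \<open>Both 12 c and 4 l are connecting images of 2 t: the first by
    \<open>\<phi>t\<close>, the second by doubling the primitives of 2 l.\<close>
  have rel1: "of_int 12 * c - of_int 4 * l \<in> coboundaries G ?U (Suc (Suc 0))"
  proof -
    have "of_int 12 * c - of_int 4 * l \<in> coboundaries G ?U (Suc (Suc (2 * 0)))"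
    proof (rule exact[of "\<phi>A - of_int 4 * \<psi>A" 0 "\<phi>B - of_int 2 * \<mu>"])
      show "\<phi>A - of_int 4 * \<psi>A \<in> cochains G A (Suc (2 * 0))" using \<phi>A \<psi>AB by (simp only: lin mult_0_right)
      show "\<phi>B - of_int 2 * \<mu> \<in> cochains G B (Suc (2 * 0))" using \<phi>B \<mu> by (simp only: lin mult_0_right)
      show "of_int 12 * c - of_int 4 * l = coboundary G (Suc (2 * 0)) (\<phi>A - of_int 4 * \<psi>A)"
        by (simp only: coboundary_linear \<phi>A(2) l_def mult_0_right)
      show "of_int 12 * c - of_int 4 * l = coboundary G (Suc (2 * 0)) (\<phi>B - of_int 2 * \<mu>)"
        by (simp only: coboundary_linear \<phi>B(2) d\<mu> mult_0_right) simp
      have "\<phi>A - of_int 4 * \<psi>A - (\<phi>B - of_int 2 * \<mu>) = \<phi>A - \<phi>B - of_int 2 * t"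
        by (simp add: t\<mu> algebra_simps)
      then show "\<phi>A - of_int 4 * \<psi>A - (\<phi>B - of_int 2 * \<mu>) \<in> coboundaries G C (Suc (2 * 0))"
        using \<phi>t by (simp only: mult_0_right)
    qed
    then show ?thesis by simp
  qed
  have rel: "of_int (12 * s) * P2 j c - of_int (4 * s) * P2 j l \<in> coboundaries G ?U (Suc (Suc (2 * j)))" for s j
  proof -
    have "of_int s * P2 j (of_int 12 * c - of_int 4 * l) \<in> coboundaries G ?U (Suc (Suc (2 * j)))"
      by (intro blin P2b rel1 sub')
    then show ?thesis by (simp only: P2lin) (simp add: algebra_simps)
  qed
  have gen: "\<exists>x y. f - of_int x * P2 j c - of_int y * P2 j l \<in> coboundaries G ?U (Suc (Suc (2 * j)))"
    if f: "f \<in> cocycles G ?U (Suc (Suc (2 * j)))" for f j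
  proof -
    have "f \<in> cocycles G A (2 * Suc j)" using f cocycles_mono[of A ?U] by auto
    then obtain x where "f - of_int x * cp (Suc j) \<in> coboundaries G A (2 * Suc j)"
      using even_cohE[OF A(1)] by blast
    then have x: "f - of_int x * P2 j c \<in> coboundaries G A (Suc (Suc (2 * j)))" unfolding cpP ev .
    define g where "g = f - of_int x * P2 j c"
    have g: "g \<in> cocycles G ?U (Suc (Suc (2 * j)))" unfolding g_def using f P2U by (intro cocycles_linear)
    have "g \<in> cocycles G B (2 * Suc j)" using g cocycles_mono[of B ?U] by auto
    then obtain y where "g - of_int y * cp (Suc j) \<in> coboundaries G B (2 * Suc j)"
      using even_cohE[OF B(1)] by blast
    then have y: "g - of_int y * P2 j c \<in> coboundaries G B (Suc (Suc (2 * j)))" unfolding cpP ev .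
    \<comment> \<open>On \<open>C\<close> the class of \<open>g\<close> vanishes because it vanishes
      on \<open>A\<close>. As c has order 6 there, \<open>y\<close> is a multiple of 6 and can be
      absorbed by \<open>l\<close> without disturbing \<open>A\<close>.\<close>
    have "g - (g - of_int y * P2 j c) \<in> coboundaries G C (Suc (Suc (2 * j)))"
      by (rule blin(3)[OF glued_coboundaries(1)[OF gl] glued_coboundaries(2)[OF gl y]])
        (unfold g_def, rule x)
    then have "6 dvd y" using evC by simp
    then obtain y' where y': "y = 6 * y'" by blast
    have "(g - of_int y * P2 j c) + of_int y' * (of_int 6 * P2 j c - P2 j l) \<in> coboundaries G B (Suc (Suc (2 * j)))"
      by (rule blin(2)[OF y blin(4)[OF P2lB]])
    moreover have "(g - of_int y * P2 j c) + of_int y' * (of_int 6 * P2 j c - P2 j l) = g - of_int y' * P2 j l"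
      by (simp add: y' algebra_simps)
    ultimately have gB': "g - of_int y' * P2 j l \<in> coboundaries G B (Suc (Suc (2 * j)))" by (simp only:)
    have gA': "g - of_int y' * P2 j l \<in> coboundaries G A (Suc (Suc (2 * j)))"
      using x P2lA by (intro blin) (simp_all add: g_def)
    obtain \<alpha> where \<alpha>: "\<alpha> \<in> cochains G A (Suc (2 * j))" "g - of_int y' * P2 j l = coboundary G (Suc (2 * j)) \<alpha>"
      using gA' by (rule coboundariesE)
    obtain \<beta> where \<beta>: "\<beta> \<in> cochains G B (Suc (2 * j))" "g - of_int y' * P2 j l = coboundary G (Suc (2 * j)) \<beta>"
      using gB' by (rule coboundariesE)
    have "\<alpha> - \<beta> \<in> cocycles G C (Suc (2 * j))"
      using gA[OF \<alpha>(1)] gB[OF \<beta>(1)] by (intro cocyclesI lin) (simp_all add: coboundary_linear \<alpha>(2)[symmetric] \<beta>(2)[symmetric])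
    then obtain m where m: "\<alpha> - \<beta> - of_int m * P1 j t \<in> coboundaries G C (Suc (2 * j))"
      using C1 unfolding P1_def by blast
    \<comment> \<open>A class that vanishes on \<open>A\<close> and \<open>B\<close> is the
      connecting image of a multiple \<open>m\<close> of t c^j, that is 2 m l c^j.\<close>
    have "g - of_int y' * P2 j l - of_int (2 * m) * P2 j l \<in> coboundaries G ?U (Suc (Suc (2 * j)))"
    proof (rule exact[of "\<alpha> - of_int (2 * m) * P1 j \<psi>A" j "\<beta> - of_int m * P1 j \<mu>"])
      show "\<alpha> - of_int (2 * m) * P1 j \<psi>A \<in> cochains G A (Suc (2 * j))"
        using \<alpha> P1c \<psi>AB sub by (intro lin)
      show "\<beta> - of_int m * P1 j \<mu> \<in> cochains G B (Suc (2 * j))"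
        using \<beta> P1c \<mu> sub by (intro lin)
      show "g - of_int y' * P2 j l - of_int (2 * m) * P2 j l =
          coboundary G (Suc (2 * j)) (\<alpha> - of_int (2 * m) * P1 j \<psi>A)"
        by (simp only: coboundary_linear dP1 \<alpha>(2)[symmetric] l_def[symmetric])
      show "g - of_int y' * P2 j l - of_int (2 * m) * P2 j l =
          coboundary G (Suc (2 * j)) (\<beta> - of_int m * P1 j \<mu>)"
        by (simp only: coboundary_linear dP1 \<beta>(2) d\<mu> P2lin) (simp add: algebra_simps)
      have "\<alpha> - of_int (2 * m) * P1 j \<psi>A - (\<beta> - of_int m * P1 j \<mu>) = \<alpha> - \<beta> - of_int m * P1 j t"
        by (simp only: t\<mu> P1lin) (simp add: algebra_simps)
      then show "\<alpha> - of_int (2 * m) * P1 j \<psi>A - (\<beta> - of_int m * P1 j \<mu>) \<in> coboundaries G C (Suc (2 * j))"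
        using m by (simp only:)
    qed
    moreover have "g - of_int y' * P2 j l - of_int (2 * m) * P2 j l =
        f - of_int x * P2 j c - of_int (y' + 2 * m) * P2 j l"
      by (simp add: g_def algebra_simps)
    ultimately show ?thesis by metis
  qed
  \<comment> \<open>For \<open>j \<noteq> 0\<close> twice t c^j is a coboundary on \<open>C\<close>,
    so its connecting image 4 l c^j vanishes.\<close>
  have four: "of_int (4 * b) * P2 j l \<in> coboundaries G ?U (Suc (Suc (2 * j)))" if "j \<noteq> 0" for b j
  proof (rule exact[of "of_int (4 * b) * P1 j \<psi>A" j "of_int (2 * b) * P1 j \<mu>"])
    show "of_int (4 * b) * P1 j \<psi>A \<in> cochains G A (Suc (2 * j))"
      using P1c \<psi>AB sub by (intro lin)
    show "of_int (2 * b) * P1 j \<mu> \<in> cochains G B (Suc (2 * j))"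
      using P1c \<mu> sub by (intro lin)
    show "of_int (4 * b) * P2 j l = coboundary G (Suc (2 * j)) (of_int (4 * b) * P1 j \<psi>A)"
      by (simp only: coboundary_linear dP1 l_def)
    show "of_int (4 * b) * P2 j l = coboundary G (Suc (2 * j)) (of_int (2 * b) * P1 j \<mu>)"
      by (simp only: coboundary_linear dP1 d\<mu> P2lin) (simp add: algebra_simps)
    have "of_int (4 * b) * P1 j \<psi>A - of_int (2 * b) * P1 j \<mu> = of_int (2 * b) * P1 j t"
      by (simp only: t\<mu> P1lin) (simp add: algebra_simps)
    then show "of_int (4 * b) * P1 j \<psi>A - of_int (2 * b) * P1 j \<mu> \<in> coboundaries G C (Suc (2 * j))"
      using C2[of "2 * b" j] that by (simp add: P1_def)
  qed
  have iff: "of_int x * P2 j c + of_int y * P2 j l \<in> coboundaries G ?U (Suc (Suc (2 * j)))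
      \<longleftrightarrow> (if j = 0 then \<exists>s. x = 12 * s \<and> y = - 4 * s else 12 dvd x \<and> 4 dvd y)"
    (is "?lhs \<longleftrightarrow> ?rhs") for x y j
  proof
    assume ?rhs
    show ?lhs
    proof (cases "j = 0")
      case True
      then obtain s where s: "x = 12 * s" "y = - 4 * s" using \<open>?rhs\<close> by auto
      show ?thesis using rel[of s j] by (simp add: s)
    next
      case False
      then obtain a b where ab: "x = 12 * a" "y = 4 * b" using \<open>?rhs\<close> by (auto elim!: dvdE)
      have "(of_int (12 * a) * P2 j c - of_int (4 * a) * P2 j l) + of_int (4 * (a + b)) * P2 j l
          \<in> coboundaries G ?U (Suc (Suc (2 * j)))"
        by (intro blin(2) rel four False)
      then show ?thesis by (simp add: ab algebra_simps)
    qed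
  next
    assume L: ?lhs
    have "(of_int x * P2 j c + of_int y * P2 j l) - of_int y * P2 j l \<in> coboundaries G A (Suc (Suc (2 * j)))"
      by (rule blin(3)[OF UA[OF L] blin(4)[OF P2lA]])
    then have "12 dvd x" using evA by simp
    then obtain s where s: "x = 12 * s" by blast
    \<comment> \<open>Subtracting \<open>s\<close> times the known relation eliminates c.
      Restriction to \<open>B\<close>, where \<open>l\<close> becomes 6 c, then shows that the
      remaining coefficient is even.\<close>
    define y2 where "y2 = y + 4 * s"
    have "(of_int x * P2 j c + of_int y * P2 j l) - (of_int (12 * s) * P2 j c - of_int (4 * s) * P2 j l)
        \<in> coboundaries G ?U (Suc (Suc (2 * j)))"
      by (rule blin(3)[OF L rel])
    then have y2: "of_int y2 * P2 j l \<in> coboundaries G ?U (Suc (Suc (2 * j)))"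
      by (simp add: s y2_def algebra_simps)
    have "of_int y2 * (of_int 6 * P2 j c - P2 j l) + of_int y2 * P2 j l \<in> coboundaries G B (Suc (Suc (2 * j)))"
      by (intro blin(2) blin(4) P2lB UB y2)
    moreover have "of_int y2 * (of_int 6 * P2 j c - P2 j l) + of_int y2 * P2 j l = of_int (6 * y2) * P2 j c"
      by (simp add: algebra_simps)
    ultimately have "12 dvd 6 * y2" by (simp only: evB)
    then obtain y3 where y3: "y2 = 2 * y3" by (auto elim!: dvdE)
    obtain z where z: "z \<in> cochains G ?U (Suc (2 * j))" "of_int y2 * P2 j l = coboundary G (Suc (2 * j)) z"
      using y2 by (rule coboundariesE)
    have zA: "z \<in> cochains G A (Suc (2 * j))" and zB: "z \<in> cochains G B (Suc (2 * j))"
      using z(1) by (auto simp: cochains_Un)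
    \<comment> \<open>The explicit primitives on \<open>A\<close> and \<open>B\<close> are compared
      with the common primitive \<open>z\<close>. Odd cohomology vanishes on both sides, so their
      difference, a multiple of t c^j, is a coboundary on \<open>C\<close>.\<close>
    have "of_int y2 * P1 j \<psi>A - z \<in> cocycles G A (Suc (2 * j))"
    proof (rule cocyclesI)
      show "of_int y2 * P1 j \<psi>A - z \<in> cochains G A (Suc (2 * j))"
        using zA P1c \<psi>AB sub by (intro lin)
      show "coboundary G (Suc (2 * j)) (of_int y2 * P1 j \<psi>A - z) = 0"
        by (simp only: coboundary_linear dP1 l_def[symmetric] z(2)[symmetric]) simp
    qed
    then have a: "of_int y2 * P1 j \<psi>A - z \<in> coboundaries G A (Suc (2 * j))" by (rule odd_cohD[OF A(2)])
    have "of_int y3 * P1 j \<mu> - z \<in> cocycles G B (Suc (2 * j))"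
    proof (rule cocyclesI)
      show "of_int y3 * P1 j \<mu> - z \<in> cochains G B (Suc (2 * j))"
        using zB P1c \<mu> sub by (intro lin)
      show "coboundary G (Suc (2 * j)) (of_int y3 * P1 j \<mu> - z) = 0"
        by (simp only: coboundary_linear dP1 d\<mu> P2lin z(2)[symmetric]) (simp add: y3 algebra_simps)
    qed
    then have b: "of_int y3 * P1 j \<mu> - z \<in> coboundaries G B (Suc (2 * j))" by (rule odd_cohD[OF B(2)])
    have "(of_int y2 * P1 j \<psi>A - z) - (of_int y3 * P1 j \<mu> - z) \<in> coboundaries G C (Suc (2 * j))"
      by (rule blin(3)[OF glued_coboundaries(1)[OF gl a] glued_coboundaries(2)[OF gl b]])
    moreover have "(of_int y2 * P1 j \<psi>A - z) - (of_int y3 * P1 j \<mu> - z) = of_int y3 * P1 j t"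
      by (simp only: t\<mu> P1lin y3) (simp add: algebra_simps)
    ultimately have "if j = 0 then y3 = 0 else 2 dvd y3" using C2[of y3 j] by (simp add: P1_def)
    then show ?rhs using s y3 y2_def by (cases "j = 0") (simp, simp, presburger)
  qed
  show ?thesis
  proof (rule that[of l])
    show "l \<in> cocycles G ?U 2" using lU by (simp add: numeral_2_eq_2)
    have two: "cup_pow G c 2 j l = P2 j l" for j by (simp add: P2_def numeral_2_eq_2)
    show "\<exists>x y. f - of_int x * cp (Suc j) - of_int y * cup_pow G c 2 j l \<in> coboundaries G ?U (2 * Suc j)"
      if "f \<in> cocycles G ?U (2 * Suc j)" for j f
      using gen[of f j] that unfolding two cpP ev .
    show "of_int x * cp (Suc j) + of_int y * cup_pow G c 2 j l \<in> coboundaries G ?U (2 * Suc j)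
      \<longleftrightarrow> (if j = 0 then \<exists>s. x = 12 * s \<and> y = - 4 * s else 12 dvd x \<and> 4 dvd y)" for j x y
      using iff[of x j y] unfolding two cpP ev .
  qed
qed

end

section \<open>Splitting invariant functions along a forest\<close>

text \<open>The argument \<open>y\<close> is an edge; \<open>\<kappa> y\<close> and
  \<open>\<mu> y\<close>, given as sets of edges, are its end vertices and \<open>a y\<close>,
  \<open>b y\<close> their heights. The value at the first end is prescribed so that the values at
  both ends of the edge to its lower neighbour add up to \<open>h\<close>; vertices without lower
  neighbour get 0. Each call exchanges the two classes of vertices.\<close>

function forest_potential ::
  "('y \<Rightarrow> 'y set) \<Rightarrow> ('y \<Rightarrow> nat) \<Rightarrow> ('y \<Rightarrow> 'y set) \<Rightarrow> ('y \<Rightarrow> nat) \<Rightarrow> ('y \<Rightarrow> int) \<Rightarrow> 'y \<Rightarrow> int" where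
  "forest_potential \<kappa> a \<mu> b h y =
     (if \<exists>y'\<in>\<kappa> y. b y' < a y
      then let y' = SOME y'. y' \<in> \<kappa> y \<and> b y' < a y in h y' - forest_potential \<mu> b \<kappa> a h y'
      else 0)"
  by pat_completeness auto
termination
proof (relation "measure (\<lambda>(\<kappa>, a, \<mu>, b, h, y). a y)")
  fix \<kappa> \<mu> :: "'y \<Rightarrow> 'y set" and a b :: "'y \<Rightarrow> nat" and h :: "'y \<Rightarrow> int" and y x
  assume "\<exists>y'\<in>\<kappa> y. b y' < a y" "x = (SOME y'. y' \<in> \<kappa> y \<and> b y' < a y)"
  then have "b x < a y" using someI_ex[of "\<lambda>y'. y' \<in> \<kappa> y \<and> b y' < a y"] by blast
  then show "((\<mu>, b, \<kappa>, a, h, x), \<kappa>, a, \<mu>, b, h, y) \<in> measure (\<lambda>(\<kappa>, a, \<mu>, b, h, y). a y)"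
    by simp
qed simp

declare forest_potential.simps [simp del]

lemma forest_potential_cong:
  assumes "\<kappa> y' = \<kappa> y" "a y' = a y"
  shows "forest_potential \<kappa> a \<mu> b h y' = forest_potential \<kappa> a \<mu> b h y"
proof -
  have "forest_potential \<kappa> a \<mu> b h y' =
     (if \<exists>y'\<in>\<kappa> y. b y' < a y
      then let y' = SOME y'. y' \<in> \<kappa> y \<and> b y' < a y in h y' - forest_potential \<mu> b \<kappa> a h y'
      else 0)"
    by (subst forest_potential.simps) (simp only: assms)
  also have "\<dots> = forest_potential \<kappa> a \<mu> b h y"
    by (rule forest_potential.simps[symmetric])
  finally show ?thesis .
qed

text \<open>The edge chosen by the recursion may differ from \<open>y\<close>, but
  \<open>parent\<close> gives it the same value and the same lower end.\<close>

lemma forest_potential_parent: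
  assumes "y \<in> \<kappa> y" "b y < a y"
    and parent: "\<And>y'. y' \<in> \<kappa> y \<Longrightarrow> b y' < a y \<Longrightarrow> h y' = h y \<and> \<mu> y' = \<mu> y \<and> b y' = b y"
  shows "h y = forest_potential \<kappa> a \<mu> b h y + forest_potential \<mu> b \<kappa> a h y"
proof -
  define y' where "y' = (SOME y'. y' \<in> \<kappa> y \<and> b y' < a y)"
  have "y' \<in> \<kappa> y \<and> b y' < a y" unfolding y'_def by (rule someI[of _ y]) (use assms(1,2) in simp)
  then have *: "h y' = h y" "\<mu> y' = \<mu> y" "b y' = b y" using parent[of y'] by auto
  have "forest_potential \<kappa> a \<mu> b h y = h y' - forest_potential \<mu> b \<kappa> a h y'"
    using assms(1,2) by (subst forest_potential.simps) (auto simp: y'_def Let_def)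
  then show ?thesis using * forest_potential_cong[of \<mu> y' y b] by simp
qed

context group
begin

text \<open>The bipartite graph with the \<open>K'\<close>- and \<open>L'\<close>-orbits of \<open>\<Gamma>\<close> as vertices and the \<open>M'\<close>-orbits as edges
  is a forest: every vertex has at most one edge to a vertex of smaller height.\<close>

lemma glued_by_heights:
  assumes \<Gamma>: "subgroup \<Gamma> G" "subgroup K' G" "subgroup L' G" "K' \<subseteq> \<Gamma>" "L' \<subseteq> \<Gamma>"
    and M': "M' \<subseteq> K'" "M' \<subseteq> L'"
    and ht: "\<And>k g. k \<in> K' \<Longrightarrow> g \<in> \<Gamma> \<Longrightarrow> a (k \<otimes> g) = (a g :: nat)"
      "\<And>k g. k \<in> L' \<Longrightarrow> g \<in> \<Gamma> \<Longrightarrow> b (k \<otimes> g) = (b g :: nat)"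
    and neq: "\<And>g. g \<in> \<Gamma> \<Longrightarrow> a g \<noteq> b g"
    and uK: "\<And>k g. g \<in> \<Gamma> \<Longrightarrow> k \<in> K' \<Longrightarrow> b g < a g \<Longrightarrow> b (k \<otimes> g) < a (k \<otimes> g) \<Longrightarrow> k \<in> M'"
    and uL: "\<And>k g. g \<in> \<Gamma> \<Longrightarrow> k \<in> L' \<Longrightarrow> a g < b g \<Longrightarrow> a (k \<otimes> g) < b (k \<otimes> g) \<Longrightarrow> k \<in> M'"
    and KLM: "K \<subseteq> K'" "L \<subseteq> L'" "M \<subseteq> carrier G" "M' \<subseteq> generate G M"
      "M \<subseteq> generate G K" "M \<subseteq> generate G L"
  shows "glued G K L M"
proof -
  have carr: "\<Gamma> \<subseteq> carrier G" "K' \<subseteq> carrier G" "L' \<subseteq> carrier G"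
    using \<Gamma> by (auto dest: subgroup.subset)
  \<comment> \<open>One representative for each right coset of \<open>\<Gamma>\<close> gives an
    equivariant map \<open>\<rho>\<close> from the whole group to \<open>\<Gamma>\<close>, along
    which the heights are pulled back.\<close>
  define rep where "rep x = (SOME y. y \<in> \<Gamma> #> x)" for x
  define \<rho> where "\<rho> x = x \<otimes> inv (rep x)" for x
  have rep: "rep x \<in> \<Gamma> #> x" if "x \<in> carrier G" for x
    unfolding rep_def by (rule someI[of _ x]) (rule rcos_self[OF that \<Gamma>(1)])
  have rep_carr: "rep x \<in> carrier G" if "x \<in> carrier G" for x
    using rep[OF that] r_coset_subset_G[OF carr(1) that] by auto
  have \<rho>: "\<rho> x \<in> \<Gamma>" if x: "x \<in> carrier G" for x
  proof -
    obtain \<gamma> where \<gamma>: "\<gamma> \<in> \<Gamma>" "rep x = \<gamma> \<otimes> x" using rep[OF x] by (auto simp: r_coset_def)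
    then have "\<rho> x = inv \<gamma>" using x carr by (auto simp: \<rho>_def inv_mult_group m_assoc[symmetric])
    then show ?thesis using \<gamma> subgroup.m_inv_closed[OF \<Gamma>(1)] by simp
  qed
  have \<rho>_mult: "\<rho> (\<gamma> \<otimes> x) = \<gamma> \<otimes> \<rho> x" if "\<gamma> \<in> \<Gamma>" "x \<in> carrier G" for \<gamma> x
  proof -
    have "\<Gamma> #> (\<gamma> \<otimes> x) = \<Gamma> #> x"
      by (rule repr_independence[symmetric]) (use that \<Gamma>(1) in \<open>auto simp: r_coset_def\<close>)
    then have "rep (\<gamma> \<otimes> x) = rep x" by (simp add: rep_def)
    then show ?thesis using that carr rep_carr by (auto simp: \<rho>_def m_assoc)
  qed
  define orb where "orb H xs = {map (\<lambda>x. k \<otimes> x) xs | k. k \<in> H}" for H xs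
  have orb: "xs \<in> orb H xs" "\<And>ys. ys \<in> orb H xs \<Longrightarrow> orb H ys = orb H xs"
    if H: "subgroup H G" and xs: "xs \<in> tuples G n" for H xs n
  proof -
    have Hc: "H \<subseteq> carrier G" using H by (rule subgroup.subset)
    have mm: "map (\<lambda>x. k \<otimes> x) (map (\<lambda>x. k' \<otimes> x) xs) = map (\<lambda>x. (k \<otimes> k') \<otimes> x) xs"
      if "k \<in> H" "k' \<in> H" for k k'
      using subsetD[OF Hc that(1)] subsetD[OF Hc that(2)] xs by (auto simp: tuples_def m_assoc)
    have "map (\<lambda>x. \<one> \<otimes> x) xs = xs" by (rule map_idI) (use xs in \<open>auto simp: tuples_def\<close>)
    then show "xs \<in> orb H xs" unfolding orb_def using subgroup.one_closed[OF H] by force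
    show "orb H ys = orb H xs" if ys: "ys \<in> orb H xs" for ys
    proof -
      obtain k' where k': "k' \<in> H" "ys = map (\<lambda>x. k' \<otimes> x) xs" using ys by (auto simp: orb_def)
      have "map (\<lambda>x. k \<otimes> x) ys = map (\<lambda>x. (k \<otimes> k') \<otimes> x) xs" if "k \<in> H" for k
        using mm[OF that k'(1)] unfolding k'(2) .
      then have "orb H ys = {map (\<lambda>x. (k \<otimes> k') \<otimes> x) xs | k. k \<in> H}"
        unfolding orb_def by (intro Collect_cong) metis
      also have "\<dots> = orb H xs"
      proof
        show "{map (\<lambda>x. (k \<otimes> k') \<otimes> x) xs | k. k \<in> H} \<subseteq> orb H xs"
          unfolding orb_def using subgroup.m_closed[OF H _ k'(1)] by blast
        show "orb H xs \<subseteq> {map (\<lambda>x. (k \<otimes> k') \<otimes> x) xs | k. k \<in> H}"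
        proof
          fix zs assume "zs \<in> orb H xs"
          then obtain k where k: "k \<in> H" "zs = map (\<lambda>x. k \<otimes> x) xs" by (auto simp: orb_def)
          have "k = (k \<otimes> inv k') \<otimes> k'"
            using subsetD[OF Hc k(1)] subsetD[OF Hc k'(1)] by (simp add: m_assoc)
          then have "zs = map (\<lambda>x. (k \<otimes> inv k' \<otimes> k') \<otimes> x) xs" using k(2) by simp
          moreover have "k \<otimes> inv k' \<in> H" using H k(1) k'(1) by (simp add: subgroup.m_closed subgroup.m_inv_closed)
          ultimately show "zs \<in> {map (\<lambda>x. (k \<otimes> k') \<otimes> x) xs | k. k \<in> H}" by blast
        qed
      qed
      finally show ?thesis .
    qed
  qed
  have split: "\<exists>p q. f = p + q \<and> p \<in> cochains G K n \<and> q \<in> cochains G L n" if f: "f \<in> cochains G M n" for f n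
  proof -
    have fM: "f (map (\<lambda>x. k \<otimes> x) xs) = f xs" if "k \<in> M'" "xs \<in> tuples G n" for k xs
      using cochains_generate[OF KLM(3) f] KLM(4) that by (auto simp: cochains_def)
    \<comment> \<open>The action on tuples is free, so the position of a tuple in the forest may be
      read off from its first entry.\<close>
    define a' where "a' xs = a (\<rho> (hd xs))" for xs
    define b' where "b' xs = b (\<rho> (hd xs))" for xs
    define p where "p xs = (if xs \<in> tuples G n then forest_potential (orb K') a' (orb L') b' f xs else 0)" for xs
    define q where "q xs = (if xs \<in> tuples G n then forest_potential (orb L') b' (orb K') a' f xs else 0)" for xs
    have hd: "hd xs \<in> carrier G" "hd (map (\<lambda>x. z \<otimes> x) xs) = z \<otimes> hd xs" if "xs \<in> tuples G n" for xs z
      using that by (cases xs; auto simp: tuples_def)+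
    have a'K: "a' (map (\<lambda>x. k \<otimes> x) xs) = a' xs" if "k \<in> K'" "xs \<in> tuples G n" for k xs
      using that hd \<Gamma> ht(1) \<rho> \<rho>_mult by (simp add: a'_def subset_iff)
    have b'L: "b' (map (\<lambda>x. k \<otimes> x) xs) = b' xs" if "k \<in> L'" "xs \<in> tuples G n" for k xs
      using that hd \<Gamma> ht(2) \<rho> \<rho>_mult by (simp add: b'_def subset_iff)
    have mt: "map (\<lambda>x. k \<otimes> x) xs \<in> tuples G n" if "k \<in> \<Gamma>" "xs \<in> tuples G n" for k xs
      using that carr by (intro map_tuples is_group) auto
    have "p (map (\<lambda>x. k \<otimes> x) xs) = p xs" if k: "k \<in> K'" and xs: "xs \<in> tuples G n" for k xs
    proof -
      have "map (\<lambda>x. k \<otimes> x) xs \<in> orb K' xs" using k by (auto simp: orb_def)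
      then have "forest_potential (orb K') a' (orb L') b' f (map (\<lambda>x. k \<otimes> x) xs) =
          forest_potential (orb K') a' (orb L') b' f xs"
        by (intro forest_potential_cong orb(2)[OF \<Gamma>(2) xs] a'K k xs)
      then show ?thesis using mt[of k xs] k xs \<Gamma> by (auto simp: p_def)
    qed
    moreover have "p xs = 0" if "xs \<notin> tuples G n" for xs
      using that by (simp add: p_def)
    ultimately have p: "p \<in> cochains G K n" using KLM(1) by (auto simp: cochains_def)
    have "q (map (\<lambda>x. k \<otimes> x) xs) = q xs" if k: "k \<in> L'" and xs: "xs \<in> tuples G n" for k xs
    proof -
      have "map (\<lambda>x. k \<otimes> x) xs \<in> orb L' xs" using k by (auto simp: orb_def)
      then have "forest_potential (orb L') b' (orb K') a' f (map (\<lambda>x. k \<otimes> x) xs) =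
          forest_potential (orb L') b' (orb K') a' f xs"
        by (intro forest_potential_cong orb(2)[OF \<Gamma>(3) xs] b'L k xs)
      then show ?thesis using mt[of k xs] k xs \<Gamma> by (auto simp: q_def)
    qed
    moreover have "q xs = 0" if "xs \<notin> tuples G n" for xs
      using that by (simp add: q_def)
    ultimately have q: "q \<in> cochains G L n" using KLM(2) by (auto simp: cochains_def)
    have "f xs = p xs + q xs" if xs: "xs \<in> tuples G n" for xs
    proof -
      have g: "\<rho> (hd xs) \<in> \<Gamma>" using hd(1)[OF xs] by (rule \<rho>)
      \<comment> \<open>Two descending edges at one vertex differ by an element of
        \<open>M'\<close>, which fixes \<open>f\<close> and the lower end. This is the uniqueness
        required by \<open>forest_potential_parent\<close>.\<close>
      have key: "f ys = f xs \<and> orb L' ys = orb L' xs \<and> b' ys = b' xs"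
        if ys: "ys \<in> orb K' xs" "b' ys < a' xs" and lt: "b' xs < a' xs" for ys
      proof -
        obtain k where k: "k \<in> K'" "ys = map (\<lambda>x. k \<otimes> x) xs" using ys by (auto simp: orb_def)
        have \<rho>y: "\<rho> (hd ys) = k \<otimes> \<rho> (hd xs)" using k hd[OF xs] \<rho>_mult \<Gamma>(4) by auto
        have "k \<in> M'"
          using uK[OF g k(1)] lt ys(2) a'K[OF k(1) xs] \<rho>y k(2) by (simp add: a'_def b'_def)
        then have "k \<in> M'" "k \<in> L'" using M' by auto
        moreover have "ys \<in> orb L' xs" using k(2) \<open>k \<in> L'\<close> by (auto simp: orb_def)
        ultimately show ?thesis using fM[OF _ xs] k(2) b'L[OF _ xs] orb(2)[OF \<Gamma>(3) xs] by auto
      qed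
      have key': "f ys = f xs \<and> orb K' ys = orb K' xs \<and> a' ys = a' xs"
        if ys: "ys \<in> orb L' xs" "a' ys < b' xs" and lt: "a' xs < b' xs" for ys
      proof -
        obtain k where k: "k \<in> L'" "ys = map (\<lambda>x. k \<otimes> x) xs" using ys by (auto simp: orb_def)
        have \<rho>y: "\<rho> (hd ys) = k \<otimes> \<rho> (hd xs)" using k hd[OF xs] \<rho>_mult \<Gamma>(5) by auto
        have "k \<in> M'"
          using uL[OF g k(1)] lt ys(2) b'L[OF k(1) xs] \<rho>y k(2) by (simp add: a'_def b'_def)
        then have "k \<in> M'" "k \<in> K'" using M' by auto
        moreover have "ys \<in> orb K' xs" using k(2) \<open>k \<in> K'\<close> by (auto simp: orb_def)
        ultimately show ?thesis using fM[OF _ xs] k(2) a'K[OF _ xs] orb(2)[OF \<Gamma>(2) xs] by auto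
      qed
      have "a' xs \<noteq> b' xs" using neq[OF g] by (simp add: a'_def b'_def)
      then consider "b' xs < a' xs" | "a' xs < b' xs" by linarith
      then show ?thesis
      proof cases
        case 1
        then show ?thesis
          using forest_potential_parent[of xs "orb K'" b' a' f "orb L'", OF orb(1)[OF \<Gamma>(2) xs] 1 key[OF _ _ 1]] xs
          by (simp add: p_def q_def)
      next
        case 2
        then show ?thesis
          using forest_potential_parent[of xs "orb L'" a' b' f "orb K'", OF orb(1)[OF \<Gamma>(3) xs] 2 key'[OF _ _ 2]] xs
          by (simp add: p_def q_def)
      qed
    qed
    then have "f xs = (p + q) xs" for xs
      using f by (cases "xs \<in> tuples G n") (auto simp: p_def q_def cochains_def)
    then have "f = p + q" by (rule ext)
    then show ?thesis using p q by blast
  qed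
  have Kc: "K \<subseteq> carrier G" and Lc: "L \<subseteq> carrier G" using KLM(1,2) carr by auto
  have "cochains G M n = {p + q | p q. p \<in> cochains G K n \<and> q \<in> cochains G L n}" for n
  proof
    show "cochains G M n \<subseteq> {p + q | p q. p \<in> cochains G K n \<and> q \<in> cochains G L n}"
      using split by blast
    have "p \<in> cochains G M n" if "p \<in> cochains G K n" for p
      by (rule cochains_mono[OF KLM(5) cochains_generate[OF Kc that]])
    moreover have "q \<in> cochains G M n" if "q \<in> cochains G L n" for q
      by (rule cochains_mono[OF KLM(6) cochains_generate[OF Lc that]])
    ultimately show "{p + q | p q. p \<in> cochains G K n \<and> q \<in> cochains G L n} \<subseteq> cochains G M n"
      by (auto intro: cochains_add)
  qed
  then show ?thesis unfolding glued_def using Kc Lc KLM(3) by simp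
qed

end

section \<open>Generators of the matrix groups\<close>

definition mat2 :: "rat \<Rightarrow> rat \<Rightarrow> rat \<Rightarrow> rat \<Rightarrow> rat ^ 2 ^ 2" where
  "mat2 a b c d = vector [vector [a, b], vector [c, d]]"

lemma mat2_nth [simp]:
  "mat2 a b c d $ 1 $ 1 = a" "mat2 a b c d $ 1 $ 2 = b"
  "mat2 a b c d $ 2 $ 1 = c" "mat2 a b c d $ 2 $ 2 = d"
  by (simp_all add: mat2_def)

lemma mat2_eq_iff: "A = mat2 a b c d \<longleftrightarrow> A $ 1 $ 1 = a \<and> A $ 1 $ 2 = b \<and> A $ 2 $ 1 = c \<and> A $ 2 $ 2 = d"
  by (auto simp: vec_eq_iff forall_2)

lemma mat2_cases: obtains a b c d where "A = mat2 a b c d"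
  by (meson mat2_eq_iff)

lemma mat2_mult: "mat2 a b c d ** mat2 a' b' c' d' =
    mat2 (a * a' + b * c') (a * b' + b * d') (c * a' + d * c') (c * b' + d * d')"
  by (simp add: mat2_eq_iff matrix_matrix_mult_def sum_2)

lemma matrix_mult_2_nth: "((A :: rat ^ 2 ^ 2) ** B) $ i $ j = A $ i $ 1 * B $ 1 $ j + A $ i $ 2 * B $ 2 $ j"
  by (simp add: matrix_matrix_mult_def sum_2)

lemma mat_1_eq_mat2: "mat 1 = mat2 1 0 0 1"
  by (simp add: mat2_eq_iff mat_def)

section \<open>Entries and elements of the arithmetic groups\<close>

lemma Z_third_of_int: "of_int m \<in> Z_third"
proof -
  have nat: "of_nat n \<in> Z_third" for n
    by (induction n) (simp_all add: Z_third_closed)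
  show ?thesis
    using nat[of "nat m"] Z_third_closed(4)[OF nat[of "nat (- m)"]] by (cases "m \<ge> 0") auto
qed

lemma Z_third_power: "(1 / 3) ^ k \<in> Z_third"
proof (induction k)
  case (Suc k)
  show ?case unfolding power_Suc by (rule Z_third_closed(6)[OF Z_third_closed(3) Suc])
qed (simp add: Z_third_closed(2))

lemma Z_third_iff: "x \<in> Z_third \<longleftrightarrow> (\<exists>k m. 3 ^ k * x = of_int m)"
proof
  assume "\<exists>k m. 3 ^ k * x = of_int m"
  then obtain k m where km: "3 ^ k * x = of_int m" by blast
  have "x = of_int m * (1 / 3) ^ k" by (simp add: km[symmetric] field_simps)
  then show "x \<in> Z_third" using Z_third_closed(6)[OF Z_third_of_int Z_third_power] by simp
next
  assume "x \<in> Z_third"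
  then have "x \<in> generate_ring ring_of_type_algebra {1/3}" by (simp add: Z_third_def)
  then show "\<exists>k m. 3 ^ k * x = of_int m"
  proof induction
    case one
    show ?case by (rule exI[of _ 0], rule exI[of _ 1]) (simp add: ring_of_type_algebra_def)
  next
    case (incl h)
    then show ?case by (intro exI[of _ 1] exI[of _ 1]) simp
  next
    case (a_inv h)
    then obtain k m where "3 ^ k * h = of_int m" by blast
    moreover have "\<ominus>\<^bsub>ring_of_type_algebra\<^esub> h = - h"
    proof -
      interpret Q: ring "ring_of_type_algebra :: rat ring" by (rule ring_from_type_algebra)
      show ?thesis using Q.r_neg[of h] by (simp add: ring_of_type_algebra_def eq_neg_iff_add_eq_0 add.commute)
    qed
    ultimately show ?case by (intro exI[of _ k] exI[of _ "- m"]) simp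
  next
    case (eng_add h1 h2)
    then obtain k m k' m' where *: "3 ^ k * h1 = of_int m" "3 ^ k' * h2 = of_int m'" by blast
    have "3 ^ (k + k') * (h1 + h2) = 3 ^ k' * (3 ^ k * h1) + 3 ^ k * (3 ^ k' * h2)"
      by (simp add: power_add algebra_simps)
    also have "\<dots> = of_int (3 ^ k' * m + 3 ^ k * m')" by (simp add: *)
    finally have "\<exists>k m. 3 ^ k * (h1 + h2) = of_int m" by blast
    then show ?case by (simp add: ring_of_type_algebra_def)
  next
    case (eng_mult h1 h2)
    then obtain k m k' m' where *: "3 ^ k * h1 = of_int m" "3 ^ k' * h2 = of_int m'" by blast
    have "3 ^ (k + k') * (h1 * h2) = (3 ^ k * h1) * (3 ^ k' * h2)"
      by (simp add: power_add algebra_simps)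
    also have "\<dots> = of_int (m * m')" by (simp add: *)
    finally have "\<exists>k m. 3 ^ k * (h1 * h2) = of_int m" by blast
    then show ?case by (simp add: ring_of_type_algebra_def)
  qed
qed

interpretation SL: group SL2_Z_third
  by (rule group_SL2_Z_third)

lemma SL_carrier: "mat2 a b c d \<in> carrier SL2_Z_third \<longleftrightarrow>
    a \<in> Z_third \<and> b \<in> Z_third \<and> c \<in> Z_third \<and> d \<in> Z_third \<and> a * d - b * c = 1"
  by (auto simp: SL2_Z_third_def special_linear_group_def forall_2 det_2)

lemma SL_mult [simp]: "A \<otimes>\<^bsub>SL2_Z_third\<^esub> B = A ** B"
  by (simp add: SL2_Z_third_def special_linear_group_def)

lemma SL_one: "\<one>\<^bsub>SL2_Z_third\<^esub> = mat2 1 0 0 1"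
  by (simp add: SL2_Z_third_def special_linear_group_def mat_1_eq_mat2)

lemma SL_inv:
  assumes "mat2 a b c d \<in> carrier SL2_Z_third"
  shows "inv\<^bsub>SL2_Z_third\<^esub> (mat2 a b c d) = mat2 d (- b) (- c) a"
proof (rule SL.inv_equality)
  show "mat2 d (- b) (- c) a \<otimes>\<^bsub>SL2_Z_third\<^esub> mat2 a b c d = \<one>\<^bsub>SL2_Z_third\<^esub>"
    using assms by (simp add: SL_carrier SL_one mat2_mult mat2_eq_iff algebra_simps)
  show "mat2 d (- b) (- c) a \<in> carrier SL2_Z_third"
    using assms by (simp add: SL_carrier Z_third_closed(4) algebra_simps)
qed (rule assms)

text \<open>\<open>imat l a b c d\<close> is the conjugate of an integral matrix by the diagonal matrix with entries
  \<open>l\<close> and 1; the vertex stabilisers in the two trees are obtained for \<open>l = 1\<close> and \<open>l = 3\<close>.\<close>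

definition imat :: "rat \<Rightarrow> int \<Rightarrow> int \<Rightarrow> int \<Rightarrow> int \<Rightarrow> rat ^ 2 ^ 2" where
  "imat l a b c d = mat2 (of_int a) (of_int b / l) (l * of_int c) (of_int d)"

definition SL2Z :: "rat \<Rightarrow> (rat ^ 2 ^ 2) set" where
  "SL2Z l = {imat l a b c d | a b c d. a * d - b * c = 1}"

definition \<Gamma>\<^sub>0 :: "(rat ^ 2 ^ 2) set" where
  "\<Gamma>\<^sub>0 = {imat 1 a b (3 * c) d | a b c d. a * d - 3 * b * c = 1}"

text \<open>Trace 0 gives \<open>matS l\<close> the square -1; trace 1 gives \<open>matU l\<close>
  and \<open>matV\<close> the cube -1. Hence the orders 4 and 6, with the common subgroup generated
  by \<open>matN\<close>.\<close>

definition matS :: "rat \<Rightarrow> rat ^ 2 ^ 2" where "matS l = imat l 0 (- 1) 1 0"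
definition matU :: "rat \<Rightarrow> rat ^ 2 ^ 2" where "matU l = imat l 0 (- 1) 1 1"
definition matV :: "rat ^ 2 ^ 2" where "matV = mat2 (- 1) (- 1) 3 2"
definition matT :: "rat ^ 2 ^ 2" where "matT = mat2 1 1 0 1"
definition matN :: "rat ^ 2 ^ 2" where "matN = mat2 (- 1) 0 0 (- 1)"

lemma imat_mult: "l \<noteq> 0 \<Longrightarrow> imat l a b c d ** imat l a' b' c' d' =
    imat l (a * a' + b * c') (a * b' + b * d') (c * a' + d * c') (c * b' + d * d')"
  by (simp add: imat_def mat2_mult mat2_eq_iff add_divide_distrib algebra_simps)

lemma imat_eq_iff: "l \<noteq> 0 \<Longrightarrow> imat l a b c d = imat l a' b' c' d' \<longleftrightarrow> a = a' \<and> b = b' \<and> c = c' \<and> d = d'"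
  by (auto simp: imat_def mat2_eq_iff)

lemma imat_one: "imat l 1 0 0 1 = \<one>\<^bsub>SL2_Z_third\<^esub>"
  by (simp add: imat_def SL_one)

lemma matN_imat: "matN = imat l (- 1) 0 0 (- 1)"
  by (simp add: matN_def imat_def)

lemma imat_carrier:
  assumes "l = 1 \<or> l = 3" "a * d - b * c = 1"
  shows "imat l a b c d \<in> carrier SL2_Z_third"
proof -
  have "of_int m / l \<in> Z_third" for m
    using assms(1) Z_third_of_int Z_third_closed(6)[OF Z_third_of_int[of m] Z_third_closed(3)] by auto
  moreover have "l * of_int m \<in> Z_third" for m
    using assms(1) Z_third_of_int[of "m"] Z_third_of_int[of "3 * m"] by auto
  moreover have "of_int a * of_int d - of_int b / l * (l * of_int c) = (1 :: rat)"
    using assms by (auto simp flip: of_int_mult of_int_diff)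
  ultimately show ?thesis by (simp add: imat_def SL_carrier Z_third_of_int)
qed

lemma imat_inv:
  assumes "l = 1 \<or> l = 3" "a * d - b * c = 1"
  shows "inv\<^bsub>SL2_Z_third\<^esub> (imat l a b c d) = imat l d (- b) (- c) a"
  using SL_inv imat_carrier[OF assms] by (simp add: imat_def)

lemma SL2ZI: "a * d - b * c = 1 \<Longrightarrow> imat l a b c d \<in> SL2Z l"
  by (auto simp: SL2Z_def)

lemma SL2Z_subgroup:
  assumes l: "l = 1 \<or> l = 3"
  shows "subgroup (SL2Z l) SL2_Z_third"
proof (rule SL.subgroupI)
  show "SL2Z l \<subseteq> carrier SL2_Z_third" using imat_carrier[OF l] by (auto simp: SL2Z_def)
  show "SL2Z l \<noteq> {}" using SL2ZI[of 1 1 0 0 l] by auto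
  show "inv\<^bsub>SL2_Z_third\<^esub> A \<in> SL2Z l" if Al: "A \<in> SL2Z l" for A
  proof -
    obtain a b c d where A: "A = imat l a b c d" "a * d - b * c = 1" using Al by (auto simp: SL2Z_def)
    then have "inv\<^bsub>SL2_Z_third\<^esub> A = imat l d (- b) (- c) a" "d * a - (- b) * (- c) = 1"
      using imat_inv[OF l] by (auto simp: mult.commute)
    then show ?thesis unfolding SL2Z_def by blast
  qed
  show "A \<otimes>\<^bsub>SL2_Z_third\<^esub> B \<in> SL2Z l" if AB: "A \<in> SL2Z l" "B \<in> SL2Z l" for A B
  proof -
    obtain a b c d a' b' c' d' where A: "A = imat l a b c d" "a * d - b * c = 1"
      "B = imat l a' b' c' d'" "a' * d' - b' * c' = 1" using AB by (auto simp: SL2Z_def)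
    have "(a * a' + b * c') * (c * b' + d * d') - (a * b' + b * d') * (c * a' + d * c') =
      (a * d - b * c) * (a' * d' - b' * c')" by (simp add: algebra_simps)
    also have "\<dots> = 1" by (simp only: A)
    finally have det: "(a * a' + b * c') * (c * b' + d * d') - (a * b' + b * d') * (c * a' + d * c') = 1" .
    have "l \<noteq> 0" using l by auto
    then show ?thesis unfolding A SL_mult by (simp only: imat_mult not_False_eq_True SL2ZI[OF det])
  qed
qed

lemma \<Gamma>\<^sub>0_alt: "\<Gamma>\<^sub>0 = SL2Z 1 \<inter> SL2Z 3"
proof
  show "\<Gamma>\<^sub>0 \<subseteq> SL2Z 1 \<inter> SL2Z 3"
  proof
    fix A assume "A \<in> \<Gamma>\<^sub>0"
    then obtain a b c d where A: "A = imat 1 a b (3 * c) d" "a * d - 3 * b * c = 1" by (auto simp: \<Gamma>\<^sub>0_def)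
    then have "A = imat 3 a (3 * b) c d" by (simp add: imat_def)
    then show "A \<in> SL2Z 1 \<inter> SL2Z 3" using A unfolding SL2Z_def by (fastforce simp: algebra_simps)
  qed
  show "SL2Z 1 \<inter> SL2Z 3 \<subseteq> \<Gamma>\<^sub>0"
  proof
    fix A assume "A \<in> SL2Z 1 \<inter> SL2Z 3"
    then have "A \<in> SL2Z 1" "A \<in> SL2Z 3" by auto
    then obtain a b c d a' b' c' d' where A: "A = imat 1 a b c d" "a * d - b * c = 1" "A = imat 3 a' b' c' d'"
      unfolding SL2Z_def by blast
    then have "of_int c = (of_int (3 * c') :: rat)" by (simp add: imat_def mat2_eq_iff)
    then have "c = 3 * c'" by (simp only: of_int_eq_iff)
    then show "A \<in> \<Gamma>\<^sub>0" using A unfolding \<Gamma>\<^sub>0_def by (fastforce simp: algebra_simps)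
  qed
qed

lemma \<Gamma>\<^sub>0_subgroup: "subgroup \<Gamma>\<^sub>0 SL2_Z_third"
  unfolding \<Gamma>\<^sub>0_alt using SL.subgroups_Inter_pair[OF SL2Z_subgroup SL2Z_subgroup] by simp

section \<open>Generation by Euclidean reduction\<close>

lemma abs_less_of_twice_le: "2 * \<bar>x\<bar> \<le> \<bar>y\<bar> \<Longrightarrow> y \<noteq> 0 \<Longrightarrow> \<bar>x\<bar> < \<bar>y\<bar>" for x y :: int
  by linarith

lemma abs_less_of_twice_le_3:
  "2 * \<bar>x\<bar> \<le> \<bar>y\<bar> \<Longrightarrow> 2 * \<bar>y\<bar> \<le> \<bar>3 * z\<bar> \<Longrightarrow> z \<noteq> 0 \<Longrightarrow> \<bar>x\<bar> < \<bar>z\<bar>" for x y z :: int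
  by linarith

lemma nearest_multiple:
  fixes x y :: int
  assumes "y \<noteq> 0"
  obtains k where "2 * \<bar>x + k * y\<bar> \<le> \<bar>y\<bar>"
proof -
  have *: "\<exists>k. 2 * \<bar>x + k * y\<bar> \<le> \<bar>y\<bar>" if "y > 0" for y
  proof -
    have m: "0 \<le> x mod y" "x mod y < y" "x mod y = x - (x div y) * y" using that by (simp_all add: minus_div_mult_eq_mod)
    show ?thesis
    proof (cases "2 * (x mod y) \<le> y")
      case True
      then show ?thesis using m by (intro exI[of _ "- (x div y)"]) simp
    next
      case False
      then show ?thesis using m by (intro exI[of _ "- (x div y) - 1"]) (simp add: algebra_simps)
    qed
  qed
  show ?thesis
  proof (cases "y > 0")
    case True
    then show ?thesis using * that by blast
  next
    case False
    then obtain k where "2 * \<bar>x + k * (- y)\<bar> \<le> \<bar>- y\<bar>" using *[of "- y"] assms by auto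
    then show ?thesis using that[of "- k"] by simp
  qed
qed

context
  fixes H :: "(rat ^ 2 ^ 2) set"
  assumes H: "subgroup H SL2_Z_third"
begin

lemma SL_subgroup_mult: "A \<in> H \<Longrightarrow> B \<in> H \<Longrightarrow> A ** B \<in> H"
  using subgroup.m_closed[OF H] by simp

lemma SL_subgroup_upper:
  assumes l: "l = 1 \<or> l = 3" and T: "imat l 1 x 0 1 \<in> H"
  shows "imat l 1 (k * x) 0 1 \<in> H"
proof -
  have nat: "imat l 1 (int n * x) 0 1 \<in> H" for n
  proof (induction n)
    case 0
    then show ?case using subgroup.one_closed[OF H] by (simp add: imat_one)
  next
    case (Suc n)
    then show ?case using SL_subgroup_mult[OF T Suc] l by (auto simp: imat_mult algebra_simps)
  qed
  have "inv\<^bsub>SL2_Z_third\<^esub> (imat l 1 (int n * x) 0 1) = imat l 1 (- int n * x) 0 1" for n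
    by (subst imat_inv[OF l]) simp_all
  then have "imat l 1 (- int n * x) 0 1 \<in> H" for n
    using subgroup.m_inv_closed[OF H nat[of n]] by simp
  then show ?thesis using nat by (cases k rule: int_cases2) auto
qed

lemma SL_subgroup_lower:
  assumes l: "l = 1 \<or> l = 3" and T: "imat l 1 0 x 1 \<in> H"
  shows "imat l 1 0 (k * x) 1 \<in> H"
proof -
  have nat: "imat l 1 0 (int n * x) 1 \<in> H" for n
  proof (induction n)
    case 0
    then show ?case using subgroup.one_closed[OF H] by (simp add: imat_one)
  next
    case (Suc n)
    then show ?case using SL_subgroup_mult[OF T Suc] l by (auto simp: imat_mult algebra_simps)
  qed
  have "inv\<^bsub>SL2_Z_third\<^esub> (imat l 1 0 (int n * x) 1) = imat l 1 0 (- int n * x) 1" for n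
    by (subst imat_inv[OF l]) simp_all
  then have "imat l 1 0 (- int n * x) 1 \<in> H" for n
    using subgroup.m_inv_closed[OF H nat[of n]] by simp
  then show ?thesis using nat by (cases k rule: int_cases2) auto
qed

lemma SL_subgroup_cancel_left:
  assumes "A \<in> H" "A ** B \<in> H" "B \<in> carrier SL2_Z_third"
  shows "B \<in> H"
proof -
  have A: "A \<in> carrier SL2_Z_third" using assms(1) subgroup.subset[OF H] by auto
  have "inv\<^bsub>SL2_Z_third\<^esub> A \<otimes>\<^bsub>SL2_Z_third\<^esub> (A \<otimes>\<^bsub>SL2_Z_third\<^esub> B) \<in> H"
    using assms subgroup.m_inv_closed[OF H] subgroup.m_closed[OF H] by simp
  then show ?thesis using A assms(3) by (simp add: SL.m_assoc[symmetric] del: SL_mult)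
qed

lemma SL_subgroup_triangular:
  assumes l: "l = 1 \<or> l = 3" and T: "imat l 1 1 0 1 \<in> H" and N: "matN \<in> H" and ad: "a * d = 1"
  shows "imat l a b 0 d \<in> H"
proof -
  have "a = 1 \<and> d = 1 \<or> a = - 1 \<and> d = - 1" using ad by (rule zmult_eq_1_iff[THEN iffD1])
  then show ?thesis
  proof
    assume "a = 1 \<and> d = 1"
    then show ?thesis using SL_subgroup_upper[OF l T, of b] by simp
  next
    assume ad: "a = - 1 \<and> d = - 1"
    have "matN ** imat l 1 (- b) 0 1 = imat l a b 0 d"
      using l by (auto simp: matN_imat[of l] imat_mult ad)
    then show ?thesis using SL_subgroup_mult[OF N SL_subgroup_upper[OF l T, of "- b"]] by simp
  qed
qed

text \<open>Euclid's algorithm on the first column: a shear reduces the upper entry modulo the lower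
  one and \<open>matS l\<close> exchanges them. The shear itself is minus the product of
  \<open>matS l\<close> and \<open>matU l\<close>.\<close>

lemma SL2Z_generated:
  assumes l: "l = 1 \<or> l = 3" and S: "matS l \<in> H" and U: "matU l \<in> H"
  shows "SL2Z l \<subseteq> H"
proof -
  have l0: "l \<noteq> 0" using l by auto
  have N: "matN \<in> H"
    using SL_subgroup_mult[OF S S] l0 by (simp add: matS_def imat_mult matN_imat[of l])
  have T: "imat l 1 1 0 1 \<in> H"
  proof -
    have "(matN ** matS l) ** matU l = imat l 1 1 0 1"
      using l0 by (simp add: matS_def matU_def imat_mult matN_imat[of l])
    then show ?thesis using SL_subgroup_mult N S U by metis
  qed
  have "imat l a b c d \<in> H" if "a * d - b * c = 1" for a b c d
    using that
  proof (induction "nat \<bar>c\<bar>" arbitrary: a b c d rule: less_induct)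
    case less
    show ?case
    proof (cases "c = 0")
      case True
      then show ?thesis using SL_subgroup_triangular[OF l T N] less.prems by simp
    next
      case False
      obtain k where k: "2 * \<bar>a + k * c\<bar> \<le> \<bar>c\<bar>" using nearest_multiple[OF False] by blast
      have "imat l (- c) (- d) (a + k * c) (b + k * d) \<in> H"
      proof (rule less.hyps)
        have "\<bar>a + k * c\<bar> < \<bar>c\<bar>" by (rule abs_less_of_twice_le[OF k False])
        then show "nat \<bar>a + k * c\<bar> < nat \<bar>c\<bar>" by simp
        show "- c * (b + k * d) - - d * (a + k * c) = 1" using less.prems by (simp add: algebra_simps)
      qed
      moreover have "matS l ** (imat l 1 (k * 1) 0 1 ** imat l a b c d) =
          imat l (- c) (- d) (a + k * c) (b + k * d)"
        using l0 by (simp add: matS_def imat_mult)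
      moreover have ic: "imat l a b c d \<in> carrier SL2_Z_third" by (rule imat_carrier[OF l less.prems])
      moreover have kH: "imat l 1 (k * 1) 0 1 \<in> H" by (rule SL_subgroup_upper[OF l T])
      moreover have "imat l 1 (k * 1) 0 1 ** imat l a b c d \<in> carrier SL2_Z_third"
        using SL.m_closed[OF _ ic] kH subgroup.subset[OF H] by auto
      ultimately show ?thesis using SL_subgroup_cancel_left S by metis
    qed
  qed
  then show ?thesis by (auto simp: SL2Z_def)
qed

text \<open>Only multiples of 3 times the upper entry can be subtracted from the lower one.
  Remainders of least absolute value compensate for this: two halvings and the factor 3 give 3/4, so
  \<open>c\<close> still decreases.\<close>

lemma \<Gamma>\<^sub>0_generated:
  assumes V: "matV \<in> H" and T: "matT \<in> H" and N: "matN \<in> H"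
  shows "\<Gamma>\<^sub>0 \<subseteq> H"
proof -
  note l = disjI1[OF refl, of "1 :: rat" "1 = 3"]
  have T': "imat 1 1 1 0 1 \<in> H" using T by (simp add: matT_def imat_def)
  have "inv\<^bsub>SL2_Z_third\<^esub> matV = imat 1 2 1 (- 3) (- 1)"
    using imat_inv[OF l, of "- 1" 2 "- 1" 3] by (simp add: matV_def imat_def)
  then have "imat 1 2 1 (- 3) (- 1) \<in> H" using subgroup.m_inv_closed[OF H V] by simp
  \<comment> \<open>This product is the lower shear with entry 3, the second shear used in the
    reduction.\<close>
  then have "matT ** (imat 1 2 1 (- 3) (- 1) ** matN) \<in> H"
    by (intro SL_subgroup_mult T N)
  then have L: "imat 1 1 0 3 1 \<in> H" by (simp add: matT_def matN_def imat_def mat2_mult)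
  have "imat 1 a b (3 * c) d \<in> H" if "a * d - 3 * b * c = 1" for a b c d
    using that
  proof (induction "nat \<bar>c\<bar>" arbitrary: a b c d rule: less_induct)
    case less
    show ?case
    proof (cases "c = 0")
      case True
      then show ?thesis using SL_subgroup_triangular[OF l T' N] less.prems by simp
    next
      case False
      then have "3 * c \<noteq> 0" by simp
      then obtain k where k: "2 * \<bar>a + k * (3 * c)\<bar> \<le> \<bar>3 * c\<bar>" using nearest_multiple by blast
      define a' where "a' = a + k * (3 * c)"
      define b' where "b' = b + k * d"
      have det: "a' * d - 3 * b' * c = 1" using less.prems by (simp add: a'_def b'_def algebra_simps)
      have "a' \<noteq> 0"
      proof
        assume "a' = 0"
        then have "3 * (- (b' * c)) = 1" using det by simp
        then show False by presburger
      qed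
      then obtain m where m: "2 * \<bar>c + m * a'\<bar> \<le> \<bar>a'\<bar>" using nearest_multiple by blast
      have "imat 1 a' b' (3 * (c + m * a')) (d + 3 * m * b') \<in> H"
      proof (rule less.hyps)
        have "\<bar>c + m * a'\<bar> < \<bar>c\<bar>"
          by (rule abs_less_of_twice_le_3[OF m k[folded a'_def] False])
        then show "nat \<bar>c + m * a'\<bar> < nat \<bar>c\<bar>" by simp
        show "a' * (d + 3 * m * b') - 3 * b' * (c + m * a') = 1" using det by (simp add: algebra_simps)
      qed
      moreover have "imat 1 1 0 (m * 3) 1 ** (imat 1 1 (k * 1) 0 1 ** imat 1 a b (3 * c) d) =
          imat 1 a' b' (3 * (c + m * a')) (d + 3 * m * b')"
        by (simp add: imat_mult imat_eq_iff a'_def b'_def algebra_simps)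
      moreover have ic: "imat 1 a b (3 * c) d \<in> carrier SL2_Z_third"
        by (rule imat_carrier[OF l]) (use less.prems in \<open>simp add: algebra_simps\<close>)
      moreover have kH: "imat 1 1 (k * 1) 0 1 \<in> H" by (rule SL_subgroup_upper[OF l T'])
      moreover have "imat 1 1 (k * 1) 0 1 ** imat 1 a b (3 * c) d \<in> carrier SL2_Z_third"
        using SL.m_closed[OF _ ic] kH subgroup.subset[OF H] by auto
      moreover have "imat 1 1 0 (m * 3) 1 \<in> H" by (rule SL_subgroup_lower[OF l L])
      ultimately show ?thesis using SL_subgroup_cancel_left by metis
    qed
  qed
  then show ?thesis by (auto simp: \<Gamma>\<^sub>0_def)
qed

text \<open>An integral matrix built from Bezout coefficients makes \<open>g\<close> upper
  triangular. The diagonal entries are inverse to each other in Z[1/3], hence powers of 3 up to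
  sign, and a triangular matrix is a product of a diagonal one and a shear.\<close>

lemma SL2_Z_third_generated:
  assumes A: "SL2Z 1 \<subseteq> H" and B: "SL2Z 3 \<subseteq> H"
  shows "carrier SL2_Z_third \<subseteq> H"
proof -
  have AI: "imat 1 a b c d \<in> H" if "a * d - b * c = 1" for a b c d
    by (rule subsetD[OF A SL2ZI[OF that]])
  have BI: "imat 3 a b c d \<in> H" if "a * d - b * c = 1" for a b c d
    by (rule subsetD[OF B SL2ZI[OF that]])
  \<comment> \<open>Minus the product of \<open>matS 1\<close> and \<open>matS 3\<close> is diagonal
    with entries 3 and 1/3; no single vertex group contains it.\<close>
  have "matN ** (imat 1 0 (- 1) 1 0 ** imat 3 0 (- 1) 1 0) \<in> H"
    by (intro SL_subgroup_mult) (simp_all add: matN_imat[of 1] AI BI)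
  then have D1: "mat2 3 0 0 (1 / 3) \<in> H" by (simp add: matN_def imat_def mat2_mult)
  have D: "mat2 (3 ^ n) 0 0 (1 / 3 ^ n) \<in> H" for n
  proof (induction n)
    case 0
    then show ?case using subgroup.one_closed[OF H] by (simp add: SL_one)
  next
    case (Suc n)
    then show ?case using SL_subgroup_mult[OF D1 Suc] by (simp add: mat2_mult)
  qed
  have D': "mat2 (1 / 3 ^ n) 0 0 (3 ^ n) \<in> H" for n
  proof -
    have "inv\<^bsub>SL2_Z_third\<^esub> (mat2 (3 ^ n) 0 0 (1 / 3 ^ n)) = mat2 (1 / 3 ^ n) 0 0 (3 ^ n)"
      using SL_inv[of "3 ^ n" 0 0 "1 / 3 ^ n"] D[of n] subgroup.subset[OF H] by auto
    then show ?thesis using subgroup.m_inv_closed[OF H D[of n]] by simp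
  qed
  have E: "mat2 1 x 0 1 \<in> H" if x: "x \<in> Z_third" for x
  proof -
    obtain k m where km: "3 ^ k * x = of_int m" using x unfolding Z_third_iff by (elim exE)
    \<comment> \<open>Conjugation by the diagonal matrix divides the entry of a shear by the square
      of \<open>3 ^ k\<close>, which leaves \<open>x\<close>.\<close>
    have "imat 1 1 (3 ^ k * m) 0 1 \<in> H" by (rule AI) simp
    then have "mat2 (1 / 3 ^ k) 0 0 (3 ^ k) ** (imat 1 1 (3 ^ k * m) 0 1 ** mat2 (3 ^ k) 0 0 (1 / 3 ^ k)) \<in> H"
      by (intro SL_subgroup_mult D D')
    then show ?thesis by (simp add: imat_def mat2_mult km[symmetric])
  qed
  show ?thesis
  proof
    fix g assume g: "g \<in> carrier SL2_Z_third"
    obtain a b c d where gm: "g = mat2 a b c d" by (rule mat2_cases)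
    have gz: "a \<in> Z_third" "b \<in> Z_third" "c \<in> Z_third" "d \<in> Z_third" "a * d - b * c = 1"
      using g by (simp_all add: gm SL_carrier)
    obtain k p where kp: "3 ^ k * a = of_int p" using gz(1) unfolding Z_third_iff by (elim exE)
    obtain k' q where kq: "3 ^ k' * c = of_int q" using gz(3) unfolding Z_third_iff by (elim exE)
    define P where "P = 3 ^ k' * p"
    define Q where "Q = 3 ^ k * q"
    define n where "n = k + k'"
    have P: "3 ^ n * a = of_int P" and Q: "3 ^ n * c = of_int Q"
      by (simp_all add: P_def Q_def n_def power_add kp[symmetric] kq[symmetric])
    define e where "e = gcd P Q"
    have "e \<noteq> 0"
    proof
      assume "e = 0"
      then have "P = 0" "Q = 0" by (simp_all add: e_def)
      then show False using P Q gz(5) by simp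
    qed
    obtain u v where uv: "u * P + v * Q = e" using bezout_int e_def by metis
    obtain P' Q' where PQ: "P = e * P'" "Q = e * Q'"
      using gcd_dvd1[of P Q] gcd_dvd2[of P Q] unfolding e_def[symmetric] by (auto elim!: dvdE)
    have "e * (u * P' + v * Q') = e * 1" using uv by (simp add: PQ algebra_simps)
    then have uv': "u * P' + v * Q' = 1" using \<open>e \<noteq> 0\<close> by simp
    define W where "W = imat 1 u v (- Q') P'"
    have W: "W \<in> H" unfolding W_def by (rule AI) (use uv' in \<open>simp add: algebra_simps\<close>)
    have Wg: "W ** g \<in> carrier SL2_Z_third"
      using SL.m_closed[of W g] W g subgroup.subset[OF H] by auto
    define r where "r = of_int u * b + of_int v * d"
    define s where "s = - of_int Q' * b + of_int P' * d"
    have a: "a = of_int P / 3 ^ n" and c: "c = of_int Q / 3 ^ n" by (simp_all add: P[symmetric] Q[symmetric])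
    have "W ** g = mat2 (of_int u * a + of_int v * c) r (- of_int Q' * a + of_int P' * c) s"
      by (simp add: W_def gm imat_def mat2_mult r_def s_def)
    moreover have "of_int u * a + of_int v * c = of_int e / 3 ^ n"
      by (simp add: a c uv[symmetric] add_divide_distrib)
    moreover have "- of_int Q' * a + of_int P' * c = 0"
      by (simp add: a c PQ)
    ultimately have Wg_eq: "W ** g = mat2 (of_int e / 3 ^ n) r 0 s" by simp
    have "mat2 (of_int e / 3 ^ n) r 0 s \<in> carrier SL2_Z_third" using Wg by (simp only: Wg_eq)
    then have "r \<in> Z_third \<and> s \<in> Z_third \<and> of_int e / 3 ^ n * s - r * 0 = 1"
      unfolding SL_carrier by (elim conjE) (intro conjI)
    then have rs: "r \<in> Z_third" "s \<in> Z_third" "of_int e / 3 ^ n * s = 1"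
      by (simp_all only: mult_zero_right diff_zero)
    \<comment> \<open>As \<open>s\<close> is inverse to \<open>e / 3 ^ n\<close> and has a power of
      3 as denominator, \<open>e\<close> divides a power of 3; being a gcd it carries no
      sign.\<close>
    obtain k2 m where km: "3 ^ k2 * s = of_int m" using rs(2) unfolding Z_third_iff by (elim exE)
    have "of_int (e * m) = of_int e * (3 ^ k2 * s)" by (simp add: km)
    also have "\<dots> = 3 ^ k2 * 3 ^ n * (of_int e / 3 ^ n * s)" by simp
    also have "\<dots> = of_int (3 ^ (k2 + n))" unfolding rs(3) by (simp add: power_add)
    finally have em: "e * m = 3 ^ (k2 + n)" by (simp only: of_int_eq_iff)
    have "prime (3 :: int)" by simp
    moreover have "e dvd 3 ^ (k2 + n)" using em by (metis dvd_triv_left)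
    ultimately obtain i where i: "normalize e = normalize (3 ^ i)"
      using divides_primepow[of 3 e "k2 + n"] by auto
    have "e = 3 ^ i" using i by (simp add: e_def)
    then have s: "s = 3 ^ n / 3 ^ i" using rs(3) by (simp add: field_simps)
    have "mat2 (3 ^ i) 0 0 (1 / 3 ^ i) ** (mat2 (1 / 3 ^ n) 0 0 (3 ^ n) ** mat2 1 (r * s) 0 1) \<in> H"
      by (intro SL_subgroup_mult D D' E Z_third_closed(6) rs)
    also have "mat2 (3 ^ i) 0 0 (1 / 3 ^ i) ** (mat2 (1 / 3 ^ n) 0 0 (3 ^ n) ** mat2 1 (r * s) 0 1) = W ** g"
      by (simp add: Wg_eq mat2_mult mat2_eq_iff \<open>e = 3 ^ i\<close> s)
    finally show "g \<in> H" using SL_subgroup_cancel_left[OF W _ g] by simp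
  qed
qed

end

section \<open>The three trees\<close>

text \<open>For \<open>A = imat l a b c d\<close> these are the entries of the Gram matrix of \<open>(a, b)\<close> and \<open>(c, d)\<close>.\<close>

definition gramP :: "rat \<Rightarrow> rat ^ 2 ^ 2 \<Rightarrow> int" where
  "gramP l A = \<lfloor>(A $ 1 $ 1)\<^sup>2 + (l * A $ 1 $ 2)\<^sup>2\<rfloor>"
definition gramX :: "rat \<Rightarrow> rat ^ 2 ^ 2 \<Rightarrow> int" where
  "gramX l A = \<lfloor>A $ 1 $ 1 * (A $ 2 $ 1 / l) + l * A $ 1 $ 2 * A $ 2 $ 2\<rfloor>"
definition gramQ :: "rat \<Rightarrow> rat ^ 2 ^ 2 \<Rightarrow> int" where
  "gramQ l A = \<lfloor>(A $ 2 $ 1 / l)\<^sup>2 + (A $ 2 $ 2)\<^sup>2\<rfloor>"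

section \<open>Gram matrices under left multiplication\<close>

lemma gram_imat:
  assumes "l \<noteq> 0"
  shows "gramP l (imat l a b c d) = a\<^sup>2 + b\<^sup>2"
    "gramX l (imat l a b c d) = a * c + b * d"
    "gramQ l (imat l a b c d) = c\<^sup>2 + d\<^sup>2"
  using assms by (simp_all add: gramP_def gramX_def gramQ_def imat_def
      flip: of_int_mult of_int_add of_int_power)

lemma SL2Z_cases:
  assumes "A \<in> SL2Z l"
  obtains a b c d where "A = imat l a b c d" "a * d - b * c = 1"
  using assms by (auto simp: SL2Z_def)

lemma gram_mult:
  assumes "l \<noteq> 0" "A \<in> SL2Z l"
  shows "gramP l (imat l p q r s ** A) = p\<^sup>2 * gramP l A + 2 * p * q * gramX l A + q\<^sup>2 * gramQ l A"
    "gramX l (imat l p q r s ** A) = p * r * gramP l A + (p * s + q * r) * gramX l A + q * s * gramQ l A"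
    "gramQ l (imat l p q r s ** A) = r\<^sup>2 * gramP l A + 2 * r * s * gramX l A + s\<^sup>2 * gramQ l A"
  using assms(2) by (auto elim!: SL2Z_cases simp: imat_mult gram_imat assms(1) power2_eq_square algebra_simps)

lemma gram_det:
  assumes "l \<noteq> 0" "A \<in> SL2Z l"
  shows "gramP l A * gramQ l A - (gramX l A)\<^sup>2 = 1"
proof -
  obtain a b c d where A: "A = imat l a b c d" "a * d - b * c = 1" using assms(2) by (rule SL2Z_cases)
  have "gramP l A * gramQ l A - (gramX l A)\<^sup>2 = (a * d - b * c)\<^sup>2"
    by (simp add: A(1) gram_imat assms(1) power2_eq_square algebra_simps)
  then show ?thesis by (simp add: A(2))
qed

lemma gram_pos:
  assumes "l \<noteq> 0" "A \<in> SL2Z l"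
  shows "gramP l A > 0" "gramQ l A > 0"
proof -
  obtain a b c d where A: "A = imat l a b c d" "a * d - b * c = 1" using assms(2) by (rule SL2Z_cases)
  have "a \<noteq> 0 \<or> b \<noteq> 0" "c \<noteq> 0 \<or> d \<noteq> 0" using A(2) by auto
  then show "gramP l A > 0" "gramQ l A > 0"
    by (simp_all add: A(1) gram_imat assms(1) sum_power2_gt_zero_iff)
qed

lemma matS_SL2Z: "matS l \<in> SL2Z l" and matU_SL2Z: "matU l \<in> SL2Z l" and matN_SL2Z: "matN \<in> SL2Z l"
  by (simp_all add: matS_def matU_def matN_imat[of l] SL2ZI)

lemma SL2Z_carrier: "l = 1 \<or> l = 3 \<Longrightarrow> A \<in> SL2Z l \<Longrightarrow> A \<in> carrier SL2_Z_third"
  using subgroup.subset[OF SL2Z_subgroup] by blast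

lemma SL_generate_mult:
  "A \<in> generate SL2_Z_third K \<Longrightarrow> B \<in> generate SL2_Z_third K \<Longrightarrow> A ** B \<in> generate SL2_Z_third K"
  using generate.eng[of A SL2_Z_third K B] by simp

text \<open>This is Conway's topograph: \<open>K'\<close>-orbits are lattice bases up to sign,
  \<open>L'\<close>-orbits superbases v1 + v2 + v3 = 0, and the three numbers in \<open>hL\<close>
  are the inner products of pairs, the Selling parameters. A basis can descend only to the superbase
  in which its inner product is negative. A superbase can descend only along a nonnegative
  parameter; there is at most one because two parameters add up to minus a squared length.\<close>

lemma glued_SL2Z:
  assumes l: "l = 1 \<or> l = 3"
  shows "glued SL2_Z_third {matS l} {matU l} {matN}"
proof -
  have l0: "l \<noteq> 0" using l by auto
  define I where "I = imat l 1 0 0 1"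
  define J where "J = imat l (- 1) 0 0 (- 1)"
  define K' where "K' = {I, J, imat l 0 (- 1) 1 0, imat l 0 1 (- 1) 0}"
  define L' where "L' = {I, J, imat l 0 (- 1) 1 1, imat l 0 1 (- 1) (- 1),
     imat l (- 1) (- 1) 1 0, imat l 1 1 (- 1) 0}"
  note IJ = I_def J_def
  note g = gram_mult[OF l0]
  define hK where "hK A = nat (2 * \<bar>gramX l A\<bar>)" for A
  define hL where "hL A = nat (2 * max (gramX l A)
     (max (- gramX l A - gramP l A) (- gramX l A - gramQ l A)) + 1)" for A
  show ?thesis
  proof (rule SL.glued_by_heights[where \<Gamma> = "SL2Z l" and K' = K' and L' = L' and M' = "{I, J}"
        and a = hK and b = hL])
    show "subgroup (SL2Z l) SL2_Z_third" by (rule SL2Z_subgroup[OF l])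
    show "subgroup K' SL2_Z_third"
      by (rule SL.subgroupI) (use l0 in \<open>auto simp: K'_def IJ imat_carrier[OF l] imat_inv[OF l] imat_mult\<close>)
    show "subgroup L' SL2_Z_third"
      by (rule SL.subgroupI) (use l0 in \<open>auto simp: L'_def IJ imat_carrier[OF l] imat_inv[OF l] imat_mult\<close>)
    show "K' \<subseteq> SL2Z l" "L' \<subseteq> SL2Z l" "{I, J} \<subseteq> K'" "{I, J} \<subseteq> L'"
      by (auto simp: K'_def L'_def IJ SL2ZI)
    show "hK (k \<otimes>\<^bsub>SL2_Z_third\<^esub> A) = hK A" if "k \<in> K'" "A \<in> SL2Z l" for k A
      using that by (auto simp: K'_def IJ hK_def g)
    show "hL (k \<otimes>\<^bsub>SL2_Z_third\<^esub> A) = hL A" if "k \<in> L'" "A \<in> SL2Z l" for k A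
      using that by (auto simp: L'_def IJ hL_def g max_def)
    show "hK A \<noteq> hL A" if "A \<in> SL2Z l" for A
      using gram_pos[OF l0 that] by (auto simp: hK_def hL_def max_def nat_eq_iff nat_eq_iff2)
    show "k \<in> {I, J}" if A: "A \<in> SL2Z l" and k: "k \<in> K'" and lt: "hL A < hK A"
      "hL (k \<otimes>\<^bsub>SL2_Z_third\<^esub> A) < hK (k \<otimes>\<^bsub>SL2_Z_third\<^esub> A)" for k A
    proof (rule ccontr)
      assume "k \<notin> {I, J}"
      then have "k = imat l 0 (- 1) 1 0 \<or> k = imat l 0 1 (- 1) 0" using k by (auto simp: K'_def)
      then have "gramX l (k ** A) = - gramX l A" using A by (auto simp: g)
      moreover have neg: "gramX l B < 0" if "hL B < hK B" for B
        using that by (auto simp: hK_def hL_def max_def split: if_splits)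
      ultimately show False using neg[OF lt(1)] neg[OF lt(2)] by simp
    qed
    show "k \<in> {I, J}" if A: "A \<in> SL2Z l" and k: "k \<in> L'" and lt: "hK A < hL A"
      "hK (k \<otimes>\<^bsub>SL2_Z_third\<^esub> A) < hL (k \<otimes>\<^bsub>SL2_Z_third\<^esub> A)" for k A
    proof (rule ccontr)
      assume nk: "k \<notin> {I, J}"
      have nonneg: "gramX l B \<ge> 0" if "hK B < hL B" "B \<in> SL2Z l" for B
        using that gram_pos[OF l0 that(2)] by (auto simp: hK_def hL_def max_def split: if_splits)
      have kA: "k ** A \<in> SL2Z l"
        using subgroup.m_closed[OF SL2Z_subgroup[OF l] _ A, of k] k by (auto simp: L'_def IJ SL2ZI)
      have "gramX l (k ** A) = - gramX l A - gramP l A \<or> gramX l (k ** A) = - gramX l A - gramQ l A"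
        using nk k A by (auto simp: L'_def g)
      then show False using nonneg[OF lt(1) A] nonneg[OF _ kA] lt(2) gram_pos[OF l0 A] by auto
    qed
    show "{matS l} \<subseteq> K'" "{matU l} \<subseteq> L'" by (auto simp: K'_def L'_def matS_def matU_def)
    show "{matN} \<subseteq> carrier SL2_Z_third" using SL2Z_carrier[OF l matN_SL2Z] by simp
    show "{I, J} \<subseteq> generate SL2_Z_third {matN}"
      using generate.one[of SL2_Z_third "{matN}"] generate.incl[of matN "{matN}" SL2_Z_third]
      by (simp add: I_def J_def imat_one matN_imat[of l])
    have "matN = matS l ** matS l" using l0 by (simp add: matN_imat[of l] matS_def imat_mult)
    moreover have "matS l ** matS l \<in> generate SL2_Z_third {matS l}"
      by (intro SL_generate_mult generate.incl) simp_all
    ultimately show "{matN} \<subseteq> generate SL2_Z_third {matS l}" by simp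
    have "matN = matU l ** (matU l ** matU l)" using l0 by (simp add: matN_imat[of l] matU_def imat_mult)
    moreover have "matU l ** (matU l ** matU l) \<in> generate SL2_Z_third {matU l}"
      by (intro SL_generate_mult generate.incl) simp_all
    ultimately show "{matN} \<subseteq> generate SL2_Z_third {matU l}" by simp
  qed
qed

lemma matV_imat: "matV = imat 1 (- 1) (- 1) 3 2" "matV = imat 3 (- 1) (- 3) 1 2"
  by (simp_all add: matV_def imat_def)

lemma matT_imat: "matT = imat 1 1 1 0 1" "matT = imat 3 1 3 0 1"
  by (simp_all add: matT_def imat_def)

lemma VTN_\<Gamma>\<^sub>0: "matV \<in> \<Gamma>\<^sub>0" "matT \<in> \<Gamma>\<^sub>0" "matN \<in> \<Gamma>\<^sub>0"
  unfolding \<Gamma>\<^sub>0_alt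
  using SL2ZI[of "- 1" 2 "- 1" 3 1] SL2ZI[of "- 1" 2 "- 3" 1 3] SL2ZI[of 1 1 1 0 1] SL2ZI[of 1 1 3 0 3]
    matN_SL2Z by (auto simp: matV_imat[symmetric] matT_imat[symmetric])

text \<open>Squares that differ by 9 force Q to be at most 5. For a lower row in level 3 this leaves
  only Q = 1, which is too small. The lemma excludes ties between heights.\<close>

lemma \<Gamma>\<^sub>0_row_unique:
  assumes A: "A \<in> \<Gamma>\<^sub>0" and D: "(gramQ 1 A)\<^sup>2 = D\<^sup>2 + 9"
  shows False
proof -
  obtain a b c d where abcd: "A = imat 1 a b (3 * c) d" "a * d - 3 * b * c = 1"
    using A by (auto simp: \<Gamma>\<^sub>0_def)
  define Q where "Q = gramQ 1 A"
  have Q: "Q = 9 * c\<^sup>2 + d\<^sup>2" by (simp add: Q_def abcd(1) gram_imat power_mult_distrib)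
  then have "Q \<ge> 0" by simp
  have QD: "Q\<^sup>2 = D\<^sup>2 + 9" using D by (simp add: Q_def)
  have "D\<^sup>2 < Q\<^sup>2" using QD by simp
  then have "\<bar>D\<bar> < Q" using \<open>Q \<ge> 0\<close> by (metis abs_of_nonneg power2_less_imp_less power2_abs)
  then have "\<bar>D\<bar> \<le> Q - 1" by simp
  then have "D\<^sup>2 \<le> (Q - 1)\<^sup>2" by (metis abs_le_square_iff abs_of_nonneg abs_ge_zero order_trans)
  then have "Q \<le> 5" using QD by (simp add: power2_eq_square algebra_simps)
  have "c = 0"
  proof (rule ccontr)
    assume "c \<noteq> 0"
    then have "c\<^sup>2 \<ge> 1" by (simp add: int_one_le_iff_zero_less)
    then show False using Q \<open>Q \<le> 5\<close> zero_le_power2[of d] by linarith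
  qed
  then have "a * d = 1" using abcd(2) by simp
  then have "d\<^sup>2 = 1" by (auto simp: zmult_eq_1_iff)
  then have "Q = 1" using Q \<open>c = 0\<close> by simp
  then show False using QD zero_le_power2[of D] by simp
qed

text \<open>The group \<open>L'\<close> stabilises a cusp, whose height is the squared length Q of
  the lower row. The three edges at a \<open>K'\<close>-vertex have the values Q, \<open>q1\<close>
  and \<open>q2\<close>, and the vertex descends to the cusp with the least of them.\<close>

lemma glued_\<Gamma>\<^sub>0: "glued SL2_Z_third {matV} {matT, matN} {matN}"
proof -
  have l: "(1::rat) = 1 \<or> (1::rat) = 3" by simp
  have l0: "(1::rat) \<noteq> 0" by simp
  define I where "I = imat 1 1 0 0 1"
  define J where "J = imat 1 (- 1) 0 0 (- 1)"
  define K' where "K' = {I, J, imat 1 (- 1) (- 1) 3 2, imat 1 1 1 (- 3) (- 2),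
     imat 1 (- 2) (- 1) 3 1, imat 1 2 1 (- 3) (- 1)}"
  define L' where "L' = {imat 1 e (e * j) 0 e | e j. e = 1 \<or> e = - 1}"
  note IJ = I_def J_def
  note g = gram_mult[OF l0]
  define q1 where "q1 A = 9 * gramP 1 A + 12 * gramX 1 A + 4 * gramQ 1 A" for A
  define q2 where "q2 A = 9 * gramP 1 A + 6 * gramX 1 A + gramQ 1 A" for A
  define hK where "hK A = nat (2 * min (gramQ 1 A) (min (q1 A) (q2 A)) + 1)" for A
  define hL where "hL A = nat (2 * gramQ 1 A)" for A
  have \<Gamma>1: "A \<in> SL2Z 1" if "A \<in> \<Gamma>\<^sub>0" for A using that by (simp add: \<Gamma>\<^sub>0_alt)
  have \<Gamma>I: "imat 1 a b (3 * c) d \<in> \<Gamma>\<^sub>0" if "a * d - 3 * b * c = 1" for a b c d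
    using that by (auto simp: \<Gamma>\<^sub>0_def)
  have det: "gramP 1 A * gramQ 1 A - (gramX 1 A)\<^sup>2 = 1" if "A \<in> \<Gamma>\<^sub>0" for A
    by (rule gram_det[OF l0 \<Gamma>1[OF that]])
  have pos: "gramQ 1 A > 0" if "A \<in> \<Gamma>\<^sub>0" for A
    by (rule gram_pos(2)[OF l0 \<Gamma>1[OF that]])
  have qpos: "q1 A > 0 \<and> q2 A > 0" if "A \<in> \<Gamma>\<^sub>0" for A
  proof -
    \<comment> \<open>The determinant relation replaces 9 P Q by 9 X^2 + 9, which completes a
      square.\<close>
    have "q1 A * gramQ 1 A = (3 * gramX 1 A + 2 * gramQ 1 A)\<^sup>2 + 9"
      using det[OF that] by (simp add: q1_def power2_eq_square algebra_simps)
    then have "q1 A * gramQ 1 A > 0" by (simp add: add_nonneg_pos)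
    moreover have "q2 A * gramQ 1 A = (3 * gramX 1 A + gramQ 1 A)\<^sup>2 + 9"
      using det[OF that] by (simp add: q2_def power2_eq_square algebra_simps)
    then have "q2 A * gramQ 1 A > 0" by (simp add: add_nonneg_pos)
    ultimately show ?thesis using pos[OF that] by (simp add: zero_less_mult_iff)
  qed
  show ?thesis
  proof (rule SL.glued_by_heights[where \<Gamma> = \<Gamma>\<^sub>0 and K' = K' and L' = L' and M' = "{I, J}"
        and a = hK and b = hL])
    show "subgroup \<Gamma>\<^sub>0 SL2_Z_third" by (rule \<Gamma>\<^sub>0_subgroup)
    show "subgroup K' SL2_Z_third"
      by (rule SL.subgroupI) (auto simp: K'_def IJ imat_carrier[OF l] imat_inv[OF l] imat_mult)
    show "subgroup L' SL2_Z_third"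
    proof (rule SL.subgroupI)
      show "L' \<subseteq> carrier SL2_Z_third" by (auto simp: L'_def intro!: imat_carrier[OF l])
      show "L' \<noteq> {}" by (auto simp: L'_def)
      show "inv\<^bsub>SL2_Z_third\<^esub> A \<in> L'" if AL: "A \<in> L'" for A
      proof -
        obtain e j where A: "A = imat 1 e (e * j) 0 e" "e = 1 \<or> e = - 1" using AL by (auto simp: L'_def)
        have "inv\<^bsub>SL2_Z_third\<^esub> A = imat 1 e (e * (- j)) 0 e"
          unfolding A(1) by (subst imat_inv[OF l]) (use A(2) in auto)
        then show ?thesis using A(2) unfolding L'_def by blast
      qed
      show "A \<otimes>\<^bsub>SL2_Z_third\<^esub> B \<in> L'" if AB: "A \<in> L'" "B \<in> L'" for A B
      proof -
        obtain e j e' j' where A: "A = imat 1 e (e * j) 0 e" "e = 1 \<or> e = - 1"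
          "B = imat 1 e' (e' * j') 0 e'" "e' = 1 \<or> e' = - 1" using AB by (auto simp: L'_def)
        have "A ** B = imat 1 (e * e') ((e * e') * (j + j')) 0 (e * e')"
          by (simp add: A(1,3) imat_mult algebra_simps)
        moreover have "e * e' = 1 \<or> e * e' = - 1" using A by auto
        ultimately show ?thesis unfolding L'_def SL_mult by blast
      qed
    qed
    show "K' \<subseteq> \<Gamma>\<^sub>0"
      using \<Gamma>I[of 1 1 0 0] \<Gamma>I[of "- 1" "- 1" 0 0] \<Gamma>I[of "- 1" 2 "- 1" 1] \<Gamma>I[of 1 "- 2" 1 "- 1"]
        \<Gamma>I[of "- 2" 1 "- 1" 1] \<Gamma>I[of 2 "- 1" 1 "- 1"]
      by (simp add: K'_def IJ)
    show L'\<Gamma>: "L' \<subseteq> \<Gamma>\<^sub>0" using \<Gamma>I[of _ _ _ 0] by (auto simp: L'_def)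
    show "{I, J} \<subseteq> K'" by (auto simp: K'_def)
    have "I = imat 1 1 (1 * 0) 0 1" "J = imat 1 (- 1) ((- 1) * 0) 0 (- 1)" by (simp_all add: IJ)
    then show "{I, J} \<subseteq> L'" unfolding L'_def by blast
    show "hK (k \<otimes>\<^bsub>SL2_Z_third\<^esub> A) = hK A" if "k \<in> K'" "A \<in> \<Gamma>\<^sub>0" for k A
      using that(1) \<Gamma>1[OF that(2)] by (auto simp: K'_def IJ hK_def q1_def q2_def g min_def)
    show "hL (k \<otimes>\<^bsub>SL2_Z_third\<^esub> A) = hL A" if "k \<in> L'" "A \<in> \<Gamma>\<^sub>0" for k A
      using that(1) \<Gamma>1[OF that(2)] by (auto simp: L'_def hL_def g)
    show "hK A \<noteq> hL A" if "A \<in> \<Gamma>\<^sub>0" for A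
    proof -
      have "nat (2 * x + 1) \<noteq> nat (2 * y)" if "x > 0" "y > 0" for x y :: int
        using that by (simp add: eq_nat_nat_iff) presburger
      then show ?thesis using pos[OF that] qpos[OF that] unfolding hK_def hL_def by simp
    qed
    show "k \<in> {I, J}" if A: "A \<in> \<Gamma>\<^sub>0" and k: "k \<in> K'" and lt: "hL A < hK A"
      "hL (k \<otimes>\<^bsub>SL2_Z_third\<^esub> A) < hK (k \<otimes>\<^bsub>SL2_Z_third\<^esub> A)" for k A
    proof (rule ccontr)
      assume nk: "k \<notin> {I, J}"
      have kA: "k ** A \<in> \<Gamma>\<^sub>0"
        using subgroup.m_closed[OF \<Gamma>\<^sub>0_subgroup _ A, of k] k \<open>K' \<subseteq> \<Gamma>\<^sub>0\<close> by auto
      have hh: "gramQ 1 B \<le> q1 B" "gramQ 1 B \<le> q2 B" if "hL B < hK B" "B \<in> \<Gamma>\<^sub>0" for B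
        using that pos[OF that(2)] by (auto simp: hK_def hL_def)
      \<comment> \<open>Modulo -1 the group \<open>K'\<close> has order 3, so \<open>k\<close> leads
        to the edge with value \<open>q1\<close> or \<open>q2\<close>. If both edges were minimal,
        these values would tie.\<close>
      have "gramQ 1 (k ** A) = q1 A \<and> gramQ 1 A \<in> {q1 (k ** A), q2 (k ** A)}
          \<or> gramQ 1 (k ** A) = q2 A \<and> gramQ 1 A \<in> {q1 (k ** A), q2 (k ** A)}"
        using nk k \<Gamma>1[OF A] by (auto simp: K'_def g q1_def q2_def)
      then have "gramQ 1 A = q1 A \<or> gramQ 1 A = q2 A"
        using hh[OF lt(1) A] hh[OF _ kA] lt(2) by auto
      then have "(gramQ 1 A)\<^sup>2 = (3 * gramX 1 A + 2 * gramQ 1 A)\<^sup>2 + 9 \<or>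
          (gramQ 1 A)\<^sup>2 = (3 * gramX 1 A + gramQ 1 A)\<^sup>2 + 9"
      proof
        assume "gramQ 1 A = q1 A"
        then have "(gramQ 1 A)\<^sup>2 = q1 A * gramQ 1 A" by (simp add: power2_eq_square)
        then show ?thesis using det[OF A] by (simp add: q1_def power2_eq_square algebra_simps)
      next
        assume "gramQ 1 A = q2 A"
        then have "(gramQ 1 A)\<^sup>2 = q2 A * gramQ 1 A" by (simp add: power2_eq_square)
        then show ?thesis using det[OF A] by (simp add: q2_def power2_eq_square algebra_simps)
      qed
      then show False using \<Gamma>\<^sub>0_row_unique[OF A] by blast
    qed
    show "k \<in> {I, J}" if A: "A \<in> \<Gamma>\<^sub>0" and k: "k \<in> L'" and lt: "hK A < hL A"
      "hK (k \<otimes>\<^bsub>SL2_Z_third\<^esub> A) < hL (k \<otimes>\<^bsub>SL2_Z_third\<^esub> A)" for k A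
    proof -
      obtain e j where ej: "k = imat 1 e (e * j) 0 e" "e = 1 \<or> e = - 1" using k by (auto simp: L'_def)
      have kA: "k ** A \<in> \<Gamma>\<^sub>0"
        using subgroup.m_closed[OF \<Gamma>\<^sub>0_subgroup _ A, of k] k L'\<Gamma> by auto
      \<comment> \<open>A descending edge at a cusp has 3 X + Q in an open interval of length 3 Q.
        The power of the shear with exponent \<open>j\<close> adds 3 j Q, so at most one edge
        fits.\<close>
      have bound: "- 2 * gramQ 1 B < 3 * gramX 1 B + gramQ 1 B \<and> 3 * gramX 1 B + gramQ 1 B < gramQ 1 B"
        if lt: "hK B < hL B" and B: "B \<in> \<Gamma>\<^sub>0" for B
      proof -
        let ?Q = "gramQ 1 B" and ?Y = "3 * gramX 1 B + gramQ 1 B"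
        have sq: "\<bar>y\<bar> < ?Q" if "q < ?Q" "q * ?Q = y\<^sup>2 + 9" for q y
        proof -
          have "y\<^sup>2 < q * ?Q" using that by simp
          also have "\<dots> < ?Q\<^sup>2" using that(1) pos[OF B] by (simp add: power2_eq_square)
          finally show ?thesis using power2_less_imp_less[of "\<bar>y\<bar>" ?Q] pos[OF B] by simp
        qed
        have "q1 B < ?Q \<or> q2 B < ?Q"
          using lt pos[OF B] qpos[OF B] by (auto simp: hK_def hL_def min_def split: if_splits)
        then show ?thesis
        proof
          assume *: "q1 B < ?Q"
          have "q1 B * ?Q = (?Y + ?Q)\<^sup>2 + 9"
            using det[OF B] by (simp add: q1_def power2_eq_square algebra_simps)
          then show ?thesis using sq[OF *, of "?Y + ?Q"] pos[OF B] by auto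
        next
          assume *: "q2 B < ?Q"
          have "q2 B * ?Q = ?Y\<^sup>2 + 9"
            using det[OF B] by (simp add: q2_def power2_eq_square algebra_simps)
          then show ?thesis using sq[OF *, of ?Y] pos[OF B] by auto
        qed
      qed
      have Q: "gramQ 1 (k ** A) = gramQ 1 A" and X: "gramX 1 (k ** A) = gramX 1 A + j * gramQ 1 A"
        using ej \<Gamma>1[OF A] by (auto simp: g)
      have squeeze: "- 1 * q < u \<and> u < 1 * q"
        if "- 2 * q < 3 * x + q" "3 * x + q < q" "- 2 * q < 3 * (x + u) + q" "3 * (x + u) + q < q"
        for q x u :: int using that by presburger
      have "- 1 * gramQ 1 A < j * gramQ 1 A \<and> j * gramQ 1 A < 1 * gramQ 1 A"
        by (rule squeeze[of _ "gramX 1 A"])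
          (use bound[OF lt(1) A] bound[OF lt(2)[unfolded SL_mult] kA, unfolded Q X] in blast)+
      then have "- 1 < j" "j < 1" using pos[OF A] by (simp_all only: mult_less_cancel_right_pos)
      then have "j = 0" by simp
      then show ?thesis using ej by (auto simp: IJ)
    qed
    show "{matV} \<subseteq> K'" by (auto simp: K'_def matV_imat(1))
    have "matT = imat 1 1 (1 * 1) 0 1" "matN = imat 1 (- 1) ((- 1) * 0) 0 (- 1)"
      by (simp_all add: matT_imat(1) matN_imat[of 1])
    then show "{matT, matN} \<subseteq> L'" unfolding L'_def by blast
    show "{matN} \<subseteq> carrier SL2_Z_third" using SL2Z_carrier[OF l matN_SL2Z] by simp
    show "{I, J} \<subseteq> generate SL2_Z_third {matN}"
      using generate.one[of SL2_Z_third "{matN}"] generate.incl[of matN "{matN}" SL2_Z_third]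
      by (simp add: I_def J_def imat_one matN_imat[of 1])
    show "{matN} \<subseteq> generate SL2_Z_third {matT, matN}" by (simp add: generate.incl)
    have "matN = matV ** (matV ** matV)" by (simp add: matN_imat[of 1] matV_imat(1) imat_mult)
    moreover have "matV ** (matV ** matV) \<in> generate SL2_Z_third {matV}"
      by (intro SL_generate_mult generate.incl) simp_all
    ultimately show "{matN} \<subseteq> generate SL2_Z_third {matV}" by simp
  qed
qed

section \<open>Denominators and the tree of lattices\<close>

definition isint :: "rat \<Rightarrow> bool" where "isint x \<longleftrightarrow> (\<exists>m. x = of_int m)"

lemma isint_simps [simp]: "isint (of_int m)" "isint 0" "isint 1"
  using isint_def by (force intro: exI[of _ 0] exI[of _ 1])+

lemma isint_add: "isint x \<Longrightarrow> isint y \<Longrightarrow> isint (x + y)"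
  unfolding isint_def by (metis of_int_add)

lemma isint_diff: "isint x \<Longrightarrow> isint y \<Longrightarrow> isint (x - y)"
  unfolding isint_def by (metis of_int_diff)

lemma isint_mult: "isint x \<Longrightarrow> isint y \<Longrightarrow> isint (x * y)"
  unfolding isint_def by (metis of_int_mult)

lemma isint_dvd_3:
  assumes "isint (of_int r * e)" "isint (3 * e)" "\<not> isint e"
  shows "3 dvd r"
proof (rule ccontr)
  assume "\<not> 3 dvd r"
  then have "coprime 3 r" by (simp add: prime_imp_coprime)
  then obtain u v where "u * 3 + v * r = 1" using bezout_int[of 3 r] by (metis coprime_iff_gcd_eq_1)
  then have "of_int (u * 3 + v * r) * e = e" by simp
  then have "e = of_int u * (3 * e) + of_int v * (of_int r * e)" by (simp add: algebra_simps)
  then have "isint e" using assms(1,2) by (metis isint_add isint_mult isint_simps(1))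
  then show False using assms(3) by simp
qed

text \<open>The distance in the tree of \<open>SL\<^sub>2(\<rat>\<^sub>3)\<close> between the standard lattice and the lattices
  spanned by the rows of \<open>A\<close>, respectively by these rows with the first one multiplied by 3, is read
  off the denominators.\<close>

definition intA :: "nat \<Rightarrow> rat ^ 2 ^ 2 \<Rightarrow> bool" where
  "intA n A \<longleftrightarrow> (\<forall>j. isint (3 ^ n * A $ 1 $ j) \<and> isint (3 ^ n * A $ 2 $ j))"
definition intB :: "nat \<Rightarrow> rat ^ 2 ^ 2 \<Rightarrow> bool" where
  "intB n A \<longleftrightarrow> (\<forall>j. isint (3 ^ n * (3 * A $ 1 $ j)) \<and> isint (3 ^ n * A $ 2 $ j))"

lemma intA_mult:
  assumes "K \<in> SL2Z 1" "intA n A"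
  shows "intA n (K ** A)"
proof -
  obtain p q r s where K: "K = imat 1 p q r s" using assms(1) by (auto simp: SL2Z_def)
  have "3 ^ n * (of_int u * x + of_int v * y) = of_int u * (3 ^ n * x) + of_int v * (3 ^ n * y)"
    for u v and x y :: rat by (simp add: algebra_simps)
  then show ?thesis
    using assms(2) by (simp add: intA_def K imat_def matrix_mult_2_nth isint_add isint_mult)
qed

lemma intB_mult:
  assumes "K \<in> SL2Z 3" "intB n A"
  shows "intB n (K ** A)"
proof -
  obtain p q r s where K: "K = imat 3 p q r s" using assms(1) by (auto simp: SL2Z_def)
  have "3 ^ n * (3 * (of_int p * x + of_int q / 3 * y)) = of_int p * (3 ^ n * (3 * x)) + of_int q * (3 ^ n * y)"
    "3 ^ n * (3 * of_int r * x + of_int s * y) = of_int r * (3 ^ n * (3 * x)) + of_int s * (3 ^ n * y)"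
    for x y :: rat by (simp_all add: algebra_simps)
  then show ?thesis
    using assms(2) by (simp add: intB_def K imat_def matrix_mult_2_nth isint_add isint_mult)
qed

lemma intA_mono: "intA n A \<Longrightarrow> n \<le> m \<Longrightarrow> intA m A"
proof -
  assume n: "intA n A" "n \<le> m"
  have "3 ^ m * x = of_int (3 ^ (m - n)) * (3 ^ n * x)" for x :: rat
    using n(2) by (simp add: mult.assoc[symmetric] power_add[symmetric])
  then show ?thesis using n(1) unfolding intA_def by (metis isint_mult isint_simps(1))
qed

lemma intB_mono: "intB n A \<Longrightarrow> n \<le> m \<Longrightarrow> intB m A"
proof -
  assume n: "intB n A" "n \<le> m"
  have "3 ^ m * x = of_int (3 ^ (m - n)) * (3 ^ n * x)" for x :: rat
    using n(2) by (simp add: mult.assoc[symmetric] power_add[symmetric])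
  then show ?thesis using n(1) unfolding intB_def by (metis isint_mult isint_simps(1))
qed

lemma intA_imp_intB: "intA n A \<Longrightarrow> intB n A"
proof -
  assume "intA n A"
  moreover have "3 ^ n * (3 * x) = of_int 3 * (3 ^ n * x)" for x :: rat by simp
  ultimately show ?thesis unfolding intA_def intB_def by (metis isint_mult isint_simps(1))
qed

lemma intA_exists:
  assumes "A \<in> carrier SL2_Z_third"
  shows "\<exists>n. intA n A"
proof -
  have Z: "\<exists>k. isint (3 ^ k * A $ i $ j)" for i j
    using assms Z_third_iff by (auto simp: SL2_Z_third_def special_linear_group_def isint_def)
  then obtain k where k: "isint (3 ^ k i j * A $ i $ j)" for i j by metis
  define n where "n = k 1 1 + k 1 2 + k 2 1 + k 2 2"
  have "isint (3 ^ n * A $ i $ j)" for i j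
  proof -
    have "k i j \<le> n" using exhaust_2[of i] exhaust_2[of j] by (auto simp: n_def)
    then have "3 ^ n * A $ i $ j = of_int (3 ^ (n - k i j)) * (3 ^ k i j * A $ i $ j)"
      by (simp add: mult.assoc[symmetric] power_add[symmetric])
    then show ?thesis using k by (metis isint_mult isint_simps(1))
  qed
  then show ?thesis by (auto simp: intA_def)
qed

lemma \<Gamma>\<^sub>0I:
  assumes "3 dvd c" "a * d - b * c = 1"
  shows "imat 1 a b c d \<in> \<Gamma>\<^sub>0"
proof -
  obtain k where "c = 3 * k" using assms(1) by blast
  then show ?thesis
    unfolding \<Gamma>\<^sub>0_def using assms(2)
    by (intro CollectI exI[of _ a] exI[of _ b] exI[of _ k] exI[of _ d]) (simp add: algebra_simps)
qed

lemma \<Gamma>\<^sub>0I_3: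
  assumes "3 dvd b" "a * d - b * c = 1"
  shows "imat 3 a b c d \<in> \<Gamma>\<^sub>0"
proof -
  obtain b' where "b = 3 * b'" using assms(1) by blast
  then have "imat 3 a b c d = imat 1 a b' (3 * c) d" by (simp add: imat_def)
  then show ?thesis using \<Gamma>\<^sub>0I[of "3 * c" a d b'] assms \<open>b = 3 * b'\<close> by (simp add: algebra_simps)
qed

text \<open>After scaling, some entry of the first row has denominator exactly 3 while the second
  row is integral. The product keeps its second row integral only if the lower left entry of
  \<open>K\<close> absorbs this 3.\<close>

lemma \<Gamma>\<^sub>0_unique_A:
  assumes B: "intB n A" "\<not> intA n A" and K: "K \<in> SL2Z 1" "intB n (K ** A)"
  shows "K \<in> \<Gamma>\<^sub>0"
proof -
  obtain p q r s where pqrs: "K = imat 1 p q r s" "p * s - q * r = 1" using K(1) by (rule SL2Z_cases)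
  obtain j where j: "\<not> isint (3 ^ n * A $ 1 $ j)" using B by (auto simp: intA_def intB_def)
  have 2: "isint (3 ^ n * A $ 2 $ j)" "isint (3 * (3 ^ n * A $ 1 $ j))"
    using B(1) by (auto simp: intB_def algebra_simps)
  have "isint (3 ^ n * (K ** A) $ 2 $ j)" using K(2) by (simp add: intB_def)
  moreover have "3 ^ n * (K ** A) $ 2 $ j = of_int r * (3 ^ n * A $ 1 $ j) + of_int s * (3 ^ n * A $ 2 $ j)"
    by (simp add: pqrs(1) imat_def matrix_mult_2_nth algebra_simps)
  ultimately have "isint (of_int r * (3 ^ n * A $ 1 $ j) + of_int s * (3 ^ n * A $ 2 $ j))" by simp
  from isint_diff[OF this isint_mult[OF isint_simps(1)[of s] 2(1)]] have "isint (of_int r * (3 ^ n * A $ 1 $ j))" by simp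
  then have "3 dvd r" using isint_dvd_3 2(2) j by blast
  then show ?thesis using \<Gamma>\<^sub>0I pqrs by simp
qed

text \<open>The mirror image: the denominator 3 now sits in a third of the second row and has to be
  absorbed by the upper right entry.\<close>

lemma \<Gamma>\<^sub>0_unique_B:
  fixes A :: "rat ^ 2 ^ 2"
  assumes A: "intA n A" and j: "\<not> isint (3 ^ n * A $ 2 $ j / 3)" and K: "K \<in> SL2Z 3" "intA n (K ** A)"
  shows "K \<in> \<Gamma>\<^sub>0"
proof -
  obtain p q r s where pqrs: "K = imat 3 p q r s" "p * s - q * r = 1" using K(1) by (rule SL2Z_cases)
  have A12: "isint (3 ^ n * A $ 1 $ j)" "isint (3 * (3 ^ n * A $ 2 $ j / 3))"
    using A by (simp_all add: intA_def)
  have "isint (3 ^ n * (K ** A) $ 1 $ j)" using K(2) by (simp add: intA_def)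
  moreover have "3 ^ n * (K ** A) $ 1 $ j = of_int p * (3 ^ n * A $ 1 $ j) + of_int q * (3 ^ n * A $ 2 $ j / 3)"
    by (simp add: pqrs(1) imat_def matrix_mult_2_nth algebra_simps)
  ultimately have "isint (of_int p * (3 ^ n * A $ 1 $ j) + of_int q * (3 ^ n * A $ 2 $ j / 3))" by simp
  from isint_diff[OF this isint_mult[OF isint_simps(1)[of p] A12(1)]] have "isint (of_int q * (3 ^ n * A $ 2 $ j / 3))" by simp
  then have "3 dvd q" using isint_dvd_3 A12(2) j by blast
  then show ?thesis using \<Gamma>\<^sub>0I_3 pqrs by simp
qed

text \<open>Elementary divisors 3^-k and 3^k mean distance 2 k, and 3^-k and 3^(k+1) mean distance 2
  k + 1. So \<open>hA\<close> and \<open>hB\<close> are the distances from the standard lattice, and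
  their parity separates the two kinds of vertices.\<close>

lemma glued_SL2_Z_third:
  "glued SL2_Z_third {matS 1, matU 1} {matS 3, matU 3} {matV, matT, matN}"
proof -
  have l1: "(1::rat) = 1 \<or> (1::rat) = 3" and l3: "(3::rat) = 1 \<or> (3::rat) = 3" by simp_all
  define kA where "kA A = (LEAST n. intA n A)" for A
  define kB where "kB A = (LEAST n. intB n A)" for A
  define hA where "hA A = 2 * kA A" for A
  define hB where "hB A = Suc (2 * kB A)" for A
  have intA_eq: "intA n (K ** A) \<longleftrightarrow> intA n A" if "K \<in> SL2Z 1" "A \<in> carrier SL2_Z_third" for K A n
  proof
    show "intA n A \<Longrightarrow> intA n (K ** A)" using that by (simp add: intA_mult)
    have K: "K \<in> carrier SL2_Z_third" by (rule SL2Z_carrier[OF l1 that(1)])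
    have "inv\<^bsub>SL2_Z_third\<^esub> K \<otimes>\<^bsub>SL2_Z_third\<^esub> (K \<otimes>\<^bsub>SL2_Z_third\<^esub> A) = A"
      using K that(2) by (simp add: SL.m_assoc[symmetric] del: SL_mult)
    then show "intA n (K ** A) \<Longrightarrow> intA n A"
      using intA_mult[OF subgroup.m_inv_closed[OF SL2Z_subgroup[OF l1] that(1)], of n "K ** A"] by simp
  qed
  have intB_eq: "intB n (K ** A) \<longleftrightarrow> intB n A" if "K \<in> SL2Z 3" "A \<in> carrier SL2_Z_third" for K A n
  proof
    show "intB n A \<Longrightarrow> intB n (K ** A)" using that by (simp add: intB_mult)
    have K: "K \<in> carrier SL2_Z_third" by (rule SL2Z_carrier[OF l3 that(1)])
    have "inv\<^bsub>SL2_Z_third\<^esub> K \<otimes>\<^bsub>SL2_Z_third\<^esub> (K \<otimes>\<^bsub>SL2_Z_third\<^esub> A) = A"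
      using K that(2) by (simp add: SL.m_assoc[symmetric] del: SL_mult)
    then show "intB n (K ** A) \<Longrightarrow> intB n A"
      using intB_mult[OF subgroup.m_inv_closed[OF SL2Z_subgroup[OF l3] that(1)], of n "K ** A"] by simp
  qed
  have kA: "intA (kA A) A" "\<And>n. intA n A \<Longrightarrow> kA A \<le> n" if "A \<in> carrier SL2_Z_third" for A
    unfolding kA_def using LeastI_ex[OF intA_exists[OF that]] Least_le by metis+
  have kB: "intB (kB A) A" "\<And>n. intB n A \<Longrightarrow> kB A \<le> n" if "A \<in> carrier SL2_Z_third" for A
    unfolding kB_def using LeastI_ex[of "\<lambda>n. intB n A"] intA_imp_intB intA_exists[OF that] Least_le by metis+
  have mem: "matV \<in> SL2Z 1" "matT \<in> SL2Z 1" "matV \<in> SL2Z 3" "matT \<in> SL2Z 3"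
    using VTN_\<Gamma>\<^sub>0 by (simp_all add: \<Gamma>\<^sub>0_alt)
  have gen: "SL2Z l \<subseteq> generate SL2_Z_third {matS l, matU l}" if l: "l = 1 \<or> l = 3" for l
  proof (rule SL2Z_generated[OF _ l])
    show "subgroup (generate SL2_Z_third {matS l, matU l}) SL2_Z_third"
      by (rule SL.generate_is_subgroup) (use SL2Z_carrier[OF l] matS_SL2Z matU_SL2Z in auto)
  qed (simp_all add: generate.incl)
  show ?thesis
  proof (rule SL.glued_by_heights[where \<Gamma> = "carrier SL2_Z_third" and K' = "SL2Z 1" and L' = "SL2Z 3"
        and M' = \<Gamma>\<^sub>0 and a = hA and b = hB])
    show "subgroup (carrier SL2_Z_third) SL2_Z_third" by (rule SL.subgroup_self)
    show "subgroup (SL2Z 1) SL2_Z_third" "subgroup (SL2Z 3) SL2_Z_third"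
      using SL2Z_subgroup by simp_all
    show "SL2Z 1 \<subseteq> carrier SL2_Z_third" "SL2Z 3 \<subseteq> carrier SL2_Z_third"
      using SL2Z_carrier by blast+
    show "\<Gamma>\<^sub>0 \<subseteq> SL2Z 1" "\<Gamma>\<^sub>0 \<subseteq> SL2Z 3" by (simp_all add: \<Gamma>\<^sub>0_alt)
    show "hA (k \<otimes>\<^bsub>SL2_Z_third\<^esub> A) = hA A" if "k \<in> SL2Z 1" "A \<in> carrier SL2_Z_third" for k A
      using intA_eq[OF that] by (simp add: hA_def kA_def)
    show "hB (k \<otimes>\<^bsub>SL2_Z_third\<^esub> A) = hB A" if "k \<in> SL2Z 3" "A \<in> carrier SL2_Z_third" for k A
      using intB_eq[OF that] by (simp add: hB_def kB_def)
    show "hA A \<noteq> hB A" for A unfolding hA_def hB_def by presburger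
    show "k \<in> \<Gamma>\<^sub>0" if A: "A \<in> carrier SL2_Z_third" and k: "k \<in> SL2Z 1" and lt: "hB A < hA A"
      "hB (k \<otimes>\<^bsub>SL2_Z_third\<^esub> A) < hA (k \<otimes>\<^bsub>SL2_Z_third\<^esub> A)" for k A
    proof -
      have kc: "k ** A \<in> carrier SL2_Z_third" using SL.m_closed[OF SL2Z_carrier[OF l1 k] A] by simp
      have e: "kA (k ** A) = kA A" using intA_eq[OF k A] by (simp add: kA_def)
      have lt': "kB A \<le> kA A - 1" "kB (k ** A) \<le> kA A - 1" "0 < kA A"
        using lt e by (simp_all add: hA_def hB_def)
      have "\<not> intA (kA A - 1) A" using kA(2)[OF A, of "kA A - 1"] lt'(3) by auto
      moreover have "intB (kA A - 1) A" by (rule intB_mono[OF kB(1)[OF A] lt'(1)])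
      moreover have "intB (kA A - 1) (k ** A)" by (rule intB_mono[OF kB(1)[OF kc] lt'(2)])
      ultimately show ?thesis using \<Gamma>\<^sub>0_unique_A k by blast
    qed
    show "k \<in> \<Gamma>\<^sub>0" if A: "A \<in> carrier SL2_Z_third" and k: "k \<in> SL2Z 3" and lt: "hA A < hB A"
      "hA (k \<otimes>\<^bsub>SL2_Z_third\<^esub> A) < hB (k \<otimes>\<^bsub>SL2_Z_third\<^esub> A)" for k A
    proof -
      have kc: "k ** A \<in> carrier SL2_Z_third" using SL.m_closed[OF SL2Z_carrier[OF l3 k] A] by simp
      have e: "kB (k ** A) = kB A" using intB_eq[OF k A] by (simp add: kB_def)
      have lt': "kA A \<le> kB A" "kA (k ** A) \<le> kB A"
        using lt e by (simp_all add: hA_def hB_def)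
      have i: "intA (kB A) A" by (rule intA_mono[OF kA(1)[OF A] lt'(1)])
      have i': "intA (kB A) (k ** A)" by (rule intA_mono[OF kA(1)[OF kc] lt'(2)])
      \<comment> \<open>If the scaled second row were divisible by 3, then for
        \<open>kB A = 0\<close> the determinant would be too, and otherwise \<open>kB A\<close>
        would not be minimal.\<close>
      have "\<exists>j. \<not> isint (3 ^ kB A * A $ 2 $ j / 3)"
      proof (cases "kB A")
        case 0
        show ?thesis
        proof (rule ccontr)
          assume "\<not> (\<exists>j. \<not> isint (3 ^ kB A * A $ 2 $ j / 3))"
          then have *: "isint (A $ 2 $ j / 3)" "isint (A $ 1 $ j)" for j
            using i 0 by (simp_all add: intA_def)
          have "A $ 1 $ 1 * A $ 2 $ 2 - A $ 1 $ 2 * A $ 2 $ 1 = 1"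
            using A by (simp add: SL2_Z_third_def special_linear_group_def det_2)
          then have "A $ 1 $ 1 * (A $ 2 $ 2 / 3) - A $ 1 $ 2 * (A $ 2 $ 1 / 3) = 1 / 3" by simp
          then have "isint (1 / 3)" using * by (metis isint_diff isint_mult)
          then obtain m where "1 / 3 = (of_int m :: rat)" by (auto simp: isint_def)
          then have "of_int (3 * m) = (of_int 1 :: rat)" by simp
          then have "3 * m = 1" by (simp only: of_int_eq_iff)
          then show False by presburger
        qed
      next
        case (Suc n)
        have "\<not> intB n A" using kB(2)[OF A, of n] Suc by auto
        moreover have "isint (3 ^ n * (3 * A $ 1 $ j))" for j
          using i Suc by (simp add: intA_def algebra_simps)
        ultimately obtain j where "\<not> isint (3 ^ n * A $ 2 $ j)" by (auto simp: intB_def)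
        then show ?thesis using Suc by auto
      qed
      then show ?thesis using \<Gamma>\<^sub>0_unique_B[OF i _ k i'] by blast
    qed
    show "{matS 1, matU 1} \<subseteq> SL2Z 1" "{matS 3, matU 3} \<subseteq> SL2Z 3"
      by (simp_all add: matS_SL2Z matU_SL2Z)
    show VTN: "{matV, matT, matN} \<subseteq> carrier SL2_Z_third"
      using SL2Z_carrier[OF l1] mem matN_SL2Z by auto
    show "\<Gamma>\<^sub>0 \<subseteq> generate SL2_Z_third {matV, matT, matN}"
      by (rule \<Gamma>\<^sub>0_generated[OF SL.generate_is_subgroup[OF VTN]]) (simp_all add: generate.incl)
    show "{matV, matT, matN} \<subseteq> generate SL2_Z_third {matS 1, matU 1}"
      using gen[OF l1] mem matN_SL2Z by auto
    show "{matV, matT, matN} \<subseteq> generate SL2_Z_third {matS 3, matU 3}"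
      using gen[OF l3] mem matN_SL2Z by auto
  qed
qed

lemma generate_SL2_Z_third:
  "generate SL2_Z_third ({matS 1, matU 1} \<union> {matS 3, matU 3}) = carrier SL2_Z_third"
proof
  let ?K = "{matS 1, matU 1} \<union> {matS 3, matU 3}"
  have K: "?K \<subseteq> carrier SL2_Z_third"
    using SL2Z_carrier[of 1] SL2Z_carrier[of 3] matS_SL2Z matU_SL2Z by auto
  have H: "subgroup (generate SL2_Z_third ?K) SL2_Z_third" by (rule SL.generate_is_subgroup[OF K])
  show "generate SL2_Z_third ?K \<subseteq> carrier SL2_Z_third" by (rule subgroup.subset[OF H])
  show "carrier SL2_Z_third \<subseteq> generate SL2_Z_third ?K"
    by (rule SL2_Z_third_generated[OF H]; rule SL2Z_generated[OF H]) (simp_all add: generate.incl)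
qed

section \<open>The Euler class\<close>

text \<open>These are the nonzero vectors with argument in [0, pi); accordingly
  \<open>angle_less\<close> compares arguments in [0, 2 pi).\<close>

definition upper :: "rat \<times> rat \<Rightarrow> bool" where
  "upper u \<longleftrightarrow> snd u > 0 \<or> snd u = 0 \<and> fst u > 0"

definition cross :: "rat \<times> rat \<Rightarrow> rat \<times> rat \<Rightarrow> rat" where
  "cross u v = fst u * snd v - snd u * fst v"

definition angle_less :: "rat \<times> rat \<Rightarrow> rat \<times> rat \<Rightarrow> bool" where
  "angle_less u v \<longleftrightarrow> upper u \<and> \<not> upper v \<or> upper u = upper v \<and> cross u v > 0"

lemma upper_uminus: "u \<noteq> 0 \<Longrightarrow> upper (- u) \<longleftrightarrow> \<not> upper u"
  by (cases u) (auto simp: upper_def zero_prod_def)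

lemma cross_uminus [simp]: "cross (- u) v = - cross u v" "cross u (- v) = - cross u v"
  by (simp_all add: cross_def)

lemma cross_swap: "cross v u = - cross u v"
  by (simp add: cross_def)

lemma upper_plus: "upper u \<Longrightarrow> upper v \<Longrightarrow> upper (u + v)"
  by (auto simp: upper_def)

lemma upper_scale: "upper b \<Longrightarrow> upper (x * fst b, x * snd b) \<longleftrightarrow> x > 0"
  by (auto simp: upper_def zero_less_mult_iff)

lemma cross_trans:
  assumes "upper a" "upper b" "upper c" "cross a b \<ge> 0" "cross b c \<ge> 0"
  shows "cross a c \<ge> 0" "cross a b > 0 \<or> cross b c > 0 \<Longrightarrow> cross a c > 0"
proof -
  \<comment> \<open>The linear relation between three vectors of the plane. Since
    \<open>upper\<close> is a convex cone, the sign of the coefficient of \<open>b\<close> can be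
    read off from the right-hand side.\<close>
  have id: "(cross a c * fst b, cross a c * snd b) =
      (cross b c * fst a, cross b c * snd a) + (cross a b * fst c, cross a b * snd c)"
    by (simp add: cross_def algebra_simps)
  have strict: "cross a c > 0" if "cross a b > 0 \<or> cross b c > 0"
  proof (cases "cross b c = 0 \<or> cross a b = 0")
    case False
    then have "upper (cross a c * fst b, cross a c * snd b)"
      unfolding id using assms by (intro upper_plus) (simp_all add: upper_scale)
    then show ?thesis using upper_scale[OF assms(2)] by simp
  next
    case True
    then have "upper (cross a c * fst b, cross a c * snd b)"
      unfolding id using assms that
      by (auto simp: upper_scale zero_prod_def[symmetric])
    then show ?thesis using upper_scale[OF assms(2)] by simp
  qed
  show "cross a b > 0 \<or> cross b c > 0 \<Longrightarrow> cross a c > 0" by (rule strict)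
  show "cross a c \<ge> 0"
  proof (cases "cross a b > 0 \<or> cross b c > 0")
    case False
    then have "cross a b = 0" "cross b c = 0" using assms by auto
    then have "cross a c * fst b = 0" "cross a c * snd b = 0" using id by (simp_all add: prod_eq_iff)
    then show ?thesis using assms(2) by (auto simp: upper_def)
  qed (use strict in auto)
qed

text \<open>Within a half-open half plane \<open>cross\<close> orders the directions linearly. The
  cases of a rotation become such impossible cycles once lower vectors are replaced by their
  negatives.\<close>

lemma no_cross_cycle:
  assumes "upper a" "upper b" "upper c" "upper d"
    "cross a b > 0" "cross b c \<ge> 0" "cross c d > 0" "cross d a \<ge> 0"
  shows False
proof -
  have "cross a c > 0" using cross_trans(2)[of a b c] assms by simp
  then have "cross a d > 0" using cross_trans(2)[of a c d] assms by simp
  then show False using assms(8) by (simp add: cross_swap[of d a])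
qed

text \<open>A rotation by a positive angle less than \<open>\<pi>\<close> preserves the cyclic order; the angle order fails to be
  preserved only where the half-line through \<open>(1, 0)\<close> is crossed.\<close>

lemma angle_less_rotate:
  assumes nz: "u \<noteq> 0" "v \<noteq> 0" "u' \<noteq> 0" "v' \<noteq> 0"
    and rot: "cross u u' > 0" "cross v v' > 0" and det: "cross u' v' = cross u v"
    and dir: "cross u v = 0 \<Longrightarrow> upper u = upper v \<longleftrightarrow> upper u' = upper v'"
  shows "of_bool (angle_less u' v') - of_bool (angle_less u v) =
    of_bool (\<not> upper u \<and> upper u') - (of_bool (\<not> upper v \<and> upper v') :: int)"
proof -
  \<comment> \<open>Only the case without \<open>angle_less u v\<close> needs geometry; the other
    one follows by exchanging the two vectors.\<close>
  have mono: "of_bool (\<not> upper u \<and> upper u') - of_bool (\<not> upper v \<and> upper v') = (of_bool (angle_less u' v') :: int)"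
    if vu: "\<not> angle_less u v" and nz: "u \<noteq> 0" "v \<noteq> 0" "u' \<noteq> 0" "v' \<noteq> 0"
      and rot: "cross u u' > 0" "cross v v' > 0" and det: "cross u' v' = cross u v" for u v u' v'
  proof -
    note up = nz[THEN upper_uminus]
    have sw: "cross v u = - cross u v" "cross v' u' = - cross u v" "cross u' u = - cross u u'" "cross v' v = - cross v v'"
      by (simp_all add: cross_swap[of v u] cross_swap[of v' u'] cross_swap[of u' u] cross_swap[of v' v] det)
    consider "upper v" "\<not> upper u" | "upper v" "upper u" "cross u v \<le> 0" | "\<not> upper v" "\<not> upper u" "cross u v \<le> 0"
      using vu unfolding angle_less_def by (metis not_le)
    then show ?thesis
    proof cases
      case 1
      have "angle_less u' v' \<longleftrightarrow> upper u'"
      proof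
        assume "angle_less u' v'"
        show "upper u'"
        proof (rule ccontr)
          assume "\<not> upper u'"
          then have "\<not> upper v'" "cross u' v' > 0" using \<open>angle_less u' v'\<close> by (auto simp: angle_less_def)
          then show False
            using no_cross_cycle[of "- u" "- u'" "- v'" v] 1 \<open>\<not> upper u'\<close> up rot det sw by simp
        qed
      next
        assume "upper u'"
        show "angle_less u' v'"
        proof (rule ccontr)
          assume "\<not> angle_less u' v'"
          then have "upper v'" "cross u' v' \<le> 0" using \<open>upper u'\<close> by (auto simp: angle_less_def)
          then show False
            using no_cross_cycle[of v v' u' "- u"] 1 \<open>upper u'\<close> up rot det sw by simp
        qed
      qed
      then show ?thesis using 1 by simp
    next
      case 2
      have "\<not> angle_less u' v'"
      proof
        assume "angle_less u' v'"
        then have "upper u'" "\<not> upper v'" using 2 det by (auto simp: angle_less_def)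
        then show False using no_cross_cycle[of u u' "- v'" v] 2 up rot det sw by simp
      qed
      then show ?thesis using 2 by simp
    next
      case 3
      have "\<not> (\<not> upper u' \<and> upper v')"
      proof
        assume *: "\<not> upper u' \<and> upper v'"
        then show False using no_cross_cycle[of v' "- v" "- u" "- u'"] 3 up rot det sw by simp
      qed
      then show ?thesis using 3 det by (auto simp: angle_less_def)
    qed
  qed
  show ?thesis
  proof (cases "angle_less u v")
    case False
    then show ?thesis using mono[OF False nz rot det] by simp
  next
    case True
    have sw: "cross v u = - cross u v" "cross v' u' = - cross u' v'"
      by (rule cross_swap)+
    have "\<not> angle_less v u" using True sw by (auto simp: angle_less_def)
    then have "of_bool (\<not> upper v \<and> upper v') - of_bool (\<not> upper u \<and> upper u') = (of_bool (angle_less v' u') :: int)"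
      using mono[of v u v' u'] nz rot det sw by simp
    \<comment> \<open>Equal directions would spoil this symmetry. They are excluded for
      \<open>u\<close> and \<open>v\<close> by \<open>angle_less u v\<close>, and \<open>dir\<close>
      carries this over to the images.\<close>
    moreover have "angle_less v' u' \<longleftrightarrow> \<not> angle_less u' v'"
      using True det dir sw by (cases "cross u v" "0 :: rat" rule: linorder_cases) (auto simp: angle_less_def)
    then have "of_bool (angle_less v' u') = (1 - of_bool (angle_less u' v') :: int)" by simp
    moreover have "of_bool (angle_less u v) = (1 :: int)" using True by simp
    ultimately show ?thesis by linarith
  qed
qed

section \<open>The Euler cochain and its change under translations\<close>

definition col :: "rat ^ 2 ^ 2 \<Rightarrow> rat \<times> rat" where
  "col A = (A $ 1 $ 1, A $ 2 $ 1)"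

text \<open>It is 1 if turning counterclockwise from the ray of the first entry to the ray of the
  second passes or reaches the direction (1, 0). Its coboundary compares two successive turns with
  the direct one, which is the Euler cocycle of the action on rays.\<close>

definition euler_cochain :: "(rat ^ 2 ^ 2) list \<Rightarrow> int" where
  "euler_cochain xs = (if xs \<in> tuples SL2_Z_third 1 then of_bool (angle_less (col (xs ! 1)) (col (xs ! 0))) else 0)"

text \<open>The same count for the turn from a ray to its image under \<open>z\<close>, provided
  that \<open>z\<close> turns counterclockwise by at most pi.\<close>

definition crossing :: "rat ^ 2 ^ 2 \<Rightarrow> (rat ^ 2 ^ 2) list \<Rightarrow> int" where
  "crossing z xs = (if xs \<in> tuples SL2_Z_third 0 then of_bool (\<not> upper (col (hd xs)) \<and> upper (col (z ** hd xs))) else 0)"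

lemma col_nonzero:
  assumes "A \<in> carrier SL2_Z_third"
  shows "col A \<noteq> 0"
proof
  assume "col A = 0"
  then have "det A = 0" by (simp add: col_def det_2 zero_prod_def)
  then show False using assms by (simp add: SL2_Z_third_def special_linear_group_def)
qed

lemma col_mult: "col (mat2 p q r s ** A) = (p * fst (col A) + q * snd (col A), r * fst (col A) + s * snd (col A))"
  by (simp add: col_def matrix_mult_2_nth)

lemma tuples_1: "xs \<in> tuples G (Suc 0) \<longleftrightarrow> (\<exists>x\<in>carrier G. \<exists>y\<in>carrier G. xs = [x, y])"
  by (auto simp: tuples_def length_Suc_conv)

lemma euler_cochain_in: "euler_cochain \<in> cochains SL2_Z_third {} 1"
  by (simp add: cochains_def euler_cochain_def)

lemma crossing_in: "crossing z \<in> cochains SL2_Z_third {} 0"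
  by (simp add: cochains_def crossing_def)

lemma act_euler_cochainI:
  assumes z: "z \<in> carrier SL2_Z_third"
    and eq: "\<And>A B. A \<in> carrier SL2_Z_third \<Longrightarrow> B \<in> carrier SL2_Z_third \<Longrightarrow>
      of_bool (angle_less (col (z ** B)) (col (z ** A))) - of_bool (angle_less (col B) (col A)) = f [B] - f [A]"
  shows "act SL2_Z_third z euler_cochain - euler_cochain = coboundary SL2_Z_third 0 f"
proof
  fix xs
  show "(act SL2_Z_third z euler_cochain - euler_cochain) xs = coboundary SL2_Z_third 0 f xs"
  proof (cases "xs \<in> tuples SL2_Z_third (Suc 0)")
    case True
    then obtain A B where AB: "A \<in> carrier SL2_Z_third" "B \<in> carrier SL2_Z_third" "xs = [A, B]"
      by (auto simp: tuples_1)
    have "z ** A \<in> carrier SL2_Z_third" "z ** B \<in> carrier SL2_Z_third"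
      using SL.m_closed[OF z AB(1)] SL.m_closed[OF z AB(2)] by simp_all
    then show ?thesis
      using eq[OF AB(1,2)] AB by (simp add: act_def euler_cochain_def coboundary_def tuples_def)
  next
    case False
    have "monoid.mult SL2_Z_third = (**)" by (intro ext) simp
    then show ?thesis
      using False map_tuples_iff[OF group_SL2_Z_third z, of xs "Suc 0"]
      by (auto simp: act_def euler_cochain_def coboundary_def)
  qed
qed

text \<open>One vector is a scalar multiple of the other, and a homogeneous map keeps the sign of
  the scalar.\<close>

lemma upper_parallel:
  assumes "cross u v = 0" "u \<noteq> 0" "v \<noteq> 0"
    and lin: "\<And>x. f (x * fst u, x * snd u) = (x * fst (f u), x * snd (f u))"
    and nz: "f u \<noteq> 0" "f v \<noteq> 0"
  shows "upper u = upper v \<longleftrightarrow> upper (f u) = upper (f v)"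
proof -
  obtain x where x: "v = (x * fst u, x * snd u)"
  proof (cases "fst u = 0")
    case True
    then have "snd u \<noteq> 0" using assms(2) by (auto simp: prod_eq_iff)
    then have "v = (snd v / snd u * fst u, snd v / snd u * snd u)"
      using True assms(1) by (auto simp: prod_eq_iff cross_def)
    then show ?thesis using that by blast
  next
    case False
    then have "v = (fst v / fst u * fst u, fst v / fst u * snd u)"
      using assms(1) by (auto simp: prod_eq_iff cross_def field_simps)
    then show ?thesis using that by blast
  qed
  have "x \<noteq> 0" using x assms(3) by (auto simp: zero_prod_def)
  have *: "upper (x * fst b, x * snd b) \<longleftrightarrow> (x > 0 \<longleftrightarrow> upper b)" if "b \<noteq> 0" for b
  proof (cases "upper b")
    case False
    then have "upper (- b)" using that by (simp add: upper_uminus)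
    then have "upper (- x * fst (- b), - x * snd (- b)) \<longleftrightarrow> - x > 0" by (rule upper_scale)
    then show ?thesis using False \<open>x \<noteq> 0\<close> by auto
  qed (simp add: upper_scale)
  show ?thesis using *[OF assms(2)] *[OF nz(1)] lin[of x] by (simp add: x) blast
qed

lemma act_euler_cochain_elliptic:
  assumes z: "z \<in> carrier SL2_Z_third" and pos: "\<And>A. A \<in> carrier SL2_Z_third \<Longrightarrow> cross (col A) (col (z ** A)) > 0"
  shows "act SL2_Z_third z euler_cochain - euler_cochain = coboundary SL2_Z_third 0 (crossing z)"
proof (rule act_euler_cochainI[OF z])
  fix A B assume AB: "A \<in> carrier SL2_Z_third" "B \<in> carrier SL2_Z_third"
  obtain p q r s where pqrs: "z = mat2 p q r s" by (rule mat2_cases)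
  have det: "p * s - q * r = 1" using z by (simp add: pqrs SL_carrier)
  define f where "f u = (p * fst u + q * snd u, r * fst u + s * snd u)" for u
  have f: "col (z ** D) = f (col D)" for D by (simp add: pqrs col_mult f_def)
  have zAB: "z ** A \<in> carrier SL2_Z_third" "z ** B \<in> carrier SL2_Z_third"
    using SL.m_closed[OF z AB(1)] SL.m_closed[OF z AB(2)] by simp_all
  note nz = col_nonzero[OF AB(2)] col_nonzero[OF AB(1)] col_nonzero[OF zAB(2)] col_nonzero[OF zAB(1)]
  have "cross (f u) (f v) = (p * s - q * r) * cross u v" for u v
    by (simp add: cross_def f_def algebra_simps)
  then have cr: "cross (f u) (f v) = cross u v" for u v by (simp add: det)
  have "of_bool (angle_less (col (z ** B)) (col (z ** A))) - of_bool (angle_less (col B) (col A)) =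
    of_bool (\<not> upper (col B) \<and> upper (col (z ** B))) - (of_bool (\<not> upper (col A) \<and> upper (col (z ** A))) :: int)"
  proof (rule angle_less_rotate[OF nz pos[OF AB(2)] pos[OF AB(1)]])
    show "cross (col (z ** B)) (col (z ** A)) = cross (col B) (col A)" by (simp add: f cr)
    show "upper (col B) = upper (col A) \<longleftrightarrow> upper (col (z ** B)) = upper (col (z ** A))"
      if "cross (col B) (col A) = 0" unfolding f
    proof (rule upper_parallel[OF that nz(1,2)])
      show "f (x * fst (col B), x * snd (col B)) = (x * fst (f (col B)), x * snd (f (col B)))" for x
        by (simp add: f_def algebra_simps)
    qed (use nz in \<open>simp_all add: f[symmetric]\<close>)
  qed
  then show "of_bool (angle_less (col (z ** B)) (col (z ** A))) - of_bool (angle_less (col B) (col A)) =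
      crossing z [B] - crossing z [A]"
    using AB by (simp add: crossing_def tuples_def)
qed

lemma matN_carrier: "matN \<in> carrier SL2_Z_third"
  using SL2Z_carrier[OF _ matN_SL2Z[of 1]] by simp

text \<open>A turn by exactly pi makes \<open>cross\<close> vanish, so the elliptic criterion does
  not apply and the half planes are compared directly.\<close>

lemma act_euler_cochain_matN:
  "act SL2_Z_third matN euler_cochain - euler_cochain = coboundary SL2_Z_third 0 (crossing matN)"
proof (rule act_euler_cochainI[OF matN_carrier])
  fix A B assume AB: "A \<in> carrier SL2_Z_third" "B \<in> carrier SL2_Z_third"
  have N: "col (matN ** D) = - col D" for D by (simp add: matN_def col_mult uminus_prod_def)
  note up = AB[THEN col_nonzero, THEN upper_uminus]
  show "of_bool (angle_less (col (matN ** B)) (col (matN ** A))) - of_bool (angle_less (col B) (col A)) =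
      crossing matN [B] - crossing matN [A]"
    using AB by (auto simp: N up angle_less_def crossing_def tuples_def)
qed

text \<open>The expression is the quadratic form r x^2 + (s - p) x y - q y^2; \<open>disc\<close>
  says that its discriminant is negative, and completing the square shows that it is positive
  definite.\<close>

lemma cross_elliptic_pos:
  fixes p q r s :: rat
  assumes r: "r > 0" and disc: "(s - p)\<^sup>2 + 4 * q * r < 0" and u: "u \<noteq> 0"
  shows "cross u (p * fst u + q * snd u, r * fst u + s * snd u) > 0"
proof -
  obtain x y where xy: "u = (x, y)" by (cases u)
  have "4 * r * cross u (p * fst u + q * snd u, r * fst u + s * snd u) =
      (2 * r * x + (s - p) * y)\<^sup>2 + (- ((s - p)\<^sup>2 + 4 * q * r)) * y\<^sup>2"
    by (simp add: xy cross_def power2_eq_square algebra_simps)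
  also have "\<dots> > 0"
  proof (cases "y = 0")
    case True
    then have "x \<noteq> 0" using u xy by (simp add: zero_prod_def)
    then show ?thesis using True r by simp
  next
    case False
    then have "(- ((s - p)\<^sup>2 + 4 * q * r)) * y\<^sup>2 > 0" using disc by (intro mult_pos_pos) simp_all
    then show ?thesis by (simp add: add_nonneg_pos)
  qed
  finally show ?thesis using r by (simp add: zero_less_mult_iff)
qed

lemma act_euler_cochain_mat2:
  assumes "mat2 p q r s \<in> carrier SL2_Z_third" "r > 0" "(s - p)\<^sup>2 + 4 * q * r < 0"
  shows "act SL2_Z_third (mat2 p q r s) euler_cochain - euler_cochain =
    coboundary SL2_Z_third 0 (crossing (mat2 p q r s))"
proof (rule act_euler_cochain_elliptic[OF assms(1)])
  show "cross (col A) (col (mat2 p q r s ** A)) > 0" if "A \<in> carrier SL2_Z_third" for A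
    unfolding col_mult by (rule cross_elliptic_pos[OF assms(2,3) col_nonzero[OF that]])
qed

lemma matS_carrier: "l = 1 \<or> l = 3 \<Longrightarrow> matS l \<in> carrier SL2_Z_third"
  and matU_carrier: "l = 1 \<or> l = 3 \<Longrightarrow> matU l \<in> carrier SL2_Z_third"
  using SL2Z_carrier matS_SL2Z matU_SL2Z by blast+

lemma matV_carrier: "matV \<in> carrier SL2_Z_third" and matT_carrier: "matT \<in> carrier SL2_Z_third"
  using VTN_\<Gamma>\<^sub>0 subgroup.subset[OF \<Gamma>\<^sub>0_subgroup] by auto

lemma act_euler_cochain_SUV:
  "l = 1 \<or> l = 3 \<Longrightarrow> act SL2_Z_third (matS l) euler_cochain - euler_cochain = coboundary SL2_Z_third 0 (crossing (matS l))"
  "l = 1 \<or> l = 3 \<Longrightarrow> act SL2_Z_third (matU l) euler_cochain - euler_cochain = coboundary SL2_Z_third 0 (crossing (matU l))"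
  "act SL2_Z_third matV euler_cochain - euler_cochain = coboundary SL2_Z_third 0 (crossing matV)"
  using act_euler_cochain_mat2[of 0 "- 1 / l" l 0] act_euler_cochain_mat2[of 0 "- 1 / l" l 1]
    act_euler_cochain_mat2[of "- 1" "- 1" 3 2] matS_carrier[of l] matU_carrier[of l] matV_carrier
  by (auto simp: matS_def matU_def matV_def imat_def)

text \<open>It suffices to test the generators, which are all elliptic. For them the cochain changes
  by a coboundary, so its own coboundary does not change.\<close>

lemma euler_class_invariant:
  "coboundary SL2_Z_third 1 euler_cochain \<in> cochains SL2_Z_third (carrier SL2_Z_third) 2"
proof -
  let ?c = "coboundary SL2_Z_third 1 euler_cochain"
  have sub: "{matS 1, matU 1} \<union> {matS 3, matU 3} \<subseteq> carrier SL2_Z_third"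
    using matS_carrier matU_carrier by auto
  have "?c \<in> cochains SL2_Z_third {} (Suc 1)"
    by (rule SL.coboundary_cochains[OF euler_cochain_in]) simp
  then have c: "?c \<in> cochains SL2_Z_third {} 2" by (simp add: numeral_2_eq_2)
  have "act SL2_Z_third z ?c = ?c" if "z \<in> {matS 1, matU 1} \<union> {matS 3, matU 3}" for z
  proof -
    have z: "z \<in> carrier SL2_Z_third" using that sub by auto
    have "act SL2_Z_third z euler_cochain - euler_cochain = coboundary SL2_Z_third 0 (crossing z)"
      using that act_euler_cochain_SUV by auto
    then have "coboundary SL2_Z_third (Suc 0) (act SL2_Z_third z euler_cochain - euler_cochain) = 0" by simp
    then show ?thesis by (simp add: coboundary_linear SL.act_coboundary[OF z])
  qed
  then have "?c \<in> cochains SL2_Z_third ({matS 1, matU 1} \<union> {matS 3, matU 3}) 2"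
    by (rule SL.cochainsI_act[OF c])
  from SL.cochains_generate[OF sub this] show ?thesis by (simp only: generate_SL2_Z_third)
qed

interpretation E: group_with_class SL2_Z_third euler_cochain
  by unfold_locales (rule euler_cochain_in, rule euler_class_invariant)

section \<open>Elements of finite order make one full turn\<close>

lemma SL_pow: "z [^]\<^bsub>SL2_Z_third\<^esub> (0::nat) = mat2 1 0 0 1"
  "z [^]\<^bsub>SL2_Z_third\<^esub> (Suc n) = z [^]\<^bsub>SL2_Z_third\<^esub> n ** z"
  by (simp_all add: SL_one)

text \<open>Evaluated at \<open>A\<close>, the norm counts the entries into the upper half plane
  along the orbit of a ray. The value one means that the orbit goes round exactly once.\<close>

lemma orbit_sum_crossing:
  assumes z: "z \<in> carrier SL2_Z_third"
    and eq: "\<And>A. A \<in> carrier SL2_Z_third \<Longrightarrow>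
      (\<Sum>i<m. of_bool (\<not> upper (col ((z [^]\<^bsub>SL2_Z_third\<^esub> i) ** A)) \<and>
        upper (col (z ** ((z [^]\<^bsub>SL2_Z_third\<^esub> i) ** A))))) = (1 :: int)"
  shows "SL.orbit_sum z m (crossing z) = unit_cochain SL2_Z_third"
proof
  fix xs
  show "SL.orbit_sum z m (crossing z) xs = unit_cochain SL2_Z_third xs"
  proof (cases "xs \<in> tuples SL2_Z_third 0")
    case True
    then obtain A where A: "A \<in> carrier SL2_Z_third" "xs = [A]" by (auto simp: tuples_0)
    have "(z [^]\<^bsub>SL2_Z_third\<^esub> i) ** A \<in> carrier SL2_Z_third" for i :: nat
      using SL.m_closed[OF SL.nat_pow_closed[OF z] A(1)] by simp
    then show ?thesis
      using eq[OF A(1)] A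
      by (simp add: SL.orbit_sum_def sum_fun_apply act_def crossing_def unit_cochain_def tuples_def)
  next
    case False
    have "SL.orbit_sum z m (crossing z) \<in> cochains SL2_Z_third {} 0"
      by (rule SL.orbit_sum_cochains[OF z crossing_in])
    then show ?thesis using False by (simp add: cochains_def unit_cochain_def)
  qed
qed

lemma rotation_matN: "E.rotation matN 2 (crossing matN)"
  unfolding E.rotation_def
proof (intro conjI)
  have sq: "matN ** matN = mat2 1 0 0 1" by (simp add: matN_def mat2_mult)
  have eqs: "(\<Sum>i<2. f i) = f 0 + f (Suc 0)" for f :: "nat \<Rightarrow> int" by (simp add: numeral_2_eq_2)
  show "matN [^]\<^bsub>SL2_Z_third\<^esub> (2::nat) = \<one>\<^bsub>SL2_Z_third\<^esub>"
    by (simp add: numeral_2_eq_2 SL_pow sq SL_one mat2_mult matN_def)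
  show "SL.orbit_sum matN 2 (crossing matN) = unit_cochain SL2_Z_third"
  proof (rule orbit_sum_crossing[OF matN_carrier])
    fix A assume A: "A \<in> carrier SL2_Z_third"
    have N: "col (matN ** D) = - col D" for D by (simp add: matN_def col_mult uminus_prod_def)
    have 1: "mat2 1 0 0 1 ** D = D" for D by (simp add: mat_1_eq_mat2[symmetric])
    show "(\<Sum>i<(2::nat). of_bool (\<not> upper (col ((matN [^]\<^bsub>SL2_Z_third\<^esub> i) ** A)) \<and>
        upper (col (matN ** ((matN [^]\<^bsub>SL2_Z_third\<^esub> i) ** A))))) = (1 :: int)"
      unfolding eqs SL_pow 1 using upper_uminus[OF col_nonzero[OF A]] by (simp add: N)
  qed
qed (use matN_carrier crossing_in act_euler_cochain_matN in auto)

lemma matN_commute: "A ** (matN ** B) = matN ** (A ** B)"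
proof -
  obtain a b c d where A: "A = mat2 a b c d" by (rule mat2_cases)
  have "A ** matN = matN ** A" by (simp add: A matN_def mat2_mult)
  then show ?thesis by (simp add: matrix_mul_assoc)
qed

lemma rotation_order_4:
  assumes z: "z \<in> carrier SL2_Z_third" and zz: "z ** z = matN"
    and act: "act SL2_Z_third z euler_cochain - euler_cochain = coboundary SL2_Z_third 0 (crossing z)"
  shows "E.rotation z 4 (crossing z)"
  unfolding E.rotation_def
proof (intro conjI)
  have 1: "mat2 1 0 0 1 ** D = D" for D by (simp add: mat_1_eq_mat2[symmetric])
  have 4: "4 = Suc (Suc (Suc (Suc 0)))" by simp
  have NN: "matN ** matN = mat2 1 0 0 1" by (simp add: matN_def mat2_mult)
  have zzm: "z ** (z ** D) = matN ** D" for D by (simp add: matrix_mul_assoc zz)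
  show "z [^]\<^bsub>SL2_Z_third\<^esub> (4::nat) = \<one>\<^bsub>SL2_Z_third\<^esub>"
    unfolding 4 SL_pow SL_one by (simp add: 1 zz zzm matrix_mul_assoc[symmetric] NN)
  show "SL.orbit_sum z 4 (crossing z) = unit_cochain SL2_Z_third"
  proof (rule orbit_sum_crossing[OF z])
    fix A assume A: "A \<in> carrier SL2_Z_third"
    have zA: "z ** A \<in> carrier SL2_Z_third" using SL.m_closed[OF z A] by simp
    have N: "col (matN ** D) = - col D" for D by (simp add: matN_def col_mult uminus_prod_def)
    have eqs: "(\<Sum>i<4. f i) = f 0 + f (Suc 0) + f (Suc (Suc 0)) + f (Suc (Suc (Suc 0)))" for f :: "nat \<Rightarrow> int"
      unfolding 4 by simp
    \<comment> \<open>The second half of the orbit consists of the negatives of the first half, so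
      the half planes are p, q, not p, not q; cyclically there is exactly one step from lower to
      upper.\<close>
    show "(\<Sum>i<(4::nat). of_bool (\<not> upper (col ((z [^]\<^bsub>SL2_Z_third\<^esub> i) ** A)) \<and>
        upper (col (z ** ((z [^]\<^bsub>SL2_Z_third\<^esub> i) ** A))))) = (1 :: int)"
      unfolding eqs SL_pow 1 matrix_mul_assoc[symmetric] zzm matN_commute[of z] N
      using upper_uminus[OF col_nonzero[OF A]] upper_uminus[OF col_nonzero[OF zA]] by auto
  qed
qed (use z act crossing_in in auto)

lemma rotation_order_6:
  assumes z: "z \<in> carrier SL2_Z_third" and zzz: "z ** (z ** z) = matN"
    and plus: "\<And>A. col (z ** (z ** A)) + col A = col (z ** A)"
    and act: "act SL2_Z_third z euler_cochain - euler_cochain = coboundary SL2_Z_third 0 (crossing z)"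
  shows "E.rotation z 6 (crossing z)"
  unfolding E.rotation_def
proof (intro conjI)
  have 1: "mat2 1 0 0 1 ** D = D" for D by (simp add: mat_1_eq_mat2[symmetric])
  have 6: "6 = Suc (Suc (Suc (Suc (Suc (Suc 0)))))" by simp
  have NN: "matN ** matN = mat2 1 0 0 1" by (simp add: matN_def mat2_mult)
  have zzzm: "z ** (z ** (z ** D)) = matN ** D" for D by (simp add: matrix_mul_assoc zzz[symmetric])
  show "z [^]\<^bsub>SL2_Z_third\<^esub> (6::nat) = \<one>\<^bsub>SL2_Z_third\<^esub>"
    unfolding 6 SL_pow SL_one by (simp add: 1 zzz zzzm matrix_mul_assoc[symmetric] NN)
  show "SL.orbit_sum z 6 (crossing z) = unit_cochain SL2_Z_third"
  proof (rule orbit_sum_crossing[OF z])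
    fix A assume A: "A \<in> carrier SL2_Z_third"
    have zA: "z ** A \<in> carrier SL2_Z_third" using SL.m_closed[OF z A] by simp
    have zzA: "z ** (z ** A) \<in> carrier SL2_Z_third" using SL.m_closed[OF z zA] by simp
    have N: "col (matN ** D) = - col D" for D by (simp add: matN_def col_mult uminus_prod_def)
    have eqs: "(\<Sum>i<6. f i) = f 0 + f (Suc 0) + f (Suc (Suc 0)) + f (Suc (Suc (Suc 0)))
        + f (Suc (Suc (Suc (Suc 0)))) + f (Suc (Suc (Suc (Suc (Suc 0)))))" for f :: "nat \<Rightarrow> int"
      unfolding 6 by simp
    note up = A[THEN col_nonzero, THEN upper_uminus] zA[THEN col_nonzero, THEN upper_uminus]
      zzA[THEN col_nonzero, THEN upper_uminus]
    \<comment> \<open>Alternating half planes along the orbit would give three crossings. They are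
      impossible because by \<open>plus\<close> the middle one of three successive vectors is the
      sum of the outer two.\<close>
    have "upper (col (z ** (z ** A))) \<Longrightarrow> upper (col A) \<Longrightarrow> upper (col (z ** A))"
      using upper_plus[of "col (z ** (z ** A))" "col A"] by (simp add: plus)
    moreover have "\<not> upper (col (z ** (z ** A))) \<Longrightarrow> \<not> upper (col A) \<Longrightarrow> \<not> upper (col (z ** A))"
    proof -
      have "- col (z ** (z ** A)) + - col A = - col (z ** A)" using plus[of A] by (metis minus_add_distrib add.commute)
      then show "\<not> upper (col (z ** (z ** A))) \<Longrightarrow> \<not> upper (col A) \<Longrightarrow> \<not> upper (col (z ** A))"
        using upper_plus[of "- col (z ** (z ** A))" "- col A"] up by simp
    qed
    ultimately show "(\<Sum>i<(6::nat). of_bool (\<not> upper (col ((z [^]\<^bsub>SL2_Z_third\<^esub> i) ** A)) \<and>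
        upper (col (z ** ((z [^]\<^bsub>SL2_Z_third\<^esub> i) ** A))))) = (1 :: int)"
      unfolding eqs SL_pow 1 matrix_mul_assoc[symmetric] zzzm matN_commute[of z] N
      by (cases "upper (col A)"; cases "upper (col (z ** A))"; cases "upper (col (z ** (z ** A)))")
        (simp_all add: up)
  qed
qed (use z act crossing_in in auto)

lemma rotation_matS: "l = 1 \<or> l = 3 \<Longrightarrow> E.rotation (matS l) 4 (crossing (matS l))"
  by (rule rotation_order_4[OF matS_carrier _ act_euler_cochain_SUV(1)])
    (auto simp: matS_def matN_imat[of l] imat_mult)

lemma rotation_matU: "l = 1 \<or> l = 3 \<Longrightarrow> E.rotation (matU l) 6 (crossing (matU l))"
  by (rule rotation_order_6[OF matU_carrier _ _ act_euler_cochain_SUV(2)])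
    (auto simp: matU_def matN_imat[of l] imat_mult, auto simp: imat_def col_mult prod_eq_iff)

lemma rotation_matV: "E.rotation matV 6 (crossing matV)"
  by (rule rotation_order_6[OF matV_carrier _ _ act_euler_cochain_SUV(3)])
    (simp_all add: matV_def matN_def mat2_mult col_mult prod_eq_iff)

section \<open>The cohomology of the amalgams\<close>

context group_with_class
begin

text \<open>The obstruction lies in the even cohomology of \<open>M\<close> and is a multiple of
  \<open>cp j\<close>, which extends to both sides.\<close>

lemma glued_odd_coboundary:
  assumes gl: "glued G K L M" and M: "even_coh M m"
    and "x \<in> coboundaries G K (Suc (2 * j))" "x \<in> coboundaries G L (Suc (2 * j))"
  shows "x \<in> coboundaries G (K \<union> L) (Suc (2 * j))"
proof -
  obtain \<alpha> where \<alpha>: "\<alpha> \<in> cochains G K (2 * j)" "x = coboundary G (2 * j) \<alpha>"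
    using assms(3) by (rule coboundariesE)
  obtain \<beta> where \<beta>: "\<beta> \<in> cochains G L (2 * j)" "x = coboundary G (2 * j) \<beta>"
    using assms(4) by (rule coboundariesE)
  have "\<alpha> - \<beta> \<in> cocycles G M (2 * j)"
    using \<alpha> \<beta> glued_cochains[OF gl] by (auto simp: cocycles_def coboundary_linear intro: cochains_linear)
  then obtain k where "\<alpha> - \<beta> - of_int k * cp j \<in> coboundaries G M (2 * j)"
    using even_cohE[OF M] by blast
  then show ?thesis
    using glued_exact[OF gl \<alpha>(1) \<beta>(1) \<alpha>(2) \<beta>(2), of "of_int k * cp j"] glued_subset[OF gl]
    by (auto intro: cocycles_linear cp_cocycle)
qed

text \<open>An invariant primitive of \<open>k\<close> times c differs from \<open>k\<close> times
  \<open>w\<close> by a cocycle without invariance, hence by a coboundary. The resulting 0-cochain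
  has computable translates.\<close>

lemma multiple_of_class_potential:
  assumes K: "K \<subseteq> carrier G" and "even_coh K m" "m dvd k"
  obtains \<alpha> where "\<alpha> \<in> cochains G {} 0" "of_int k * w + coboundary G 0 \<alpha> \<in> cochains G K (Suc 0)"
proof -
  have "of_int k * cp (Suc 0) \<in> coboundaries G K (2 * Suc 0)"
    using even_coh_iff[OF assms(2)] assms(3) by blast
  moreover have "cp (Suc 0) = c" unfolding cp_Suc by simp
  ultimately have "of_int k * c \<in> coboundaries G K (Suc (Suc 0))" by (simp add: numeral_2_eq_2)
  then obtain \<phi> where \<phi>: "\<phi> \<in> cochains G K (Suc 0)" "of_int k * c = coboundary G (Suc 0) \<phi>"
    by (rule coboundariesE)
  have "w \<in> cochains G {} (Suc 0)" using w_cochain by simp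
  moreover have "\<phi> \<in> cochains G {} (Suc 0)" using cochains_mono[OF empty_subsetI \<phi>(1)] .
  moreover have "coboundary G (Suc 0) (\<phi> - of_int k * w) = 0"
    using \<phi>(2) by (simp add: coboundary_linear c_def)
  ultimately have "\<phi> - of_int k * w \<in> cocycles G {} (Suc 0)"
    by (intro cocyclesI cochains_diff cochains_of_int_mult)
  then obtain \<alpha> where \<alpha>: "\<alpha> \<in> cochains G {} 0" "\<phi> - of_int k * w = coboundary G 0 \<alpha>"
    using cocycles_trivial_acyclic coboundariesE by metis
  have "of_int k * w + coboundary G 0 \<alpha> = \<phi>" by (simp add: \<alpha>(2)[symmetric])
  then show ?thesis using that[OF \<alpha>(1)] \<phi>(1) by simp
qed

text \<open>Invariance determines the change of \<open>\<alpha>\<close> up to a constant. Norms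
  determine the constant, since \<open>a\<close> has norm one and
  \<open>act G z \<alpha> - \<alpha>\<close> has norm zero.\<close>

lemma rotation_potential:
  assumes r: "rotation z m a" and \<alpha>: "\<alpha> \<in> cochains G {} 0"
    and inv: "of_int (int m * k) * w + coboundary G 0 \<alpha> \<in> cochains G {z} (Suc 0)"
  shows "act G z \<alpha> = \<alpha> + of_int k * unit_cochain G - of_int (int m * k) * a"
proof -
  have z: "z \<in> carrier G" "z [^] m = \<one>" "0 < m" and a: "a \<in> cochains G {} 0" "orbit_sum z m a = unit_cochain G"
    and aw: "act G z w - w = coboundary G 0 a"
    using r by (auto simp: rotation_def)
  define b where "b = of_int (int m * k) * a + (act G z \<alpha> - \<alpha>)"
  have "act G z (of_int (int m * k) * w + coboundary G 0 \<alpha>) = of_int (int m * k) * w + coboundary G 0 \<alpha>"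
    using cochains_act_eq[OF inv] by simp
  then have "of_int (int m * k) * (act G z w - w) + (coboundary G 0 (act G z \<alpha>) - coboundary G 0 \<alpha>) = 0"
    by (simp only: act_linear act_coboundary[OF z(1)]) (simp add: algebra_simps)
  then have "coboundary G 0 b = 0"
    by (simp only: b_def coboundary_linear aw)
  moreover have "b \<in> cochains G {} 0"
    unfolding b_def by (rule cochains_add[OF cochains_of_int_mult[OF a(1)] cochains_diff[OF act_cochains[OF \<alpha> z(1)] \<alpha>]])
  ultimately obtain k' where k': "b = of_int k' * unit_cochain G"
    using cocycles_0_constant[OF cocyclesI] by blast
  have "of_int (int m * k') * unit_cochain G = orbit_sum z m b"
    using orbit_sum_const[OF z(1) unit_cochain_cochains, of m] z(1)
    by (simp add: k' orbit_sum_linear algebra_simps)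
  also have "\<dots> = of_int (int m * k) * unit_cochain G"
    by (simp only: b_def orbit_sum_linear a(2) act_orbit_sum(2)[OF z(1,2) \<alpha>]) simp
  finally have "of_int (int m * k' - int m * k) * unit_cochain G = 0" by (simp add: algebra_simps)
  then have "int m * k' = int m * k" using of_int_mult_unit_eq_0[of "int m * k' - int m * k"] by simp
  then have "k' = k" using z(3) by simp
  then have "of_int (int m * k) * a + (act G z \<alpha> - \<alpha>) = of_int k * unit_cochain G"
    using k' by (simp only: b_def)
  then show ?thesis by (simp add: algebra_simps)
qed

end

text \<open>A shear along the first axis preserves the half planes and \<open>cross\<close>, hence
  the order of angles itself.\<close>

lemma act_matT_euler_cochain:
  assumes l: "l = 1 \<or> l = 3"
  shows "act SL2_Z_third (imat l 1 1 0 1) euler_cochain = euler_cochain"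
proof -
  have z: "imat l 1 1 0 1 \<in> carrier SL2_Z_third" by (rule imat_carrier[OF l]) simp
  have "act SL2_Z_third (imat l 1 1 0 1) euler_cochain - euler_cochain = coboundary SL2_Z_third 0 0"
  proof (rule act_euler_cochainI[OF z])
    fix A B :: "rat ^ 2 ^ 2"
    have "cross (col (imat l 1 1 0 1 ** B)) (col (imat l 1 1 0 1 ** A)) = cross (col B) (col A)"
      by (simp add: imat_def col_mult cross_def algebra_simps)
    moreover have "upper (col (imat l 1 1 0 1 ** D)) = upper (col D)" for D
      by (auto simp: imat_def col_mult upper_def)
    ultimately show "of_bool (angle_less (col (imat l 1 1 0 1 ** B)) (col (imat l 1 1 0 1 ** A)))
        - of_bool (angle_less (col B) (col A)) = (0 :: (rat ^ 2 ^ 2) list \<Rightarrow> int) [B] - 0 [A]"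
      by (simp add: angle_less_def)
  qed
  then show ?thesis by simp
qed

lemma matU_eq: "l = 1 \<or> l = 3 \<Longrightarrow> matU l = matS l ** imat l 1 1 0 1"
  by (auto simp: matU_def matS_def imat_mult)

text \<open>The shear moves no ray from one half plane to the other, so in the product only
  \<open>matS l\<close> causes crossings.\<close>

lemma crossing_matU:
  assumes l: "l = 1 \<or> l = 3"
  shows "crossing (matU l) = act SL2_Z_third (imat l 1 1 0 1) (crossing (matS l))"
proof
  fix xs
  have z: "imat l 1 1 0 1 \<in> carrier SL2_Z_third" by (rule imat_carrier[OF l]) simp
  show "crossing (matU l) xs = act SL2_Z_third (imat l 1 1 0 1) (crossing (matS l)) xs"
  proof (cases "xs \<in> tuples SL2_Z_third 0")
    case True
    then obtain A where A: "A \<in> carrier SL2_Z_third" "xs = [A]" by (auto simp: tuples_0)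
    have "imat l 1 1 0 1 ** A \<in> carrier SL2_Z_third" using SL.m_closed[OF z A(1)] by simp
    moreover have "upper (col (imat l 1 1 0 1 ** A)) = upper (col A)"
      by (auto simp: imat_def col_mult upper_def)
    ultimately show ?thesis
      using A by (simp add: crossing_def act_def tuples_def matU_eq[OF l] matrix_mul_assoc)
  next
    case False
    have "act SL2_Z_third (imat l 1 1 0 1) (crossing (matS l)) \<in> cochains SL2_Z_third {} 0"
      by (rule SL.act_cochains[OF crossing_in z])
    then show ?thesis using False by (simp add: crossing_def cochains_def)
  qed
qed

text \<open>The crossings of \<open>matU l\<close> and \<open>matS l\<close> cancel by
  \<open>crossing_matU\<close>; what remains are the constants 12/6 and 12/4 of the two
  rotations.\<close>

lemma potential_shear:
  assumes l: "l = 1 \<or> l = 3" and \<alpha>: "\<alpha> \<in> cochains SL2_Z_third {} 0"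
    and inv: "of_int 12 * euler_cochain + coboundary SL2_Z_third 0 \<alpha> \<in>
      cochains SL2_Z_third {matS l, matU l} (Suc 0)"
  shows "act SL2_Z_third (imat l 1 1 0 1) \<alpha> = \<alpha> - unit_cochain SL2_Z_third"
proof -
  define T where "T = imat l 1 1 0 1"
  have T: "T \<in> carrier SL2_Z_third" unfolding T_def by (rule imat_carrier[OF l]) simp
  have invS: "of_int (int 4 * 3) * euler_cochain + coboundary SL2_Z_third 0 \<alpha> \<in> cochains SL2_Z_third {matS l} (Suc 0)"
    and invU: "of_int (int 6 * 2) * euler_cochain + coboundary SL2_Z_third 0 \<alpha> \<in> cochains SL2_Z_third {matU l} (Suc 0)"
    using cochains_mono[OF _ inv, of "{matS l}"] cochains_mono[OF _ inv, of "{matU l}"] by simp_all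
  note S = E.rotation_potential[OF rotation_matS[OF l] \<alpha> invS]
  note U = E.rotation_potential[OF rotation_matU[OF l] \<alpha> invU]
  have "act SL2_Z_third (matU l) \<alpha> = act SL2_Z_third T (act SL2_Z_third (matS l) \<alpha>)"
    using SL.act_mult[OF T matS_carrier[OF l]] by (simp add: matU_eq[OF l] T_def)
  also have "\<dots> = act SL2_Z_third T \<alpha> + of_int 3 * unit_cochain SL2_Z_third - of_int (int 4 * 3) * crossing (matU l)"
    unfolding S by (simp only: SL.act_linear SL.act_unit[OF T] crossing_matU[OF l, folded T_def])
  finally have "\<alpha> + of_int 2 * unit_cochain SL2_Z_third - of_int (int 6 * 2) * crossing (matU l) =
      act SL2_Z_third T \<alpha> + of_int 3 * unit_cochain SL2_Z_third - of_int (int 4 * 3) * crossing (matU l)"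
    unfolding U .
  then show ?thesis unfolding T_def[symmetric] by (simp add: algebra_simps)
qed

section \<open>Cohomology of the cyclic, vertex and edge groups\<close>

lemma mat_coh:
  "l = 1 \<or> l = 3 \<Longrightarrow> E.even_coh {matS l} 4" "l = 1 \<or> l = 3 \<Longrightarrow> E.odd_coh {matS l}"
  "l = 1 \<or> l = 3 \<Longrightarrow> E.even_coh {matU l} 6" "l = 1 \<or> l = 3 \<Longrightarrow> E.odd_coh {matU l}"
  "E.even_coh {matV} 6" "E.odd_coh {matV}" "E.even_coh {matN} 2" "E.odd_coh {matN}"
  using E.rotation_even_coh[OF rotation_matS[of l]] E.rotation_odd_coh[OF rotation_matS[of l]]
    E.rotation_even_coh[OF rotation_matU[of l]] E.rotation_odd_coh[OF rotation_matU[of l]]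
    E.rotation_even_coh[OF rotation_matV] E.rotation_odd_coh[OF rotation_matV]
    E.rotation_even_coh[OF rotation_matN] E.rotation_odd_coh[OF rotation_matN]
  by simp_all

lemma SL2Z_coh:
  assumes l: "l = 1 \<or> l = 3"
  shows "E.even_coh {matS l, matU l} 12" "E.odd_coh {matS l, matU l}"
proof -
  have g: "gcd (4::int) 6 = 2"
    by (simp add: gcd_red_int[of 4 6] gcd_red_int[of 6 4] gcd_red_int[of 4 2])
  then have "lcm (4::int) 6 = 12" by (simp add: lcm_gcd)
  with g show "E.even_coh {matS l, matU l} 12"
    using E.glued_even_coh[OF glued_SL2Z[OF l] mat_coh(1)[OF l] mat_coh(3)[OF l] mat_coh(8)] mat_coh(7)
    by (simp add: insert_commute)
  show "E.odd_coh {matS l, matU l}"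
    using E.glued_odd_coh[OF glued_SL2Z[OF l] mat_coh(2)[OF l] mat_coh(4)[OF l] mat_coh(7)]
    by (simp add: insert_commute)
qed

lemma T_commutes: "z \<in> {matN} \<Longrightarrow> matT \<otimes>\<^bsub>SL2_Z_third\<^esub> z = z \<otimes>\<^bsub>SL2_Z_third\<^esub> matT"
  by (simp add: matT_def matN_def mat2_mult)

text \<open>Adding the lower row to the upper one raises the quotient in each column by 1, and -1
  does not change it. The second column is used where the first has lower entry 0.\<close>

definition shear_height :: "(rat ^ 2 ^ 2) list \<Rightarrow> int" where
  "shear_height xs = (if xs \<in> tuples SL2_Z_third 0 then
     (let A = hd xs in if A $ 2 $ 1 \<noteq> 0 then \<lfloor>A $ 1 $ 1 / A $ 2 $ 1\<rfloor> else \<lfloor>A $ 1 $ 2 / A $ 2 $ 2\<rfloor>) else 0)"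

lemma shear_height:
  "shear_height \<in> cochains SL2_Z_third {matN} 0"
  "act SL2_Z_third matT shear_height = shear_height + unit_cochain SL2_Z_third"
proof -
  have 0: "shear_height \<in> cochains SL2_Z_third {} 0" by (simp add: cochains_def shear_height_def)
  have N: "shear_height [matN ** A] = shear_height [A]" if A: "A \<in> carrier SL2_Z_third" for A
  proof -
    have "matN ** A \<in> carrier SL2_Z_third" using SL.m_closed[OF matN_carrier A] by simp
    then show ?thesis using A
      by (simp add: shear_height_def tuples_def matrix_mult_2_nth matN_def)
  qed
  then show "shear_height \<in> cochains SL2_Z_third {matN} 0"
    using 0 by (auto simp: cochains_def tuples_0)
  have T: "shear_height [matT ** A] = shear_height [A] + 1" if A: "A \<in> carrier SL2_Z_third" for A
  proof -
    have "matT ** A \<in> carrier SL2_Z_third" using SL.m_closed[OF matT_carrier A] by simp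
    moreover have "A $ 2 $ 1 \<noteq> 0 \<or> A $ 2 $ 2 \<noteq> 0"
      using A by (auto simp: SL2_Z_third_def special_linear_group_def det_2)
    ultimately show ?thesis using A
      by (auto simp: shear_height_def tuples_def matrix_mult_2_nth matT_def add_divide_distrib)
  qed
  show "act SL2_Z_third matT shear_height = shear_height + unit_cochain SL2_Z_third"
  proof
    fix xs
    show "act SL2_Z_third matT shear_height xs = (shear_height + unit_cochain SL2_Z_third) xs"
    proof (cases "xs \<in> tuples SL2_Z_third 0")
      case True
      then show ?thesis using T by (auto simp: tuples_0 act_def unit_cochain_def)
    next
      case False
      then show ?thesis using SL.act_cochains[OF 0 matT_carrier] 0
        by (simp add: cochains_def unit_cochain_def)
    qed
  qed
qed

lemma TN_coh: "E.even_coh {matT, matN} 2"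
  by (rule E.translation_even_coh[OF matT_carrier _ T_commutes shear_height mat_coh(7,8)])
    (simp_all add: matN_carrier)

lemma \<Gamma>\<^sub>0_even_coh: "E.even_coh {matV, matT, matN} 6"
proof -
  have "{matV, matT, matN} = {matV} \<union> {matT, matN}" by auto
  moreover have "gcd (6::int) 2 = 2" "lcm (6::int) 2 = 6" by (simp_all add: lcm_int_def)
  ultimately show ?thesis
    using E.glued_even_coh[OF glued_\<Gamma>\<^sub>0 mat_coh(5) TN_coh mat_coh(8)] mat_coh(7) by metis
qed

text \<open>The factor generated by \<open>matV\<close> has no odd cohomology, so classes are
  detected on the factor of \<open>matT\<close> and \<open>matN\<close>. Invariance of
  \<open>\<tau>\<close> under \<open>matV\<close> makes its coboundary bound on the first factor;
  \<open>shear_height\<close> lacks this invariance.\<close>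

lemma \<Gamma>\<^sub>0_odd_cohomology:
  assumes \<tau>: "\<tau> \<in> cochains SL2_Z_third {matV, matN} 0"
    "act SL2_Z_third matT \<tau> = \<tau> + unit_cochain SL2_Z_third"
  shows "f \<in> cocycles SL2_Z_third {matV, matT, matN} (Suc (2 * j)) \<Longrightarrow>
      \<exists>k. f - of_int k * cup_pow SL2_Z_third E.c (Suc 0) j (coboundary SL2_Z_third 0 \<tau>)
        \<in> coboundaries SL2_Z_third {matV, matT, matN} (Suc (2 * j))"
    and "of_int k * cup_pow SL2_Z_third E.c (Suc 0) j (coboundary SL2_Z_third 0 \<tau>)
        \<in> coboundaries SL2_Z_third {matV, matT, matN} (Suc (2 * j))
      \<longleftrightarrow> (if j = 0 then k = 0 else 2 dvd k)"
proof -
  let ?C = "{matV, matT, matN}" and ?R = "{matT, matN}"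
  let ?t = "cup_pow SL2_Z_third E.c (Suc 0) j (coboundary SL2_Z_third 0 \<tau>)"
  have \<tau>N: "\<tau> \<in> cochains SL2_Z_third {matN} 0" and \<tau>V: "\<tau> \<in> cochains SL2_Z_third {matV} 0"
    using cochains_mono[OF _ \<tau>(1), of "{matN}"] cochains_mono[OF _ \<tau>(1), of "{matV}"] by simp_all
  note R = E.translation_odd_coh[OF matT_carrier _ T_commutes \<tau>N \<tau>(2) mat_coh(7,8)]
  have CR: "{matV} \<union> ?R = ?C" by auto
  have tV: "?t \<in> coboundaries SL2_Z_third {matV} (Suc (2 * j))"
    using E.cup_pow_coboundaries[OF coboundariesI[OF \<tau>V], of j] matV_carrier by simp
  have glue: "x \<in> coboundaries SL2_Z_third ?C (Suc (2 * j))"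
    if "x \<in> coboundaries SL2_Z_third {matV} (Suc (2 * j))" "x \<in> coboundaries SL2_Z_third ?R (Suc (2 * j))" for x
    using E.glued_odd_coboundary[OF glued_\<Gamma>\<^sub>0 mat_coh(7) that] unfolding CR .
  show "\<exists>k. f - of_int k * ?t \<in> coboundaries SL2_Z_third ?C (Suc (2 * j))"
    if f: "f \<in> cocycles SL2_Z_third ?C (Suc (2 * j))"
  proof -
    have "f \<in> cocycles SL2_Z_third ?R (Suc (2 * j))" by (rule cocycles_mono[OF _ f]) auto
    then obtain k where k: "f - of_int k * ?t \<in> coboundaries SL2_Z_third ?R (Suc (2 * j))"
      using R(1) matN_carrier by blast
    have "f \<in> cocycles SL2_Z_third {matV} (Suc (2 * j))" by (rule cocycles_mono[OF _ f]) auto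
    then have "f \<in> coboundaries SL2_Z_third {matV} (Suc (2 * j))" by (rule E.odd_cohD[OF mat_coh(6)])
    then have "f - of_int k * ?t \<in> coboundaries SL2_Z_third {matV} (Suc (2 * j))"
      by (rule coboundaries_linear(3)[OF _ coboundaries_linear(4)[OF tV]])
    then show ?thesis using glue k by blast
  qed
  have "of_int k * ?t \<in> coboundaries SL2_Z_third ?C (Suc (2 * j)) \<longleftrightarrow>
      of_int k * ?t \<in> coboundaries SL2_Z_third ?R (Suc (2 * j))"
    using glue[OF coboundaries_linear(4)[OF tV]] coboundaries_mono[of ?R ?C] by blast
  then show "of_int k * ?t \<in> coboundaries SL2_Z_third ?C (Suc (2 * j)) \<longleftrightarrow> (if j = 0 then k = 0 else 2 dvd k)"
    using R(2) matN_carrier by simp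
qed

text \<open>On the two vertex groups 12 times the Euler class is a coboundary, on the edge group already 6 times
  it. Comparing the primitives \<open>\<alpha>A\<close>, \<open>\<alpha>B\<close> and \<open>\<omega>\<close> along the shear \<open>matT\<close> yields a generator of the first
  cohomology of the edge group and the relation between the classes of degree two.\<close>

lemma potentials:
  obtains \<alpha>A \<alpha>B \<omega> where
    "of_int 12 * euler_cochain + coboundary SL2_Z_third 0 \<alpha>A \<in> cochains SL2_Z_third {matS 1, matU 1} (Suc 0)"
    "of_int 12 * euler_cochain + coboundary SL2_Z_third 0 \<alpha>B \<in> cochains SL2_Z_third {matS 3, matU 3} (Suc 0)"
    "of_int 6 * euler_cochain + coboundary SL2_Z_third 0 \<omega> \<in> cochains SL2_Z_third {matV, matT, matN} (Suc 0)"
    "of_int 2 * \<omega> - \<alpha>B \<in> cochains SL2_Z_third {matV, matN} 0"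
    "act SL2_Z_third matT (of_int 2 * \<omega> - \<alpha>B) = (of_int 2 * \<omega> - \<alpha>B) + unit_cochain SL2_Z_third"
    "\<alpha>A - \<alpha>B - of_int 2 * (of_int 2 * \<omega> - \<alpha>B) \<in> cochains SL2_Z_third {matV, matT, matN} 0"
proof -
  let ?G = SL2_Z_third and ?w = euler_cochain and ?e = "unit_cochain SL2_Z_third"
  have l1: "(1::rat) = 1 \<or> (1::rat) = 3" and l3: "(3::rat) = 1 \<or> (3::rat) = 3" by simp_all
  have sub: "{matS 1, matU 1} \<subseteq> carrier ?G" "{matS 3, matU 3} \<subseteq> carrier ?G" "{matV, matT, matN} \<subseteq> carrier ?G"
    using SL.glued_subset[OF glued_SL2_Z_third] by auto
  obtain \<alpha>A where \<alpha>A: "\<alpha>A \<in> cochains ?G {} 0"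
    "of_int 12 * ?w + coboundary ?G 0 \<alpha>A \<in> cochains ?G {matS 1, matU 1} (Suc 0)"
    by (rule E.multiple_of_class_potential[OF sub(1) SL2Z_coh(1)[OF l1] dvd_refl])
  obtain \<alpha>B where \<alpha>B: "\<alpha>B \<in> cochains ?G {} 0"
    "of_int 12 * ?w + coboundary ?G 0 \<alpha>B \<in> cochains ?G {matS 3, matU 3} (Suc 0)"
    by (rule E.multiple_of_class_potential[OF sub(2) SL2Z_coh(1)[OF l3] dvd_refl])
  obtain \<omega> where \<omega>: "\<omega> \<in> cochains ?G {} 0"
    "of_int 6 * ?w + coboundary ?G 0 \<omega> \<in> cochains ?G {matV, matT, matN} (Suc 0)"
    by (rule E.multiple_of_class_potential[OF sub(3) \<Gamma>\<^sub>0_even_coh dvd_refl])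
  have to: "f \<in> cochains ?G {matV} n \<and> f \<in> cochains ?G {matN} n" if "f \<in> cochains ?G {matV, matT, matN} n" for f n
    using cochains_mono[OF _ that, of "{matV}"] cochains_mono[OF _ that, of "{matN}"] by simp
  note A' = to[OF SL.glued_cochains(1)[OF glued_SL2_Z_third \<alpha>A(2)]]
  note B' = to[OF SL.glued_cochains(2)[OF glued_SL2_Z_third \<alpha>B(2)]]
  note W' = to[OF \<omega>(2)]
  \<comment> \<open>The constants are 12 and 6 divided by the order 6 of \<open>matV\<close>, and
    for \<open>matN\<close> below by the order 2.\<close>
  have V: "act ?G matV \<alpha>A = \<alpha>A + of_int 2 * ?e - of_int 12 * crossing matV"
    "act ?G matV \<alpha>B = \<alpha>B + of_int 2 * ?e - of_int 12 * crossing matV"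
    "act ?G matV \<omega> = \<omega> + of_int 1 * ?e - of_int 6 * crossing matV"
    using E.rotation_potential[OF rotation_matV \<alpha>A(1), of 2] E.rotation_potential[OF rotation_matV \<alpha>B(1), of 2]
      E.rotation_potential[OF rotation_matV \<omega>(1), of 1] A' B' W' by simp_all
  have N: "act ?G matN \<alpha>A = \<alpha>A + of_int 6 * ?e - of_int 12 * crossing matN"
    "act ?G matN \<alpha>B = \<alpha>B + of_int 6 * ?e - of_int 12 * crossing matN"
    "act ?G matN \<omega> = \<omega> + of_int 3 * ?e - of_int 6 * crossing matN"
    using E.rotation_potential[OF rotation_matN \<alpha>A(1), of 6] E.rotation_potential[OF rotation_matN \<alpha>B(1), of 6]
      E.rotation_potential[OF rotation_matN \<omega>(1), of 3] A' B' W' by simp_all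
  have TA: "act ?G matT \<alpha>A = \<alpha>A - ?e"
    using potential_shear[OF l1 \<alpha>A] by (simp add: matT_imat(1))
  \<comment> \<open>In the second vertex group \<open>matT\<close> is the cube of the elementary
    shear, so the change -1 occurs three times.\<close>
  have TB: "act ?G matT \<alpha>B = \<alpha>B - of_int 3 * ?e"
  proof -
    let ?T = "imat 3 1 1 0 1"
    have T: "?T \<in> carrier ?G" by (rule imat_carrier[OF l3]) simp
    have "matT = ?T ** (?T ** ?T)" by (simp add: matT_imat(2) imat_mult)
    then have "act ?G matT \<alpha>B = act ?G ?T (act ?G ?T (act ?G ?T \<alpha>B))"
      using SL.m_closed[OF T T] by (simp add: SL.act_mult T matrix_mul_assoc)
    then show ?thesis
      unfolding potential_shear[OF l3 \<alpha>B] SL.act_linear SL.act_unit[OF T] by simp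
  qed
  \<comment> \<open>The Euler cochain is fixed by \<open>matT\<close>, so \<open>\<omega>\<close>
    changes by a constant; its value depends on the choice of \<open>\<omega>\<close> and is
    normalised below.\<close>
  obtain k where TW: "act ?G matT \<omega> = \<omega> + of_int k * ?e"
  proof -
    have "act ?G matT (of_int 6 * ?w + coboundary ?G 0 \<omega>) = of_int 6 * ?w + coboundary ?G 0 \<omega>"
      by (rule SL.cochains_act_eq[OF \<omega>(2)]) simp
    then have "coboundary ?G 0 (act ?G matT \<omega> - \<omega>) = 0"
      using act_matT_euler_cochain[OF l1]
      by (simp add: SL.act_linear SL.act_coboundary[OF matT_carrier] matT_imat(1)[symmetric] coboundary_linear
          del: of_int_numeral)
    then have "act ?G matT \<omega> - \<omega> \<in> cocycles ?G {} 0"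
      using SL.act_cochains[OF \<omega>(1) matT_carrier] \<omega>(1) by (intro cocyclesI cochains_diff)
    then obtain k where "act ?G matT \<omega> - \<omega> = of_int k * ?e" by (rule SL.cocycles_0_constant)
    then show ?thesis using that[of k] by (simp add: algebra_simps)
  qed
  define \<eta> where "\<eta> = \<alpha>A - \<alpha>B"
  have \<eta>: "act ?G matV \<eta> = \<eta>" "act ?G matN \<eta> = \<eta>" "act ?G matT \<eta> = \<eta> + of_int 2 * ?e"
    by (simp_all add: \<eta>_def SL.act_linear V N TA TB)
  \<comment> \<open>Under \<open>matT\<close> the cochain \<open>2 \<omega> - \<alpha>B\<close>
    changes by the odd number 2 k + 3 and \<open>\<eta>\<close> by 2; this \<open>s\<close> leaves
    exactly 1 for \<open>\<sigma>\<close>.\<close>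
  define s where "s = k + 1"
  define \<sigma> where "\<sigma> = of_int 2 * \<omega> - \<alpha>B - of_int s * \<eta>"
  have \<sigma>: "act ?G matV \<sigma> = \<sigma>" "act ?G matN \<sigma> = \<sigma>" "act ?G matT \<sigma> = \<sigma> + ?e"
    by (simp_all only: \<sigma>_def SL.act_linear \<eta> V N TB TW) (simp_all add: s_def algebra_simps)
  \<comment> \<open>The same \<open>s\<close> turns the change k of \<open>\<omega>\<close> into -1,
    so that \<open>2 \<omega>' - \<alpha>B\<close> changes by -2 + 3 = 1.\<close>
  define \<omega>' where "\<omega>' = \<omega> - of_int s * \<sigma>"
  define \<tau> where "\<tau> = of_int 2 * \<omega>' - \<alpha>B"
  have \<tau>: "act ?G matV \<tau> = \<tau>" "act ?G matN \<tau> = \<tau>" "act ?G matT \<tau> = \<tau> + ?e"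
    by (simp_all only: \<tau>_def \<omega>'_def SL.act_linear \<sigma> V N TB TW) (simp_all add: s_def algebra_simps)
  have \<eta>0: "\<eta> \<in> cochains ?G {} 0" unfolding \<eta>_def by (intro cochains_diff \<alpha>A(1) \<alpha>B(1))
  have \<sigma>0: "\<sigma> \<in> cochains ?G {} 0"
    unfolding \<sigma>_def by (intro cochains_diff cochains_of_int_mult \<alpha>B(1) \<omega>(1) \<eta>0)
  have \<tau>0: "\<tau> \<in> cochains ?G {} 0"
    unfolding \<tau>_def \<omega>'_def by (intro cochains_diff cochains_of_int_mult \<alpha>B(1) \<omega>(1) \<sigma>0)
  show ?thesis
  proof (rule that[OF \<alpha>A(2) \<alpha>B(2), of \<omega>', folded \<tau>_def, folded \<eta>_def])
    have "coboundary ?G 0 \<sigma> \<in> cochains ?G {matV, matT, matN} (Suc 0)"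
    proof (rule SL.cochainsI_act)
      show "coboundary ?G 0 \<sigma> \<in> cochains ?G {} (Suc 0)" by (rule SL.coboundary_cochains[OF \<sigma>0]) simp
      show "act ?G z (coboundary ?G 0 \<sigma>) = coboundary ?G 0 \<sigma>" if "z \<in> {matV, matT, matN}" for z
        using that sub(3) \<sigma> by (auto simp: SL.act_coboundary coboundary_add)
    qed
    then have "of_int 6 * ?w + coboundary ?G 0 \<omega> - of_int s * coboundary ?G 0 \<sigma>
        \<in> cochains ?G {matV, matT, matN} (Suc 0)"
      by (intro cochains_diff[OF \<omega>(2)] cochains_of_int_mult)
    then show "of_int 6 * ?w + coboundary ?G 0 \<omega>' \<in> cochains ?G {matV, matT, matN} (Suc 0)"
      by (simp only: \<omega>'_def coboundary_linear) (simp add: algebra_simps)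
    show "\<tau> \<in> cochains ?G {matV, matN} 0"
      by (rule SL.cochainsI_act[OF \<tau>0]) (use \<tau> in auto)
    show "act ?G matT \<tau> = \<tau> + ?e" by (rule \<tau>(3))
    show "\<eta> - of_int 2 * \<tau> \<in> cochains ?G {matV, matT, matN} 0"
    proof (rule SL.cochainsI_act)
      show "\<eta> - of_int 2 * \<tau> \<in> cochains ?G {} 0" by (intro cochains_diff cochains_of_int_mult \<eta>0 \<tau>0)
      show "act ?G z (\<eta> - of_int 2 * \<tau>) = \<eta> - of_int 2 * \<tau>" if "z \<in> {matV, matT, matN}" for z
        using that by (auto simp only: insert_iff empty_iff SL.act_linear \<eta> \<tau>) (simp_all add: algebra_simps)
    qed
  qed
qed

section \<open>The whole group and the resulting cohomology groups\<close>

lemma cochains_generators: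
  "cochains SL2_Z_third ({matS 1, matU 1} \<union> {matS 3, matU 3}) n = cochains SL2_Z_third (carrier SL2_Z_third) n"
proof -
  let ?K = "{matS 1, matU 1} \<union> {matS 3, matU 3}"
  have sub: "?K \<subseteq> carrier SL2_Z_third" using matS_carrier matU_carrier by auto
  have "f \<in> cochains SL2_Z_third (carrier SL2_Z_third) n" if "f \<in> cochains SL2_Z_third ?K n" for f
    using SL.cochains_generate[OF sub that] by (simp only: generate_SL2_Z_third)
  then show ?thesis using cochains_mono[OF sub] by blast
qed

lemma cocycles_generators:
  "cocycles SL2_Z_third ({matS 1, matU 1} \<union> {matS 3, matU 3}) n = cocycles SL2_Z_third (carrier SL2_Z_third) n"
  by (simp only: cocycles_def cochains_generators)

lemma coboundaries_generators:
  "coboundaries SL2_Z_third ({matS 1, matU 1} \<union> {matS 3, matU 3}) n = coboundaries SL2_Z_third (carrier SL2_Z_third) n"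
  by (simp only: coboundaries_def cochains_generators)

lemma odd_cohomology:
  assumes "odd i"
  shows "trivial_group (group_cohomology SL2_Z_third i)"
proof (rule SL.trivial_group_cohomology)
  obtain j where i: "i = Suc (2 * j)" using assms by (auto elim: oddE)
  have "E.odd_coh ({matS 1, matU 1} \<union> {matS 3, matU 3})"
    by (rule E.glued_odd_coh[OF glued_SL2_Z_third SL2Z_coh(2) SL2Z_coh(2) \<Gamma>\<^sub>0_even_coh]) simp_all
  then show "cocycles SL2_Z_third (carrier SL2_Z_third) i \<subseteq> coboundaries SL2_Z_third (carrier SL2_Z_third) i"
    unfolding E.odd_coh_def cocycles_generators coboundaries_generators i by blast
qed

lemma even_cohomology:
  obtains l where "l \<in> cocycles SL2_Z_third (carrier SL2_Z_third) 2"
    "\<And>j f. f \<in> cocycles SL2_Z_third (carrier SL2_Z_third) (2 * Suc j) \<Longrightarrow>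
       \<exists>x y. f - of_int x * E.cp (Suc j) - of_int y * cup_pow SL2_Z_third E.c 2 j l
         \<in> coboundaries SL2_Z_third (carrier SL2_Z_third) (2 * Suc j)"
    "\<And>j x y. of_int x * E.cp (Suc j) + of_int y * cup_pow SL2_Z_third E.c 2 j l
         \<in> coboundaries SL2_Z_third (carrier SL2_Z_third) (2 * Suc j)
       \<longleftrightarrow> (if j = 0 then \<exists>s. x = 12 * s \<and> y = - 4 * s else 12 dvd x \<and> 4 dvd y)"
proof -
  let ?G = SL2_Z_third and ?w = euler_cochain
  obtain \<alpha>A \<alpha>B \<omega> where pot:
    "of_int 12 * ?w + coboundary ?G 0 \<alpha>A \<in> cochains ?G {matS 1, matU 1} (Suc 0)"
    "of_int 12 * ?w + coboundary ?G 0 \<alpha>B \<in> cochains ?G {matS 3, matU 3} (Suc 0)"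
    "of_int 6 * ?w + coboundary ?G 0 \<omega> \<in> cochains ?G {matV, matT, matN} (Suc 0)"
    "of_int 2 * \<omega> - \<alpha>B \<in> cochains ?G {matV, matN} 0"
    "act ?G matT (of_int 2 * \<omega> - \<alpha>B) = (of_int 2 * \<omega> - \<alpha>B) + unit_cochain ?G"
    "\<alpha>A - \<alpha>B - of_int 2 * (of_int 2 * \<omega> - \<alpha>B) \<in> cochains ?G {matV, matT, matN} 0"
    by (rule potentials)
  define \<tau> where "\<tau> = of_int 2 * \<omega> - \<alpha>B"
  note C = \<Gamma>\<^sub>0_odd_cohomology[OF pot(4,5), folded \<tau>_def]
  have d: "coboundary ?G (Suc 0) (of_int k * ?w + coboundary ?G 0 \<alpha>) = of_int k * E.c" for k \<alpha>
    by (simp add: coboundary_linear E.c_def)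
  have t: "coboundary ?G 0 \<tau> = of_int 2 * (of_int 6 * ?w + coboundary ?G 0 \<omega>) - (of_int 12 * ?w + coboundary ?G 0 \<alpha>B)"
    by (simp only: \<tau>_def coboundary_linear) (simp add: algebra_simps)
  have "(of_int 12 * ?w + coboundary ?G 0 \<alpha>A) - (of_int 12 * ?w + coboundary ?G 0 \<alpha>B) - of_int 2 * coboundary ?G 0 \<tau>
      = coboundary ?G 0 (\<alpha>A - \<alpha>B - of_int 2 * \<tau>)"
    by (simp only: coboundary_linear) (simp add: algebra_simps)
  then have dt: "(of_int 12 * ?w + coboundary ?G 0 \<alpha>A) - (of_int 12 * ?w + coboundary ?G 0 \<alpha>B) - of_int 2 * coboundary ?G 0 \<tau>
      \<in> coboundaries ?G {matV, matT, matN} (Suc 0)"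
    using coboundariesI[OF pot(6)] by (simp only: \<tau>_def)
  show ?thesis
    by (rule E.amalgam_even_cohomology[OF glued_SL2_Z_third SL2Z_coh(1) SL2Z_coh(2) SL2Z_coh(1) SL2Z_coh(2)
          \<Gamma>\<^sub>0_even_coh pot(1) d pot(2) d pot(3) d t dt C,
          unfolded cocycles_generators coboundaries_generators])
      (simp_all only: that, simp_all)
qed

text \<open>By the relation 12 c = 4 l the class l - 3 c has order 4, and c generates an infinite
  cyclic complement. The isomorphism sends c to (1, 0) and l to (3, 1).\<close>

lemma second_cohomology:
  "group_cohomology SL2_Z_third 2 \<cong> integer_group \<times>\<times> integer_mod_group 4"
proof -
  obtain l where l: "l \<in> cocycles SL2_Z_third (carrier SL2_Z_third) 2"
    "\<And>j f. f \<in> cocycles SL2_Z_third (carrier SL2_Z_third) (2 * Suc j) \<Longrightarrow>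
       \<exists>x y. f - of_int x * E.cp (Suc j) - of_int y * cup_pow SL2_Z_third E.c 2 j l
         \<in> coboundaries SL2_Z_third (carrier SL2_Z_third) (2 * Suc j)"
    "\<And>j x y. of_int x * E.cp (Suc j) + of_int y * cup_pow SL2_Z_third E.c 2 j l
         \<in> coboundaries SL2_Z_third (carrier SL2_Z_third) (2 * Suc j)
       \<longleftrightarrow> (if j = 0 then \<exists>s. x = 12 * s \<and> y = - 4 * s else 12 dvd x \<and> 4 dvd y)"
    by (rule even_cohomology) blast
  have two: "2 * Suc 0 = 2" by simp
  have rel: "(\<exists>s. x = 12 * s \<and> y = - 4 * s) \<longleftrightarrow> x + 3 * y = 0 \<and> y mod 4 = 0" for x y :: int
    by presburger
  show ?thesis
  proof (rule SL.group_cohomology_iso_generators[where h = "\<lambda>x y. (x + 3 * y, y mod 4)", OF _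
        E.cp_cocycle[OF subset_refl, of "Suc 0", unfolded two] l(1)])
    show "group (integer_group \<times>\<times> integer_mod_group 4)" by (simp add: DirProd_group)
    show "\<exists>x y. f - of_int x * E.cp (Suc 0) - of_int y * l \<in> coboundaries SL2_Z_third (carrier SL2_Z_third) 2"
      if "f \<in> cocycles SL2_Z_third (carrier SL2_Z_third) 2" for f
      using l(2)[of f 0, unfolded two] that by simp
    show "of_int x * E.cp (Suc 0) + of_int y * l \<in> coboundaries SL2_Z_third (carrier SL2_Z_third) 2 \<longleftrightarrow>
        (x + 3 * y, y mod 4) = \<one>\<^bsub>integer_group \<times>\<times> integer_mod_group 4\<^esub>" for x y
      using l(3)[of x 0 y, unfolded two] rel[of x y] by (simp add: one_DirProd)
    show "(x + 3 * y, y mod 4) \<in> carrier (integer_group \<times>\<times> integer_mod_group 4)" for x y :: int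
      by (simp add: carrier_integer_mod_group)
    show "(x + x' + 3 * (y + y'), (y + y') mod 4) =
        (x + 3 * y, y mod 4) \<otimes>\<^bsub>integer_group \<times>\<times> integer_mod_group 4\<^esub> (x' + 3 * y', y' mod 4)" for x y x' y' :: int
      by (simp add: mod_add_eq)
    show "\<exists>x y. (x + 3 * y, y mod 4) = u" if "u \<in> carrier (integer_group \<times>\<times> integer_mod_group 4)" for u :: "int \<times> int"
      by (rule exI[of _ "fst u - 3 * snd u"], rule exI[of _ "snd u"])
        (use that in \<open>auto simp: carrier_integer_mod_group\<close>)
  qed
qed

lemma higher_even_cohomology:
  assumes "j > 1"
  shows "group_cohomology SL2_Z_third (2 * j) \<cong> integer_mod_group 12 \<times>\<times> integer_mod_group 4"
proof -
  obtain l where l: "l \<in> cocycles SL2_Z_third (carrier SL2_Z_third) 2"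
    "\<And>j f. f \<in> cocycles SL2_Z_third (carrier SL2_Z_third) (2 * Suc j) \<Longrightarrow>
       \<exists>x y. f - of_int x * E.cp (Suc j) - of_int y * cup_pow SL2_Z_third E.c 2 j l
         \<in> coboundaries SL2_Z_third (carrier SL2_Z_third) (2 * Suc j)"
    "\<And>j x y. of_int x * E.cp (Suc j) + of_int y * cup_pow SL2_Z_third E.c 2 j l
         \<in> coboundaries SL2_Z_third (carrier SL2_Z_third) (2 * Suc j)
       \<longleftrightarrow> (if j = 0 then \<exists>s. x = 12 * s \<and> y = - 4 * s else 12 dvd x \<and> 4 dvd y)"
    by (rule even_cohomology) blast
  obtain i where i: "j = Suc i" "i \<noteq> 0" using assms by (cases j) auto
  have cl: "cup_pow SL2_Z_third E.c 2 i l \<in> cocycles SL2_Z_third (carrier SL2_Z_third) (2 * Suc i)"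
    using E.cup_pow_cocycles[OF l(1) subset_refl, of i] by simp
  show ?thesis
    unfolding i(1)
  proof (rule SL.group_cohomology_iso_generators[where h = "\<lambda>x y. (x mod 12, y mod 4)", OF _
        E.cp_cocycle[OF subset_refl] cl])
    show "group (integer_mod_group 12 \<times>\<times> integer_mod_group 4)" by (simp add: DirProd_group)
    show "\<exists>x y. f - of_int x * E.cp (Suc i) - of_int y * cup_pow SL2_Z_third E.c 2 i l
        \<in> coboundaries SL2_Z_third (carrier SL2_Z_third) (2 * Suc i)"
      if "f \<in> cocycles SL2_Z_third (carrier SL2_Z_third) (2 * Suc i)" for f
      by (rule l(2)[OF that])
    show "of_int x * E.cp (Suc i) + of_int y * cup_pow SL2_Z_third E.c 2 i l
          \<in> coboundaries SL2_Z_third (carrier SL2_Z_third) (2 * Suc i) \<longleftrightarrow>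
        (x mod 12, y mod 4) = \<one>\<^bsub>integer_mod_group 12 \<times>\<times> integer_mod_group 4\<^esub>" for x y
      unfolding l(3) using i(2) by (simp add: one_DirProd dvd_eq_mod_eq_0)
    show "(x mod 12, y mod 4) \<in> carrier (integer_mod_group 12 \<times>\<times> integer_mod_group 4)" for x y :: int
      by (simp add: carrier_integer_mod_group)
    show "((x + x') mod 12, (y + y') mod 4) =
        (x mod 12, y mod 4) \<otimes>\<^bsub>integer_mod_group 12 \<times>\<times> integer_mod_group 4\<^esub> (x' mod 12, y' mod 4)" for x y x' y' :: int
      by (simp add: mod_add_eq)
    show "\<exists>x y. (x mod 12, y mod 4) = u" if "u \<in> carrier (integer_mod_group 12 \<times>\<times> integer_mod_group 4)" for u :: "int \<times> int"
      by (rule exI[of _ "fst u"], rule exI[of _ "snd u"])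
        (use that in \<open>auto simp: carrier_integer_mod_group\<close>)
  qed
qed

theorem mainTheorem2:
  fixes i :: nat
  shows "(odd i \<longrightarrow> trivial_group (group_cohomology SL2_Z_third i)) \<and>
         (i = 2 \<longrightarrow>
            group_cohomology SL2_Z_third i \<cong> integer_group \<times>\<times> integer_mod_group 4) \<and>
         (\<forall>j::nat. j > 1 \<and> i = 2 * j \<longrightarrow>
            group_cohomology SL2_Z_third i \<cong> integer_mod_group 12 \<times>\<times> integer_mod_group 4)"
proof (intro conjI impI allI)
  show "trivial_group (group_cohomology SL2_Z_third i)" if "odd i"
    using that by (rule odd_cohomology)
  show "group_cohomology SL2_Z_third i \<cong> integer_group \<times>\<times> integer_mod_group 4" if "i = 2"
    unfolding that by (rule second_cohomology)
  show "group_cohomology SL2_Z_third i \<cong> integer_mod_group 12 \<times>\<times> integer_mod_group 4"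
    if "j > 1 \<and> i = 2 * j" for j
    using that higher_even_cohomology[of j] by simp
qed

end
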